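(* Let $c,d\in\mathbb{Z}\setminus\{0\}$. Then there exist a standard probability space $(X,\mathcal{B},\mu)$, two mixing, (invertible) measure preserving transformations $T,S$ of $(X,\mathcal{B},\mu)$ with zero measure-theoretic entropy, $h_\mu(X,T)=h_\mu(X,S)=0$, and a set $A\in\mathcal{B}$ with $\mu(A)>0$, such that for all $n\in\mathbb{N}$, \[ A\cap T^{-cn}A\cap S^{-dn}A=\emptyset . \]
   Context: $\mathbb{N}=\{1,2,3,\dots\}$. $h_\mu(X,T)$ denotes the Kolmogorov–Sinai entropy of $T$ with respect to $\mu$. The transformations $T$ and $S$ are not assumed to commute. A measure preserving transformation $T$ is mixing if $\mu(B_1\cap T^{-n}B_2)\to\mu(B_1)\mu(B_2)$ as $n\to\infty$ for all $B_1,B_2\in\mathcal{B}$. Transformations are invertible, so that $T^{-cn}A$ and $S^{-dn}A$ make sense also when $c<0$ or $d<0$. *)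

theory Defs
  imports "HOL-Probability.Probability"
begin

text \<open>A probability measure on the Borel sigma-algebra of a Polish space. The topology is
  existentially quantified, so it need not be related to any type class topology on the type of
  points.\<close>

definition standard_probability_space :: "'a measure \<Rightarrow> bool" where
  "standard_probability_space M \<longleftrightarrow>
     prob_space M \<and>
     (\<exists>X. completely_metrizable_space X \<and> separable_space X \<and> topspace X = space M \<and>
          sets M = sigma_sets (topspace X) {U. openin X U})"

definition invertible_mpt :: "'a measure \<Rightarrow> ('a \<Rightarrow> 'a) \<Rightarrow> bool" where
  "invertible_mpt M T \<longleftrightarrow>
     bij_betw T (space M) (space M) \<and>
     T \<in> measurable M M \<and>
     inv_into (space M) T \<in> measurable M M \<and>
     distr M M T = M"

definition int_iterate :: "'a measure \<Rightarrow> ('a \<Rightarrow> 'a) \<Rightarrow> int \<Rightarrow> 'a \<Rightarrow> 'a" where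
  "int_iterate M T k =
     (if k \<ge> 0 then T ^^ nat k else inv_into (space M) T ^^ nat (- k))"

text \<open>The preimage of \<open>A\<close> under the \<open>k\<close>-th power of \<open>T\<close>, i.e. \<open>T\<close> to the power \<open>-k\<close>
  applied to \<open>A\<close>.\<close>

definition iterate_preimage :: "'a measure \<Rightarrow> ('a \<Rightarrow> 'a) \<Rightarrow> int \<Rightarrow> 'a set \<Rightarrow> 'a set" where
  "iterate_preimage M T k A = int_iterate M T k -` A \<inter> space M"

definition mixing :: "'a measure \<Rightarrow> ('a \<Rightarrow> 'a) \<Rightarrow> bool" where
  "mixing M T \<longleftrightarrow>
     (\<forall>B1\<in>sets M. \<forall>B2\<in>sets M.
        (\<lambda>n. measure M (B1 \<inter> iterate_preimage M T (int n) B2))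
          \<longlonglongrightarrow> measure M B1 * measure M B2)"

text \<open>Partitions may contain the empty set, which contributes nothing to the entropy.\<close>

definition finite_partition :: "'a measure \<Rightarrow> 'a set set \<Rightarrow> bool" where
  "finite_partition M P \<longleftrightarrow>
     finite P \<and> P \<subseteq> sets M \<and> disjoint P \<and> \<Union>P = space M"

definition partition_entropy :: "'a measure \<Rightarrow> 'a set set \<Rightarrow> real" where
  "partition_entropy M P = - (\<Sum>A\<in>P. measure M A * ln (measure M A))"

definition partition_join :: "'a set set \<Rightarrow> 'a set set \<Rightarrow> 'a set set" where
  "partition_join P Q = {A \<inter> B | A B. A \<in> P \<and> B \<in> Q}"

text \<open>The join of the preimages of \<open>P\<close> under the powers of \<open>T\<close> with exponents \<open>0, \<dots>, n - 1\<close>.\<close>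

primrec iterated_join :: "'a measure \<Rightarrow> ('a \<Rightarrow> 'a) \<Rightarrow> 'a set set \<Rightarrow> nat \<Rightarrow> 'a set set" where
  "iterated_join M T P 0 = {space M}"
| "iterated_join M T P (Suc n) =
     partition_join (iterated_join M T P n) (iterate_preimage M T (int n) ` P)"

text \<open>The limit exists for every measure preserving \<open>T\<close> by subadditivity.\<close>

definition entropy_wrt_partition :: "'a measure \<Rightarrow> ('a \<Rightarrow> 'a) \<Rightarrow> 'a set set \<Rightarrow> real" where
  "entropy_wrt_partition M T P =
     lim (\<lambda>n. partition_entropy M (iterated_join M T P n) / real n)"

definition KS_entropy :: "'a measure \<Rightarrow> ('a \<Rightarrow> 'a) \<Rightarrow> ereal" where
  "KS_entropy M T = (SUP P\<in>{P. finite_partition M P}. ereal (entropy_wrt_partition M T P))"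

end

theory Submission
  imports Defs
begin

text \<open>Let \<open>(x n)\<close> be a stationary centred Gaussian process with unit variance and covariance \<open>cov\<close>, on
  its path space. The map \<open>reflect\<close>, \<open>x j \<mapsto> 2 * cov j * x 0 - x j\<close>, preserves the law of the process
  and fixes \<open>x 0\<close>. Let \<open>T\<close> be a power of the shift, let \<open>S\<close> be a power of the shift conjugated by
  \<open>reflect\<close>, with exponents such that \<open>T\<close> to the power \<open>c * n\<close> and \<open>S\<close> to the power \<open>d * n\<close> use the
  same shift by \<open>q\<close>, and let \<open>A\<close> be the event \<open>1 < x 0 < 2\<close>. A path \<open>x\<close> in the triple intersection
  satisfies \<open>1 < x q\<close> and \<open>1 < 2 * cov q * x 0 - x q\<close>, hence \<open>2 < 2 * cov q * x 0\<close>, which is impossible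
  if \<open>cov q < 1 / 2\<close>.

  The spectral measure of the process is the law of the random sum of \<open>\<plusminus> angle k\<close> with independent fair
  signs, so \<open>cov n\<close> is the product of the numbers \<open>cos (n * angle k)\<close>. The ratio \<open>129 / 2\<close> of consecutive
  angles is not an integer, and an Erdos-Salem type argument shows that \<open>cov\<close> tends to \<open>0\<close>: the
  shift is mixing. The ratio is also large, so the spectrum lives on a very thin Cantor set, and up to
  small errors a window of length \<open>n\<close> of the process is a function of \<open>O(sqrt n)\<close> independent normal
  variables. Quantizing these variables gives \<open>exp (o(n))\<close> tubes carrying almost all paths: the
  entropy is zero.\<close>

section \<open>Names, codes and entropy\<close>

text \<open>Zero entropy is the demand that shapes the construction. With independent normal
  \<open>x n\<close> the same reflection already works, since then \<open>cov q = 0\<close> for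
  \<open>q \<noteq> 0\<close>, but that shift has infinite entropy. A thin spectrum lowers the
  entropy and endangers mixing, which needs \<open>cov\<close> to tend to \<open>0\<close>; the
  ratio of the angles has to serve both ends. Its size enters through an error count: a window of
  length \<open>n\<close> near \<open>4 ^ K\<close> is described by \<open>2 ^ K\<close> normal
  variables, the mean error at one time is of order \<open>n * (4 / 129) ^ K\<close>, and a union
  bound over the window costs another factor \<open>n\<close>. Since
  \<open>4 / 129 < 1 / 32\<close>, a total of order \<open>16 ^ K / 32 ^ K\<close> remains, which
  tends to \<open>0\<close>.

  Gaussian processes are convenient because their law depends on the covariance alone, so a linear
  change of the coordinates only has to respect \<open>cov\<close>. The maps \<open>T\<close> and
  \<open>S\<close> cannot commute here: multiple recurrence for commuting transformations would give
  some \<open>n\<close> with a triple intersection of positive measure.\<close>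

definition name_cylinder :: "'a measure \<Rightarrow> ('a \<Rightarrow> 'a) \<Rightarrow> nat \<Rightarrow> (nat \<Rightarrow> 'a set) \<Rightarrow> 'a set" where
  "name_cylinder M T n w = {x \<in> space M. \<forall>i<n. (T ^^ i) x \<in> w i}"

lemma iterate_preimage_nat: "iterate_preimage M T (int i) B = {x \<in> space M. (T ^^ i) x \<in> B}"
  by (auto simp: iterate_preimage_def int_iterate_def)

text \<open>Indexing the cells by words turns sums over the join into sums over words, where weights
  of product form factorize over the positions. Different words may give the same empty
  cell.\<close>

lemma iterated_join_eq:
  "iterated_join M T P n = name_cylinder M T n ` ({..<n} \<rightarrow>\<^sub>E P)"
proof (induction n)
  case 0
  then show ?case by (auto simp: name_cylinder_def)
next
  case (Suc n)
  have eq: "name_cylinder M T (Suc n) w = name_cylinder M T n (restrict w {..<n}) \<inter>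
      iterate_preimage M T (int n) (w n)" for w
    unfolding iterate_preimage_nat by (auto simp: name_cylinder_def less_Suc_eq)
  show ?case
  proof (intro equalityI subsetI)
    fix A assume "A \<in> iterated_join M T P (Suc n)"
    then obtain w B where w: "w \<in> {..<n} \<rightarrow>\<^sub>E P" "B \<in> P"
      and A: "A = name_cylinder M T n w \<inter> iterate_preimage M T (int n) B"
      by (auto simp: partition_join_def Suc.IH)
    have "restrict (w(n := B)) {..<n} = w"
      using w by (auto simp: restrict_def fun_eq_iff PiE_def extensional_def)
    then have "A = name_cylinder M T (Suc n) (w(n := B))"
      unfolding eq A by simp
    moreover have "w(n := B) \<in> {..<Suc n} \<rightarrow>\<^sub>E P"
      using w by (auto simp: PiE_def Pi_def extensional_def less_Suc_eq)
    ultimately show "A \<in> name_cylinder M T (Suc n) ` ({..<Suc n} \<rightarrow>\<^sub>E P)" by blast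
  next
    fix A assume "A \<in> name_cylinder M T (Suc n) ` ({..<Suc n} \<rightarrow>\<^sub>E P)"
    then obtain w where w: "w \<in> {..<Suc n} \<rightarrow>\<^sub>E P" and A: "A = name_cylinder M T (Suc n) w"
      by blast
    have "restrict w {..<n} \<in> {..<n} \<rightarrow>\<^sub>E P" "w n \<in> P"
      using w by (auto simp: PiE_def Pi_def extensional_def)
    then show "A \<in> iterated_join M T P (Suc n)"
      unfolding A eq iterated_join.simps partition_join_def Suc.IH by blast
  qed
qed

lemma funpow_measurable: "T \<in> measurable M M \<Longrightarrow> (T ^^ i) \<in> measurable M M"
  by (induction i) (auto intro: measurable_comp simp: id_def)

lemma measure_funpow_vimage:
  assumes T: "T \<in> measurable M M" "distr M M T = M" and B: "B \<in> sets M"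
  shows "measure M ((T ^^ i) -` B \<inter> space M) = measure M B"
proof -
  have "distr M M (T ^^ i) = M"
  proof (induction i)
    case 0
    then show ?case by (simp add: id_def distr_id)
  next
    case (Suc i)
    have "distr M M (T ^^ Suc i) = distr (distr M M (T ^^ i)) M T"
      using T funpow_measurable[OF T(1)] by (simp add: distr_distr)
    then show ?case using Suc T by (simp add: comp_def)
  qed
  then show ?thesis
    using measure_distr[OF funpow_measurable[OF T(1)] B, of i] by simp
qed

text \<open>Gibbs' inequality for a single term. The summand \<open>q - p\<close> is kept because
  the weights \<open>q\<close> will only be known to have sum at most \<open>1\<close>.\<close>

lemma entropy_term_le:
  fixes p q :: real
  assumes "0 \<le> p" "0 < q"
  shows "- (p * ln p) \<le> p * (- ln q) + q - p"
proof (cases "p = 0")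
  case False
  then have p: "p > 0" using assms by simp
  have "ln (q / p) \<le> q / p - 1" using p assms by (intro ln_le_minus_one) simp
  then have "p * (ln q - ln p) \<le> p * (q / p - 1)"
    using p assms by (simp add: ln_div)
  also have "\<dots> = q - p" using p by (simp add: field_simps)
  finally show ?thesis by (simp add: algebra_simps)
qed (use assms in auto)

text \<open>In product form, the weights of all words add up to a product over positions of sums
  over letters.\<close>

lemma card_mismatch_weight:
  fixes z :: real and n :: nat
  shows "(\<Prod>i<n. if w i = s i then 1 else z) = z ^ card {i\<in>{..<n}. w i \<noteq> s i}"
proof -
  have "{i\<in>{..<n}. w i \<noteq> s i} = {..<n} \<inter> - {i. w i = s i}" by auto
  then show ?thesis by (simp add: prod.If_cases)
qed

text \<open>The entropy of the names is at most the expected length of a code that sends the index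
  of the class of \<open>x\<close> and then corrects the positions where the name of \<open>x\<close> differs from the
  representative name \<open>s C\<close> of this class. The weight \<open>q\<close> below is the sub-probability vector
  belonging to this code.\<close>

lemma partition_entropy_join_le:
  fixes z :: real
  assumes M: "prob_space M" and T: "T \<in> measurable M M" "distr M M T = M"
    and P: "finite_partition M P" and E: "E \<in> sets M"
    and \<C>: "finite \<C>" "\<C> \<noteq> {}" "\<C> \<subseteq> sets M"
    and s: "\<And>C i. s C i \<in> P"
    and agree: "\<And>C x i B. C \<in> \<C> \<Longrightarrow> x \<in> C \<Longrightarrow> i < n \<Longrightarrow> (T ^^ i) x \<in> E \<Longrightarrow> (T ^^ i) x \<in> s C i"
    and z: "0 < z" "z < 1"
  shows "partition_entropy M (iterated_join M T P n) \<le>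
     ln (card \<C>) + real n * (card P * z) +
     ln (1 / z) * (real n * measure M (space M - \<Union>\<C>) + real n * measure M (space M - E))"
proof -
  interpret prob_space M by fact
  let ?W = "{..<n} \<rightarrow>\<^sub>E P"
  let ?cyl = "name_cylinder M T n"
  have finP: "finite P" and PM: "P \<subseteq> sets M" and disj: "disjoint P" and UP: "\<Union>P = space M"
    using P by (auto simp: finite_partition_def)
  have finW: "finite ?W" using finP by (intro finite_PiE) auto
  have Tx: "(T ^^ i) x \<in> space M" if "x \<in> space M" for i x
    using funpow_measurable[OF T(1), of i] that by (auto simp: measurable_def)
  have cyl_sets: "?cyl w \<in> sets M" if "w \<in> ?W" for w
  proof -
    have "?cyl w = (\<Inter>i\<in>{..<n}. (T ^^ i) -` w i \<inter> space M)" if "n > 0"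
      using that by (auto simp: name_cylinder_def)
    moreover have "(T ^^ i) -` w i \<inter> space M \<in> sets M" if "i < n" for i
      using that \<open>w \<in> ?W\<close> PM by (intro measurable_sets[OF funpow_measurable[OF T(1)]]) auto
    then have "(\<Inter>i\<in>{..<n}. (T ^^ i) -` w i \<inter> space M) \<in> sets M" if "n > 0"
      using that by (intro sets.finite_INT) auto
    ultimately show ?thesis
      by (cases "n = 0") (simp_all add: name_cylinder_def)
  qed
  have cyl_unique: "w = w'" if "w \<in> ?W" "w' \<in> ?W" "x \<in> ?cyl w" "x \<in> ?cyl w'" for w w' x
  proof (rule PiE_ext[OF that(1,2)])
    fix i assume "i \<in> {..<n}"
    then have "w i \<in> P" "w' i \<in> P" "(T ^^ i) x \<in> w i \<inter> w' i"
      using that by (auto simp: name_cylinder_def)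
    then show "w i = w' i" using disj by (auto simp: disjoint_def)
  qed
  have cyl_ex: "\<exists>w\<in>?W. x \<in> ?cyl w" if "x \<in> space M" for x
  proof -
    have "\<exists>B\<in>P. (T ^^ i) x \<in> B" for i using Tx[OF that, of i] UP by auto
    then obtain f where f: "\<And>i. f i \<in> P \<and> (T ^^ i) x \<in> f i" by metis
    then have "restrict f {..<n} \<in> ?W" "x \<in> ?cyl (restrict f {..<n})"
      using that by (auto simp: name_cylinder_def)
    then show ?thesis by blast
  qed
  define p where "p w = measure M (?cyl w)" for w
  define mm where "mm w C = card {i\<in>{..<n}. w i \<noteq> s C i}" for w C
  \<comment> \<open>For each class the weights of all words add up to at most
    \<open>(1 + card P * z) ^ n\<close>: at every position one letter agrees with the
    representative, and the others weigh \<open>z\<close> each.\<close>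
  define N where "N = (1 + card P * z) ^ n * card \<C>"
  have cardC: "0 < card \<C>" using \<C> by (simp add: card_gt_0_iff)
  have N: "0 < N" unfolding N_def using z cardC by (intro mult_pos_pos zero_less_power) (auto intro: add_pos_nonneg)
  define q where "q w = (\<Sum>C\<in>\<C>. z ^ mm w C) / N" for w
  have q_pos: "0 < q w" for w
    unfolding q_def using \<C> z N by (intro divide_pos_pos sum_pos) auto
  have ind_sum: "(\<Sum>w\<in>?W. indicator (?cyl w) x) = (1::real)" if x: "x \<in> space M" for x
  proof -
    obtain w where w: "w \<in> ?W" "x \<in> ?cyl w" using cyl_ex[OF x] by blast
    have "(\<Sum>w'\<in>?W. indicator (?cyl w') x) = (\<Sum>w'\<in>?W. if w' = w then 1 else (0::real))"
    proof (intro sum.cong refl)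
      fix w' assume w': "w' \<in> ?W"
      show "indicator (?cyl w') x = (if w' = w then 1 else (0::real))"
        using cyl_unique[OF w(1) w' w(2)] w(2) by (cases "w' = w") (simp_all add: indicator_def, blast)
    qed
    then show ?thesis using finW w by simp
  qed
  have sum_int: "(\<Sum>w\<in>?W. \<integral>x. indicator (?cyl w) x * g x \<partial>M) = (\<integral>x. g x \<partial>M)"
    if g: "integrable M g" for g :: "'a \<Rightarrow> real"
  proof -
    have "(\<Sum>w\<in>?W. \<integral>x. indicator (?cyl w) x * g x \<partial>M) = (\<integral>x. (\<Sum>w\<in>?W. indicator (?cyl w) x * g x) \<partial>M)"
      using g cyl_sets by (subst Bochner_Integration.integral_sum) (auto intro: integrable_mult_indicator[where 'b = real, simplified])
    also have "\<dots> = (\<integral>x. g x \<partial>M)"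
      by (intro Bochner_Integration.integral_cong) (auto simp: ind_sum sum_distrib_right[symmetric])
    finally show ?thesis .
  qed
  have p_sum: "(\<Sum>w\<in>?W. p w) = 1"
    using sum_int[of "\<lambda>_. 1"] cyl_sets by (simp add: p_def prob_space)
  have q_sum: "(\<Sum>w\<in>?W. q w) \<le> 1"
  proof -
    have "(\<Sum>w\<in>?W. z ^ mm w C) \<le> (1 + card P * z) ^ n" for C
    proof -
      have "(\<Sum>w\<in>?W. z ^ mm w C) = (\<Sum>w\<in>?W. \<Prod>i<n. if w i = s C i then 1 else z)"
        unfolding mm_def card_mismatch_weight ..
      also have "\<dots> = (\<Prod>i<n. \<Sum>B\<in>P. if B = s C i then 1 else z)"
        by (subst prod_sum_PiE) (auto simp: finP)
      also have "\<dots> \<le> (\<Prod>i<n. 1 + card P * z)"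
      proof (intro prod_mono conjI)
        fix i
        show "0 \<le> (\<Sum>B\<in>P. if B = s C i then 1 else z)" using z by (intro sum_nonneg) auto
        have "(\<Sum>B\<in>P. if B = s C i then 1 else z) \<le> (\<Sum>B\<in>P. (if B = s C i then 1 else 0) + z)"
          using z by (intro sum_mono) auto
        also have "\<dots> = 1 + card P * z" using s finP by (simp add: sum.distrib)
        finally show "(\<Sum>B\<in>P. if B = s C i then 1 else z) \<le> 1 + card P * z" .
      qed
      finally show ?thesis by simp
    qed
    then have "(\<Sum>C\<in>\<C>. \<Sum>w\<in>?W. z ^ mm w C) \<le> (\<Sum>C\<in>\<C>. (1 + card P * z) ^ n)"
      by (intro sum_mono)
    also have "\<dots> = N" by (simp add: N_def mult.commute)
    finally show ?thesis
      unfolding q_def sum_divide_distrib[symmetric] using N by (subst sum.swap) simp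
  qed
  \<comment> \<open>The three summands pay for the index of the class, for the normalization and for
    the mismatches.\<close>
  have lnq: "- ln (q w) \<le> ln (card \<C>) + real n * (card P * z) + ln (1 / z) * mm w C" if "C \<in> \<C>" for w C
  proof -
    have "z ^ mm w C \<le> (\<Sum>C\<in>\<C>. z ^ mm w C)"
      using z that \<C> by (intro member_le_sum) auto
    then have "z ^ mm w C / N \<le> q w" unfolding q_def using N by (intro divide_right_mono) auto
    then have "ln (z ^ mm w C / N) \<le> ln (q w)" using z N q_pos by (subst ln_le_cancel_iff) auto
    moreover have "ln (z ^ mm w C / N) = mm w C * ln z - ln N"
      using z N by (simp add: ln_div ln_realpow)
    moreover have "ln N = n * ln (1 + card P * z) + ln (card \<C>)"
    proof -
      have "0 < 1 + card P * z" using z by (intro add_pos_nonneg) auto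
      then show ?thesis unfolding N_def using cardC by (subst ln_mult) (auto simp: ln_realpow)
    qed
    moreover have "n * ln (1 + card P * z) \<le> n * (card P * z)"
      using z by (intro mult_left_mono ln_add_one_self_le_self) auto
    ultimately show ?thesis using z by (simp add: ln_div mult.commute)
  qed
  \<comment> \<open>\<open>g x\<close> bounds the corrections needed at \<open>x\<close>: all
    \<open>n\<close> positions if no class contains \<open>x\<close>, otherwise only the times at
    which the orbit is outside \<open>E\<close>.\<close>
  define g where "g x = real n * indicator (space M - \<Union>\<C>) x +
      (\<Sum>i<n. indicator ((T ^^ i) -` (space M - E) \<inter> space M) x)" for x
  have C_sets: "space M - \<Union>\<C> \<in> sets M" using \<C> by auto
  have E_sets: "(T ^^ i) -` (space M - E) \<inter> space M \<in> sets M" for i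
    using E by (intro measurable_sets[OF funpow_measurable[OF T(1)]]) auto
  have g_int: "integrable M g"
    unfolding g_def using C_sets E_sets
    by (intro Bochner_Integration.integrable_add Bochner_Integration.integrable_sum
        integrable_mult_right integrable_real_indicator)
       (auto simp: emeasure_eq_measure)
  have g_val: "(\<integral>x. g x \<partial>M) = real n * measure M (space M - \<Union>\<C>) + real n * measure M (space M - E)"
  proof -
    have "(\<integral>x. g x \<partial>M) = real n * measure M (space M - \<Union>\<C>) +
       (\<Sum>i<n. measure M ((T ^^ i) -` (space M - E) \<inter> space M))"
      unfolding g_def using C_sets E_sets
      by (subst Bochner_Integration.integral_add)
         (auto simp: Bochner_Integration.integral_sum emeasure_eq_measure Int_absorb1 sets.sets_into_space
           intro!: Bochner_Integration.integrable_sum integrable_real_indicator)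
    then show ?thesis using measure_funpow_vimage[OF T, of "space M - E"] E by simp
  qed
  \<comment> \<open>The best class is chosen by the word alone. Hence the one number
    \<open>b w\<close> can be compared with \<open>g x\<close> at every point of the cylinder, even
    if its points lie in different classes.\<close>
  define b where "b w = Min (mm w ` \<C>)" for w
  have b_le: "real (b w) \<le> g x" if w: "w \<in> ?W" and x: "x \<in> ?cyl w" for w x
  proof -
    have xM: "x \<in> space M" using x by (auto simp: name_cylinder_def)
    show ?thesis
    proof (cases "x \<in> \<Union>\<C>")
      case False
      obtain C where C: "C \<in> \<C>" using \<C> by blast
      have "b w \<le> mm w C" unfolding b_def using C \<C> by simp
      also have "mm w C \<le> card {..<n}" unfolding mm_def by (intro card_mono) auto
      finally have "real (b w) \<le> n" by simp
      also have "\<dots> \<le> g x" unfolding g_def using False xM by (auto intro!: sum_nonneg)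
      finally show ?thesis .
    next
      case True
      then obtain C where C: "C \<in> \<C>" "x \<in> C" by blast
      have "b w \<le> mm w C" unfolding b_def using C \<C> by simp
      also have "mm w C \<le> card {i\<in>{..<n}. (T ^^ i) x \<notin> E}"
        unfolding mm_def
      proof (intro card_mono subsetI)
        fix i assume i: "i \<in> {i \<in> {..<n}. w i \<noteq> s C i}"
        have "(T ^^ i) x \<notin> E"
        proof
          assume "(T ^^ i) x \<in> E"
          then have "(T ^^ i) x \<in> s C i" using agree[OF C] i by auto
          moreover have "(T ^^ i) x \<in> w i" "w i \<in> P" using x w i by (auto simp: name_cylinder_def)
          ultimately show False using s[of C i] i disj by (auto simp: disjoint_def)
        qed
        then show "i \<in> {i\<in>{..<n}. (T ^^ i) x \<notin> E}" using i by auto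
      qed auto
      finally have "real (b w) \<le> card {i\<in>{..<n}. (T ^^ i) x \<notin> E}" by simp
      also have "\<dots> = (\<Sum>i\<in>{i\<in>{..<n}. (T ^^ i) x \<notin> E}. 1)" by simp
      also have "\<dots> = (\<Sum>i<n. if (T ^^ i) x \<notin> E then 1 else 0)"
        by (subst sum.inter_filter) auto
      also have "\<dots> = (\<Sum>i<n. indicator ((T ^^ i) -` (space M - E) \<inter> space M) x)"
        using xM Tx by (intro sum.cong) (auto simp: indicator_def)
      also have "\<dots> \<le> g x" unfolding g_def by simp
      finally show ?thesis .
    qed
  qed
  have b_sum: "(\<Sum>w\<in>?W. p w * b w) \<le> (\<integral>x. g x \<partial>M)"
  proof -
    have "(\<Sum>w\<in>?W. p w * b w) \<le> (\<Sum>w\<in>?W. \<integral>x. indicator (?cyl w) x * g x \<partial>M)"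
    proof (rule sum_mono)
      fix w assume w: "w \<in> ?W"
      have "p w * b w = (\<integral>x. indicator (?cyl w) x * real (b w) \<partial>M)"
        using cyl_sets[OF w] by (simp add: p_def sets.Int_space_eq2)
      also have "\<dots> \<le> (\<integral>x. indicator (?cyl w) x * g x \<partial>M)"
        using b_le[OF w] cyl_sets[OF w] g_int
        by (intro integral_mono integrable_mult_indicator[where 'b = real, simplified])
           (auto simp: indicator_def)
      finally show "p w * b w \<le> (\<integral>x. indicator (?cyl w) x * g x \<partial>M)" .
    qed
    then show ?thesis using sum_int[OF g_int] by simp
  qed
  define A where "A = ln (card \<C>) + real n * (card P * z)"
  have "partition_entropy M (iterated_join M T P n) = (\<Sum>w\<in>?W. - (p w * ln (p w)))"
  proof -
    have "(\<Sum>A\<in>?cyl ` ?W. measure M A * ln (measure M A)) = (\<Sum>w\<in>?W. p w * ln (p w))"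
      unfolding p_def
    \<comment> \<open>Two words with the same cylinder have an empty one, so the collapsed terms are
      \<open>0\<close>.\<close>
    proof (subst sum.reindex_nontrivial[OF finW])
      fix w w' assume w: "w \<in> ?W" "w' \<in> ?W" "w \<noteq> w'" "?cyl w = ?cyl w'"
      then have "?cyl w = {}" using cyl_unique by blast
      then show "measure M (?cyl w) * ln (measure M (?cyl w)) = 0" by simp
    qed simp
    then show ?thesis by (simp add: partition_entropy_def iterated_join_eq sum_negf)
  qed
  also have "\<dots> \<le> (\<Sum>w\<in>?W. p w * (- ln (q w)) + q w - p w)"
    using q_pos by (intro sum_mono entropy_term_le) (auto simp: p_def)
  also have "\<dots> = (\<Sum>w\<in>?W. p w * (- ln (q w))) + (\<Sum>w\<in>?W. q w) - 1"
    by (simp only: sum.distrib sum_subtractf p_sum)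
  also have "\<dots> \<le> (\<Sum>w\<in>?W. p w * (- ln (q w)))" using q_sum by simp
  also have "\<dots> \<le> (\<Sum>w\<in>?W. p w * (A + ln (1 / z) * b w))"
  proof (intro sum_mono mult_left_mono)
    fix w
    have "b w \<in> mm w ` \<C>" unfolding b_def using \<C> by (intro Min_in) auto
    then show "- ln (q w) \<le> A + ln (1 / z) * b w" unfolding A_def using lnq by auto
  qed (auto simp: p_def)
  also have "\<dots> = A * (\<Sum>w\<in>?W. p w) + ln (1 / z) * (\<Sum>w\<in>?W. p w * b w)"
    unfolding sum_distrib_left sum.distrib[symmetric] by (intro sum.cong) (auto simp: algebra_simps)
  also have "\<dots> \<le> A + ln (1 / z) * (\<integral>x. g x \<partial>M)"
    using b_sum z p_sum by (auto intro!: mult_left_mono)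
  finally show ?thesis unfolding A_def g_val .
qed

text \<open>The set \<open>E\<close> is fixed before \<open>n\<close>; the classes depend on
  \<open>n\<close> and may overlap. Points of one class have to agree only at times when both orbits
  are in \<open>E\<close>. This is what closeness of paths can deliver for an arbitrary partition,
  and by invariance the expected proportion of times spent outside \<open>E\<close> is at most
  \<open>\<gamma>\<close>.\<close>

lemma KS_entropy_eq_0I:
  assumes M: "prob_space M" and T: "T \<in> measurable M M" "distr M M T = M"
    and crit: "\<And>P \<gamma>. finite_partition M P \<Longrightarrow> 0 < \<gamma> \<Longrightarrow> \<gamma> < 1 \<Longrightarrow>
      \<exists>E\<in>sets M. measure M (space M - E) \<le> \<gamma> \<and>
        (\<forall>\<^sub>F n in sequentially. \<exists>\<C>. finite \<C> \<and> \<C> \<subseteq> sets M \<and> real (card \<C>) \<le> exp (\<gamma> * real n) \<and>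
           measure M (space M - \<Union>\<C>) \<le> \<gamma> \<and>
           (\<forall>C\<in>\<C>. \<forall>x\<in>C. \<forall>y\<in>C. \<forall>i<n. (T ^^ i) x \<in> E \<longrightarrow> (T ^^ i) y \<in> E \<longrightarrow>
              (\<forall>B\<in>P. (T ^^ i) x \<in> B \<longrightarrow> (T ^^ i) y \<in> B)))"
  shows "KS_entropy M T = 0"
proof -
  interpret prob_space M by fact
  have "entropy_wrt_partition M T P = 0" if P: "finite_partition M P" for P
  proof -
    let ?H = "\<lambda>n. partition_entropy M (iterated_join M T P n)"
    have UP: "\<Union>P = space M" and PM: "P \<subseteq> sets M" using P by (auto simp: finite_partition_def)
    have H_nonneg: "0 \<le> ?H n" for n
      unfolding partition_entropy_def by (auto intro!: sum_nonpos mult_nonneg_nonpos simp: ln_le_zero_iff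
        simp del: ln_le_zero_iff) (metis ln_le_zero_iff prob_le_1 zero_less_measure_iff ln_0 order_refl measure_nonneg less_eq_real_def)
    have "\<forall>\<^sub>F n in sequentially. ?H n / n \<le> e" if e: "0 < e" for e
    proof -
      \<comment> \<open>\<open>z\<close> keeps the normalization cost below \<open>e / 2\<close> per
        symbol. Only afterwards is \<open>\<gamma>\<close> chosen, because each mismatch costs
        \<open>ln (1 / z)\<close>.\<close>
      define z where "z = min (1/2) (e / (2 * (card P + 1)))"
      have z: "0 < z" "z < 1" using e by (auto simp: z_def)
      have "card P * z \<le> (card P + 1) * (e / (2 * (card P + 1)))"
        using e z by (intro mult_mono) (auto simp: z_def)
      also have "(card P + 1) * (e / (2 * (card P + 1))) = e / 2" by (simp add: divide_simps)
      finally have Pz: "card P * z \<le> e / 2" by simp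
      have lnz: "0 < ln (1 / z)" using z by simp
      define \<gamma> where "\<gamma> = min (1/2) (e / (2 * (1 + 2 * ln (1 / z))))"
      have \<gamma>: "0 < \<gamma>" "\<gamma> < 1" using e lnz by (auto simp: \<gamma>_def)
      have "\<gamma> * (1 + 2 * ln (1 / z)) \<le> e / (2 * (1 + 2 * ln (1 / z))) * (1 + 2 * ln (1 / z))"
        using lnz by (intro mult_right_mono) (auto simp: \<gamma>_def)
      also have "\<dots> = e / 2" using lnz by (simp add: divide_simps)
      finally have \<gamma>z: "\<gamma> * (1 + 2 * ln (1 / z)) \<le> e / 2" .
      from crit[OF P \<gamma>] obtain E where E: "E \<in> sets M" "measure M (space M - E) \<le> \<gamma>"
        and ev: "\<forall>\<^sub>F n in sequentially. \<exists>\<C>. finite \<C> \<and> \<C> \<subseteq> sets M \<and> real (card \<C>) \<le> exp (\<gamma> * real n) \<and>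
           measure M (space M - \<Union>\<C>) \<le> \<gamma> \<and>
           (\<forall>C\<in>\<C>. \<forall>x\<in>C. \<forall>y\<in>C. \<forall>i<n. (T ^^ i) x \<in> E \<longrightarrow> (T ^^ i) y \<in> E \<longrightarrow>
              (\<forall>B\<in>P. (T ^^ i) x \<in> B \<longrightarrow> (T ^^ i) y \<in> B))"
        by (elim bexE conjE)
      show ?thesis using ev eventually_gt_at_top[of 0]
      proof eventually_elim
        case (elim n)
        then obtain \<C> where \<C>: "finite \<C>" "\<C> \<subseteq> sets M" "real (card \<C>) \<le> exp (\<gamma> * real n)"
            "measure M (space M - \<Union>\<C>) \<le> \<gamma>"
          and same: "\<And>C x y i B. C \<in> \<C> \<Longrightarrow> x \<in> C \<Longrightarrow> y \<in> C \<Longrightarrow> i < n \<Longrightarrow> (T ^^ i) x \<in> E \<Longrightarrow>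
            (T ^^ i) y \<in> E \<Longrightarrow> B \<in> P \<Longrightarrow> (T ^^ i) x \<in> B \<Longrightarrow> (T ^^ i) y \<in> B"
          by (elim exE conjE) metis
        have "\<C> \<noteq> {}" using \<C>(4) \<gamma> by (auto simp: prob_space)
        have "\<exists>B\<in>P. \<forall>x\<in>C. (T ^^ i) x \<in> E \<longrightarrow> (T ^^ i) x \<in> B" if "C \<in> \<C>" "i < n" for C i
        proof (cases "\<exists>x\<in>C. (T ^^ i) x \<in> E")
          case True
          then obtain x where x: "x \<in> C" "(T ^^ i) x \<in> E" by blast
          then have "(T ^^ i) x \<in> \<Union>P" using UP E(1) sets.sets_into_space by blast
          then show ?thesis using same[OF that(1) x(1) _ that(2) x(2)] by blast
        next
          case False
          \<comment> \<open>No point of the class is in \<open>E\<close> at time \<open>i\<close>,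
            so any cell can serve as the letter.\<close>
          have "P \<noteq> {}" using UP not_empty by auto
          then show ?thesis using False by blast
        qed
        moreover have "P \<noteq> {}" using UP not_empty by auto
        ultimately have "\<exists>B. B \<in> P \<and> (C \<in> \<C> \<longrightarrow> i < n \<longrightarrow> (\<forall>x\<in>C. (T ^^ i) x \<in> E \<longrightarrow> (T ^^ i) x \<in> B))" for C i
          by blast
        then obtain s where s: "\<And>C i. s C i \<in> P"
          "\<And>C i x. C \<in> \<C> \<Longrightarrow> i < n \<Longrightarrow> x \<in> C \<Longrightarrow> (T ^^ i) x \<in> E \<Longrightarrow> (T ^^ i) x \<in> s C i"
          by metis
        have "?H n \<le> ln (card \<C>) + real n * (card P * z) +
            ln (1 / z) * (real n * measure M (space M - \<Union>\<C>) + real n * measure M (space M - E))"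
          using s \<open>\<C> \<noteq> {}\<close> \<C>(1,2) z E(1) by (intro partition_entropy_join_le[OF M T P E(1)]) assumption+
        also have "\<dots> \<le> \<gamma> * n + real n * (e / 2) + ln (1 / z) * (real n * \<gamma> + real n * \<gamma>)"
        proof (intro add_mono mult_left_mono)
          show "ln (card \<C>) \<le> \<gamma> * n"
          proof -
            have "0 < card \<C>" using \<C>(1) \<open>\<C> \<noteq> {}\<close> by (simp add: card_gt_0_iff)
            then have "ln (card \<C>) \<le> ln (exp (\<gamma> * n))" using \<C>(3) by (subst ln_le_cancel_iff) auto
            then show ?thesis by simp
          qed
        qed (use Pz \<C> E lnz in auto)
        also have "\<dots> = n * (\<gamma> * (1 + 2 * ln (1 / z)) + e / 2)" by (simp add: algebra_simps)
        also have "\<dots> \<le> n * (e / 2 + e / 2)" using \<gamma>z by (intro mult_left_mono) auto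
        finally show "?H n / n \<le> e" using elim by (simp add: field_simps)
      qed
    qed
    note ub = this
    have "(\<lambda>n. ?H n / n) \<longlonglongrightarrow> 0"
    proof (rule tendstoI)
      fix e :: real assume "0 < e"
      show "\<forall>\<^sub>F n in sequentially. dist (?H n / n) 0 < e"
        using ub[OF half_gt_zero[OF \<open>0 < e\<close>]]
      proof eventually_elim
        case (elim n)
        have "0 \<le> ?H n / n" using H_nonneg by simp
        then show ?case using elim \<open>0 < e\<close> by (simp only: dist_real_def diff_0_right abs_of_nonneg)
      qed
    qed
    then show ?thesis unfolding entropy_wrt_partition_def by (rule limI)
  qed
  moreover have "finite_partition M {space M}" by (auto simp: finite_partition_def disjoint_def)
  ultimately show ?thesis unfolding KS_entropy_def
    by (subst SUP_cong[where D = "\<lambda>_. 0", OF refl]) (auto intro!: SUP_const)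
qed

section \<open>Convergence of characteristic functions on boxes\<close>

lemma iexp_add: "iexp (a + b) = iexp a * iexp b"
  by (simp add: exp_add ring_distribs)

text \<open>Levy's continuity theorem for the finite measures with density \<open>u\<close>. They
  are normalized by their masses \<open>W\<close>, whose convergence is the case
  \<open>s = 0\<close> of the hypothesis; the lower bound \<open>1\<close> for \<open>u\<close>
  keeps the masses away from \<open>0\<close>.\<close>

lemma integral_cdf_convergence:
  fixes f :: "'a \<Rightarrow> real" and u :: "'a \<Rightarrow> real"
  assumes Mn: "\<And>n. prob_space (Mn n)" "\<And>n. sets (Mn n) = sets L" and L: "prob_space L"
    and f[measurable]: "f \<in> borel_measurable L" and u[measurable]: "u \<in> borel_measurable L"
    and u_bounds: "\<And>x. 1 \<le> u x" "\<And>x. u x \<le> B"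
    and conv: "\<And>s. (\<lambda>n. \<integral>x. u x *\<^sub>R iexp (s * f x) \<partial>Mn n) \<longlonglongrightarrow> (\<integral>x. u x *\<^sub>R iexp (s * f x) \<partial>L)"
    and atom: "measure L {x \<in> space L. f x = a} = 0"
  shows "(\<lambda>n. \<integral>x. u x * indicator {x. f x \<le> a} x \<partial>Mn n) \<longlonglongrightarrow> (\<integral>x. u x * indicator {x. f x \<le> a} x \<partial>L)"
proof -
  define W where "W K = (\<integral>x. u x \<partial>K)" for K
  define D where "D K = density K (\<lambda>x. ennreal (u x / W K))" for K
  have bnd: "integrable K g" if "prob_space K" "sets K = sets L" "g \<in> borel_measurable L" "\<And>x. norm (g x) \<le> c"
    for K and g :: "'a \<Rightarrow> 'b::{banach, second_countable_topology}" and c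
  proof -
    interpret K: prob_space K by fact
    show ?thesis using that measurable_cong_sets[OF that(2) refl, of borel]
      by (intro K.integrable_const_bound[of _ c]) auto
  qed
  have u_abs: "norm (u x) \<le> B" for x using u_bounds[of x] by simp
  have W_ge: "1 \<le> W K" if K: "prob_space K" "sets K = sets L" for K
  proof -
    interpret K: prob_space K by fact
    have "(\<integral>x. 1 \<partial>K) \<le> W K" unfolding W_def
      using K.integrable_const bnd[OF K u u_abs] u_bounds(1) by (rule integral_mono)
    then show ?thesis by (simp add: K.prob_space)
  qed
  have meas: "u \<in> borel_measurable K" "f \<in> borel_measurable K" if "sets K = sets L" for K
    using f u by (simp_all only: measurable_cong_sets[OF that refl])
  have uW: "0 \<le> u x / W K" if "prob_space K" "sets K = sets L" for K x
    using W_ge[OF that] u_bounds(1)[of x] by (intro divide_nonneg_nonneg) auto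
  have D: "prob_space (D K)" if K: "prob_space K" "sets K = sets L" for K
  proof -
    interpret K: prob_space K by fact
    have "emeasure (D K) (space (D K)) = (\<integral>\<^sup>+x. ennreal (u x / W K) \<partial>K)"
      using meas[OF K(2)] unfolding D_def by (subst emeasure_density) (auto intro!: nn_integral_cong)
    also have "\<dots> = ennreal (\<integral>x. u x / W K \<partial>K)"
      using uW[OF K] by (intro nn_integral_eq_integral integrable_divide bnd[OF K u u_abs]) auto
    also have "\<dots> = 1" using W_ge[OF K] by (simp add: W_def)
    finally show ?thesis by (rule prob_spaceI)
  qed
  have dens: "(\<integral>x. g x \<partial>D K) = (\<integral>x. u x *\<^sub>R g x \<partial>K) /\<^sub>R W K"
    if K: "prob_space K" "sets K = sets L" and "g \<in> borel_measurable L"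
    for K and g :: "'a \<Rightarrow> 'b::{banach, second_countable_topology}"
  proof -
    have "(\<integral>x. g x \<partial>D K) = (\<integral>x. (u x / W K) *\<^sub>R g x \<partial>K)" unfolding D_def
      using meas(1)[OF K(2)] uW[OF K] that(3) measurable_cong_sets[OF K(2) refl, of borel]
      by (intro integral_density) auto
    also have "\<dots> = (\<integral>x. inverse (W K) *\<^sub>R (u x *\<^sub>R g x) \<partial>K)" by (simp add: field_simps)
    also have "\<dots> = (\<integral>x. u x *\<^sub>R g x \<partial>K) /\<^sub>R W K" by (rule integral_scaleR_right)
    finally show ?thesis .
  qed
  define \<rho> where "\<rho> K = distr (D K) borel f" for K
  have fD: "f \<in> borel_measurable (D K)" if "sets K = sets L" for K
    using meas[OF that] by (simp add: D_def)
  have \<rho>: "real_distribution (\<rho> K)" if K: "prob_space K" "sets K = sets L" for K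
    unfolding \<rho>_def using prob_space.real_distribution_distr[OF D[OF K] fD[OF K(2)]] .
  have char: "char (\<rho> K) s = (\<integral>x. u x *\<^sub>R iexp (s * f x) \<partial>K) /\<^sub>R W K" if K: "prob_space K" "sets K = sets L" for K s
    unfolding char_def \<rho>_def using fD[OF K(2)] by (simp add: integral_distr dens[OF K])
  have W_conv: "(\<lambda>n. W (Mn n)) \<longlonglongrightarrow> W L"
    using tendsto_Re[OF conv[of 0]] by (simp add: W_def scaleR_conv_of_real)
  have W_pos: "W L \<noteq> 0" using W_ge[OF L refl] by simp
  have W_Mn: "W (Mn n) \<noteq> 0" for n using W_ge[OF Mn, of n] by simp
  have "weak_conv_m (\<lambda>n. \<rho> (Mn n)) (\<rho> L)"
    using \<rho>[OF Mn] \<rho>[OF L refl]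
  proof (rule levy_continuity)
    fix s show "(\<lambda>n. char (\<rho> (Mn n)) s) \<longlonglongrightarrow> char (\<rho> L) s"
      unfolding char[OF Mn] char[OF L refl] by (intro tendsto_intros conv W_conv W_pos)
  qed
  moreover have cdf: "cdf (\<rho> K) a = (\<integral>x. u x * indicator {x. f x \<le> a} x \<partial>K) / W K"
    if K: "prob_space K" "sets K = sets L" for K
  proof -
    interpret D: prob_space "D K" using D[OF K] .
    have "cdf (\<rho> K) a = measure (D K) (f -` {..a} \<inter> space (D K))"
      unfolding cdf_def \<rho>_def using fD[OF K(2)] by (simp add: measure_distr)
    also have "\<dots> = (\<integral>x. indicator (f -` {..a} \<inter> space (D K)) x \<partial>D K)" by simp
    also have "\<dots> = (\<integral>x. indicator {x. f x \<le> a} x \<partial>D K)"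
      by (intro Bochner_Integration.integral_cong) (auto simp: indicator_def)
    also have "\<dots> = (\<integral>x. u x * indicator {x. f x \<le> a} x \<partial>K) / W K"
      by (subst dens[OF K]) (auto simp: field_simps)
    finally show ?thesis .
  qed
  \<comment> \<open>Weak convergence controls the distribution functions only at continuity points
    of the limit. That \<open>f\<close> has no atom at \<open>a\<close> under \<open>L\<close>
    passes to the measure with a density.\<close>
  moreover have "isCont (cdf (\<rho> L)) a"
  proof -
    interpret \<rho>: real_distribution "\<rho> L" using \<rho>[OF L refl] .
    interpret L: prob_space L by fact
    have "emeasure L {x \<in> space L. f x = a} = 0" using atom by (simp add: L.emeasure_eq_measure)
    then have "AE x in L. f x \<noteq> a" by (intro AE_I[of _ _ "{x \<in> space L. f x = a}"]) auto
    then have "AE x in D L. f x \<noteq> a" unfolding D_def by (subst AE_density) auto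
    then have "emeasure (D L) {x \<in> space (D L). f x = a} = 0"
      using fD[OF refl] by (subst (asm) AE_iff_measurable[OF _ refl]) auto
    then have "emeasure (\<rho> L) {a} = 0"
      unfolding \<rho>_def using fD[OF refl] by (subst emeasure_distr) (auto simp: vimage_def Int_def conj_commute)
    then show ?thesis by (simp add: \<rho>.isCont_cdf measure_def)
  qed
  ultimately have "(\<lambda>n. (\<integral>x. u x * indicator {x. f x \<le> a} x \<partial>Mn n) / W (Mn n)) \<longlonglongrightarrow>
      (\<integral>x. u x * indicator {x. f x \<le> a} x \<partial>L) / W L"
    unfolding weak_conv_m_def weak_conv_def using cdf[OF Mn] cdf[OF L refl] by auto
  from tendsto_mult[OF this W_conv] show ?thesis
    using W_Mn W_pos by (simp only: nonzero_eq_divide_eq times_divide_eq_left nonzero_mult_div_cancel_right simp_thms)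
qed

text \<open>A multidimensional continuity theorem for boxes, one coordinate at a time: \<open>iexp h\<close> is
  written through the positive densities \<open>1 + cos h\<close> and \<open>1 + sin h\<close>, to which the
  one-dimensional theorem applies.\<close>

lemma box_convergence_step:
  fixes f :: "'a \<Rightarrow> real"
  assumes Mn: "\<And>n. prob_space (Mn n)" "\<And>n. sets (Mn n) = sets L" and L: "prob_space L"
    and V: "\<And>g. g \<in> V \<Longrightarrow> g \<in> borel_measurable L" "\<And>g h s. g \<in> V \<Longrightarrow> h \<in> V \<Longrightarrow> (\<lambda>x. g x + s * h x) \<in> V"
      "(\<lambda>_. 0) \<in> V"
    and conv: "\<And>h. h \<in> V \<Longrightarrow> (\<lambda>n. \<integral>x. iexp (h x) \<partial>Mn n) \<longlonglongrightarrow> (\<integral>x. iexp (h x) \<partial>L)"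
    and B: "B \<in> sets L"
    and convB: "\<And>h. h \<in> V \<Longrightarrow> (\<lambda>n. \<integral>x. indicator B x *\<^sub>R iexp (h x) \<partial>Mn n) \<longlonglongrightarrow> (\<integral>x. indicator B x *\<^sub>R iexp (h x) \<partial>L)"
    and f: "f \<in> V" and atom: "measure L {x \<in> space L. f x = a} = 0"
    and h: "h \<in> V"
  shows "(\<lambda>n. \<integral>x. indicator (B \<inter> {x. f x \<le> a}) x *\<^sub>R iexp (h x) \<partial>Mn n) \<longlonglongrightarrow>
    (\<integral>x. indicator (B \<inter> {x. f x \<le> a}) x *\<^sub>R iexp (h x) \<partial>L)"
proof -
  have [measurable]: "f \<in> borel_measurable L" "h \<in> borel_measurable L" "B \<in> sets L" using V f h B by auto
  have bnd: "integrable K g" if "prob_space K" "sets K = sets L" "g \<in> borel_measurable L" "\<And>x. norm (g x) \<le> c"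
    for K and g :: "'a \<Rightarrow> 'b::{banach, second_countable_topology}" and c
  proof -
    interpret K: prob_space K by fact
    show ?thesis using that measurable_cong_sets[OF that(2) refl, of borel]
      by (intro K.integrable_const_bound[of _ c]) auto
  qed
  let ?F = "indicator {x. f x \<le> a} :: 'a \<Rightarrow> real"
  have Fm[measurable]: "?F \<in> borel_measurable L"
  proof -
    have "{x \<in> space L. f x \<le> a} \<in> sets L" by measurable
    then have "indicator {x \<in> space L. f x \<le> a} \<in> borel_measurable L" by simp
    then show ?thesis by (rule measurable_cong[THEN iffD1, rotated]) (auto simp: indicator_def)
  qed
  have hs: "(\<lambda>x. s * f x) \<in> V" for s using V(2)[OF V(3) f, of s] by simp
  have hp: "(\<lambda>x. t * h x + s * f x) \<in> V" for s t
    using V(2)[OF V(2)[OF V(3) h, of t] f, of s] by simp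
  \<comment> \<open>The extra \<open>1\<close> makes the weight at least \<open>1\<close>, as the
    one-dimensional theorem demands. The form \<open>\<alpha> + Re (\<beta> * iexp y)\<close> covers
    the constants, \<open>1 + cos\<close> and \<open>1 + sin\<close> at once, and it turns the
    weighted characteristic function into a combination of exponentials whose convergence is
    assumed.\<close>
  have main: "(\<lambda>n. \<integral>x. (1 + indicator B x * w (h x)) * ?F x \<partial>Mn n) \<longlonglongrightarrow>
      (\<integral>x. (1 + indicator B x * w (h x)) * ?F x \<partial>L)"
    if w: "\<And>y. w y = \<alpha> + Re (\<beta> * iexp y)" "\<And>y. 0 \<le> w y" for w :: "real \<Rightarrow> real" and \<alpha> \<beta>
  proof (rule integral_cdf_convergence[OF Mn L])
    have wm[measurable]: "w \<in> borel_measurable borel"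
      unfolding w(1)[abs_def] by (intro borel_measurable_continuous_onI continuous_intros)
    have wb: "w y \<le> \<bar>\<alpha>\<bar> + norm \<beta>" for y
      using complex_Re_le_cmod[of "\<beta> * iexp y"] by (simp add: w(1) norm_mult)
    show "(\<lambda>x. 1 + indicator B x * w (h x)) \<in> borel_measurable L" by measurable
    show "1 \<le> 1 + indicator B x * w (h x)" for x using w(2)[of "h x"] by simp
    show "1 + indicator B x * w (h x) \<le> 1 + (\<bar>\<alpha>\<bar> + norm \<beta>)" for x
      using wb[of "h x"] w(2)[of "h x"] by (auto simp: indicator_def)
    have wc: "complex_of_real (w y) = \<alpha> + \<beta> / 2 * iexp y + cnj \<beta> / 2 * iexp (- y)" for y
    proof -
      have "cnj (\<beta> * iexp y) = cnj \<beta> * iexp (- y)" by (simp add: exp_cnj)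
      moreover have "complex_of_real (Re (\<beta> * iexp y)) = (\<beta> * iexp y + cnj (\<beta> * iexp y)) / 2"
        unfolding complex_add_cnj by simp
      ultimately show ?thesis unfolding w(1) of_real_add by (simp add: add_divide_distrib)
    qed
    show "(\<lambda>n. \<integral>x. (1 + indicator B x * w (h x)) *\<^sub>R iexp (s * f x) \<partial>Mn n) \<longlonglongrightarrow>
        (\<integral>x. (1 + indicator B x * w (h x)) *\<^sub>R iexp (s * f x) \<partial>L)" for s
    proof -
      have exp_eq: "(1 + indicator B x * w (h x)) *\<^sub>R iexp (s * f x) =
          iexp (s * f x) + \<alpha> * (indicator B x *\<^sub>R iexp (s * f x)) + \<beta> / 2 * (indicator B x *\<^sub>R iexp (1 * h x + s * f x))
          + cnj \<beta> / 2 * (indicator B x *\<^sub>R iexp ((- 1) * h x + s * f x))" for x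
      proof -
        have "(1 + indicator B x * w (h x)) *\<^sub>R iexp (s * f x) =
           iexp (s * f x) + indicator B x *\<^sub>R (of_real (w (h x)) * iexp (s * f x))"
          by (simp add: scaleR_conv_of_real ring_distribs)
        also have "of_real (w (h x)) * iexp (s * f x) = \<alpha> * iexp (s * f x) + \<beta> / 2 * iexp (1 * h x + s * f x)
            + cnj \<beta> / 2 * iexp ((- 1) * h x + s * f x)"
          unfolding wc iexp_add by (simp add: ring_distribs mult.assoc)
        finally show ?thesis by (cases "x \<in> B") (simp_all add: add.assoc)
      qed
      have int_eq: "(\<integral>x. (1 + indicator B x * w (h x)) *\<^sub>R iexp (s * f x) \<partial>K) =
        (\<integral>x. iexp (s * f x) \<partial>K) + \<alpha> * (\<integral>x. indicator B x *\<^sub>R iexp (s * f x) \<partial>K) +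
        \<beta> / 2 * (\<integral>x. indicator B x *\<^sub>R iexp (1 * h x + s * f x) \<partial>K) +
        cnj \<beta> / 2 * (\<integral>x. indicator B x *\<^sub>R iexp ((- 1) * h x + s * f x) \<partial>K)"
        if K: "prob_space K" "sets K = sets L" for K
      proof -
        have i: "integrable K (\<lambda>x. indicator B x *\<^sub>R iexp (t * h x + s * f x))" for t
          by (rule bnd[OF K, of _ 1]) (auto simp: indicator_def)
        have j: "integrable K (\<lambda>x. indicator B x *\<^sub>R iexp (s * f x))" "integrable K (\<lambda>x. iexp (s * f x))"
          by (rule bnd[OF K, of _ 1], auto simp: indicator_def)+
        show ?thesis unfolding exp_eq
          using i[of 1] i[of "- 1"] j
          by (simp only: Bochner_Integration.integral_add Bochner_Integration.integrable_add
              integrable_mult_right integral_mult_right_zero)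
      qed
      show ?thesis unfolding int_eq[OF Mn] int_eq[OF L refl]
        by (intro tendsto_intros conv convB hs hp)
    qed
    show "f \<in> borel_measurable L" by measurable
  qed (use atom in auto)
  have one: "(\<lambda>n. \<integral>x. ?F x \<partial>Mn n) \<longlonglongrightarrow> (\<integral>x. ?F x \<partial>L)"
    using main[of "\<lambda>_. 0" 0 0] by simp
  have c: "(\<lambda>n. \<integral>x. (1 + indicator B x * (1 + cos (h x))) * ?F x \<partial>Mn n) \<longlonglongrightarrow>
      (\<integral>x. (1 + indicator B x * (1 + cos (h x))) * ?F x \<partial>L)"
    by (intro main[of "\<lambda>y. 1 + cos y" 1 1]) (auto simp: Re_exp, smt (verit) cos_ge_minus_one)
  have s: "(\<lambda>n. \<integral>x. (1 + indicator B x * (1 + sin (h x))) * ?F x \<partial>Mn n) \<longlonglongrightarrow>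
      (\<integral>x. (1 + indicator B x * (1 + sin (h x))) * ?F x \<partial>L)"
    by (intro main[of "\<lambda>y. 1 + sin y" 1 "- \<i>"]) (auto simp: Re_exp Im_exp, smt (verit) sin_ge_minus_one)
  have b: "(\<lambda>n. \<integral>x. (1 + indicator B x * 1) * ?F x \<partial>Mn n) \<longlonglongrightarrow>
      (\<integral>x. (1 + indicator B x * 1) * ?F x \<partial>L)"
    by (intro main[of "\<lambda>y. 1" 1 0]) auto
  \<comment> \<open>Subtracting the integral with weight \<open>1 + indicator B x\<close> removes
    the positivity corrections and leaves the real and the imaginary part of
    \<open>iexp (h x)\<close> on the smaller set.\<close>
  have eq: "(\<integral>x. indicator (B \<inter> {x. f x \<le> a}) x *\<^sub>R iexp (h x) \<partial>K) =
      of_real ((\<integral>x. (1 + indicator B x * (1 + cos (h x))) * ?F x \<partial>K) - (\<integral>x. (1 + indicator B x * 1) * ?F x \<partial>K)) +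
      \<i> * of_real ((\<integral>x. (1 + indicator B x * (1 + sin (h x))) * ?F x \<partial>K) - (\<integral>x. (1 + indicator B x * 1) * ?F x \<partial>K))"
    if K: "prob_space K" "sets K = sets L" for K
  proof -
    have gen: "(\<integral>x. of_real (p x - r x) + \<i> * of_real (q x - r x) \<partial>K) =
        of_real ((\<integral>x. p x \<partial>K) - (\<integral>x. r x \<partial>K)) + \<i> * of_real ((\<integral>x. q x \<partial>K) - (\<integral>x. r x \<partial>K))"
      if "integrable K p" "integrable K q" "integrable K r" for p q r :: "'a \<Rightarrow> real"
      using that by simp
    have ci: "integrable K (\<lambda>x. (1 + indicator B x * (1 + cos (h x))) * ?F x)"
      by (rule bnd[OF K, of _ 3]) (auto simp: indicator_def, smt (verit) cos_le_one cos_ge_minus_one)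
    have si: "integrable K (\<lambda>x. (1 + indicator B x * (1 + sin (h x))) * ?F x)"
      by (rule bnd[OF K, of _ 3]) (auto simp: indicator_def, smt (verit) sin_le_one sin_ge_minus_one)
    have bi: "integrable K (\<lambda>x. (1 + indicator B x * 1) * ?F x)"
      by (rule bnd[OF K, of _ 3]) (auto simp: indicator_def)
    have "(\<integral>x. indicator (B \<inter> {x. f x \<le> a}) x *\<^sub>R iexp (h x) \<partial>K) =
      (\<integral>x. of_real ((1 + indicator B x * (1 + cos (h x))) * ?F x - (1 + indicator B x * 1) * ?F x) +
       \<i> * of_real ((1 + indicator B x * (1 + sin (h x))) * ?F x - (1 + indicator B x * 1) * ?F x) \<partial>K)"
      by (intro Bochner_Integration.integral_cong) (auto simp: indicator_def complex_eq_iff Re_exp Im_exp)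
    also have "\<dots> = of_real ((\<integral>x. (1 + indicator B x * (1 + cos (h x))) * ?F x \<partial>K) - (\<integral>x. (1 + indicator B x * 1) * ?F x \<partial>K)) +
      \<i> * of_real ((\<integral>x. (1 + indicator B x * (1 + sin (h x))) * ?F x \<partial>K) - (\<integral>x. (1 + indicator B x * 1) * ?F x \<partial>K))"
      by (rule gen[OF ci si bi])
    finally show ?thesis .
  qed
  show ?thesis unfolding eq[OF Mn] eq[OF L refl] by (intro tendsto_intros c s b)
qed

text \<open>Induction on the set of constrained coordinates. The induction must carry the factor
  \<open>iexp (h x)\<close> for every \<open>h\<close> in the linear space \<open>V\<close>, because
  the step for a new coordinate \<open>f\<close> uses the previous statement for combinations of
  \<open>h\<close> and \<open>f\<close>. The choice \<open>h = 0\<close> at the end gives the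
  probabilities.\<close>

lemma box_convergence:
  fixes V :: "('a \<Rightarrow> real) set"
  assumes Mn: "\<And>n. prob_space (Mn n)" "\<And>n. sets (Mn n) = sets L" and L: "prob_space L"
    and V: "\<And>g. g \<in> V \<Longrightarrow> g \<in> borel_measurable L" "\<And>g h s. g \<in> V \<Longrightarrow> h \<in> V \<Longrightarrow> (\<lambda>x. g x + s * h x) \<in> V"
      "(\<lambda>_. 0) \<in> V"
    and conv: "\<And>h. h \<in> V \<Longrightarrow> (\<lambda>n. \<integral>x. iexp (h x) \<partial>Mn n) \<longlonglongrightarrow> (\<integral>x. iexp (h x) \<partial>L)"
    and I: "finite I" "\<And>i. i \<in> I \<Longrightarrow> f i \<in> V" "\<And>i. i \<in> I \<Longrightarrow> measure L {x \<in> space L. f i x = a i} = 0"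
  shows "(\<lambda>n. measure (Mn n) {x \<in> space L. \<forall>i\<in>I. f i x \<le> a i}) \<longlonglongrightarrow> measure L {x \<in> space L. \<forall>i\<in>I. f i x \<le> a i}"
proof -
  have sets: "{x \<in> space L. \<forall>i\<in>J. f i x \<le> a i} \<in> sets L" if "finite J" "J \<subseteq> I" for J
    using that I(2)
  proof (induction J)
    case (insert j J)
    then have [measurable]: "f j \<in> borel_measurable L" using V(1) by auto
    have "{x \<in> space L. \<forall>i\<in>insert j J. f i x \<le> a i} = {x \<in> space L. f j x \<le> a j} \<inter> {x \<in> space L. \<forall>i\<in>J. f i x \<le> a i}"
      by auto
    moreover have "{x \<in> space L. f j x \<le> a j} \<in> sets L" by measurable
    ultimately show ?case using insert by auto
  qed auto
  have "(\<lambda>n. \<integral>x. indicator {x \<in> space L. \<forall>i\<in>J. f i x \<le> a i} x *\<^sub>R iexp (h x) \<partial>Mn n) \<longlonglongrightarrow>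
    (\<integral>x. indicator {x \<in> space L. \<forall>i\<in>J. f i x \<le> a i} x *\<^sub>R iexp (h x) \<partial>L)" if "finite J" "J \<subseteq> I" "h \<in> V" for J h
    using that
  proof (induction J arbitrary: h)
    case empty
    have sp: "space (Mn n) = space L" for n using sets_eq_imp_space_eq[OF Mn(2)] .
    have "(\<integral>x. indicator (space L) x *\<^sub>R iexp (h x) \<partial>K) = (\<integral>x. iexp (h x) \<partial>K)" if "space K = space L" for K
      using that by (intro Bochner_Integration.integral_cong) auto
    then show ?case using conv[OF empty(2)] sp by simp
  next
    case (insert j J)
    let ?B = "{x \<in> space L. \<forall>i\<in>J. f i x \<le> a i}"
    have "{x \<in> space L. \<forall>i\<in>insert j J. f i x \<le> a i} = ?B \<inter> {x. f j x \<le> a j}" by auto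
    moreover have "?B \<in> sets L" using insert by (intro sets) auto
    moreover have "j \<in> I" "J \<subseteq> I" using insert by auto
    moreover have "(\<lambda>n. \<integral>x. indicator (?B \<inter> {x. f j x \<le> a j}) x *\<^sub>R iexp (h x) \<partial>Mn n) \<longlonglongrightarrow>
      (\<integral>x. indicator (?B \<inter> {x. f j x \<le> a j}) x *\<^sub>R iexp (h x) \<partial>L)"
    proof (rule box_convergence_step[OF Mn L V conv])
      show "(\<lambda>n. \<integral>x. indicator ?B x *\<^sub>R iexp (g x) \<partial>Mn n) \<longlonglongrightarrow> (\<integral>x. indicator ?B x *\<^sub>R iexp (g x) \<partial>L)"
        if "g \<in> V" for g using insert.IH[OF _ that] insert.prems(1) by simp
    qed (use \<open>?B \<in> sets L\<close> \<open>j \<in> I\<close> I insert.prems(2) in simp_all)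
    ultimately show ?case by simp
  qed
  note tendsto_Re[OF this[OF I(1) order_refl V(3)]]
  moreover have "Re (\<integral>x. indicator {x \<in> space L. \<forall>i\<in>I. f i x \<le> a i} x *\<^sub>R iexp 0 \<partial>K) =
      measure K {x \<in> space L. \<forall>i\<in>I. f i x \<le> a i}"
    if "sets K = sets L" for K
  proof -
    have "{x \<in> space L. \<forall>i\<in>I. f i x \<le> a i} \<subseteq> space K" using sets_eq_imp_space_eq[OF that] by auto
    then show ?thesis by (simp add: scaleR_conv_of_real Int_absorb2)
  qed
  ultimately show ?thesis by (simp only: Mn(2))
qed

section \<open>The covariance\<close>

text \<open>The ratio \<open>129 / 2\<close> exceeds \<open>64\<close>, so that
  \<open>2 ^ K * angle K\<close> decays faster than \<open>(1 / 32) ^ K\<close>. The integer ratio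
  \<open>64\<close> would not do: at time \<open>64 ^ i\<close> the factors with
  \<open>k \<le> i\<close> would be \<open>1\<close> or \<open>-1\<close>, the others would have a
  fixed nonzero product, and the covariance would not decay. The denominator \<open>2\<close>
  excludes such resonances.\<close>

definition angle :: "nat \<Rightarrow> real" where
  "angle k = pi * (2 / 129) ^ k"

definition partial_cov :: "nat \<Rightarrow> int \<Rightarrow> real" where
  "partial_cov K n = (\<Prod>k<K. cos (of_int n * angle k))"

definition cov :: "int \<Rightarrow> real" where
  "cov n = lim (\<lambda>K. partial_cov K n)"

lemma abs_one_minus_cos_le: "\<bar>1 - cos x\<bar> \<le> \<bar>x :: real\<bar>"
proof -
  have "1 - cos x = 2 * (sin (x / 2))\<^sup>2"
    using cos_double_sin[of "x / 2"] by simp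
  also have "(sin (x / 2))\<^sup>2 = \<bar>sin (x / 2)\<bar> * \<bar>sin (x / 2)\<bar>" by (simp add: power2_eq_square)
  also have "2 * \<dots> \<le> 2 * (\<bar>sin (x / 2)\<bar> * 1)"
    by (intro mult_left_mono abs_sin_le_one) auto
  also have "\<bar>sin (x / 2)\<bar> * 1 \<le> \<bar>x / 2\<bar>" using abs_sin_x_le_abs_x[of "x / 2"] by simp
  finally have "1 - cos x \<le> \<bar>x\<bar>" by simp
  then show ?thesis using cos_le_one[of x] by simp
qed

lemma abs_partial_cov_le_1: "\<bar>partial_cov K n\<bar> \<le> 1"
  unfolding partial_cov_def abs_prod by (intro prod_le_1) auto

lemma partial_cov_tendsto: "(\<lambda>K. partial_cov K n) \<longlonglongrightarrow> cov n"
proof -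
  have "summable (\<lambda>K. partial_cov (Suc K) n - partial_cov K n)"
  proof (rule summable_comparison_test)
    show "\<exists>N. \<forall>K\<ge>N. norm (partial_cov (Suc K) n - partial_cov K n) \<le> \<bar>of_int n\<bar> * pi * (2 / 129) ^ K"
    proof (intro exI allI impI)
      fix K
      have "\<bar>partial_cov (Suc K) n - partial_cov K n\<bar> = \<bar>partial_cov K n\<bar> * \<bar>1 - cos (of_int n * angle K)\<bar>"
        unfolding abs_mult[symmetric] by (simp add: partial_cov_def algebra_simps abs_minus_commute)
      also have "\<dots> \<le> 1 * \<bar>of_int n * angle K\<bar>"
        by (intro mult_mono abs_partial_cov_le_1 abs_one_minus_cos_le) auto
      finally show "norm (partial_cov (Suc K) n - partial_cov K n) \<le> \<bar>of_int n\<bar> * pi * (2 / 129) ^ K"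
        by (simp add: angle_def abs_mult power_abs)
    qed
    show "summable (\<lambda>K. \<bar>of_int n\<bar> * pi * (2 / 129 :: real) ^ K)"
      by (intro summable_mult summable_geometric) auto
  qed
  then have "convergent (\<lambda>K. partial_cov K n)"
    by (simp only: summable_iff_convergent sum_lessThan_telescope[of "\<lambda>K. partial_cov K n"] convergent_diff_const_right_iff)
  then show ?thesis by (simp add: cov_def convergent_LIMSEQ_iff)
qed

lemma cov_0: "cov 0 = 1"
  using partial_cov_tendsto[of 0] by (simp add: partial_cov_def LIMSEQ_const_iff)

lemma cov_minus: "cov (- n) = cov n"
  by (simp add: cov_def partial_cov_def)

text \<open>All further factors are at most \<open>1\<close> in absolute value, so finitely many
  small factors already make the covariance small.\<close>

lemma abs_cov_le: "\<bar>cov n\<bar> \<le> \<bar>partial_cov K n\<bar>"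
proof (rule tendsto_upperbound)
  show "(\<lambda>L. \<bar>partial_cov L n\<bar>) \<longlonglongrightarrow> \<bar>cov n\<bar>" by (intro tendsto_rabs partial_cov_tendsto)
  show "\<forall>\<^sub>F L in sequentially. \<bar>partial_cov L n\<bar> \<le> \<bar>partial_cov K n\<bar>"
  proof (rule eventually_sequentiallyI)
    fix L assume "K \<le> L"
    then have "{..<L} = {..<K} \<union> {K..<L}" by auto
    then have "partial_cov L n = partial_cov K n * (\<Prod>k\<in>{K..<L}. cos (of_int n * angle k))"
      unfolding partial_cov_def by (simp add: prod.union_disjoint ivl_disj_int)
    moreover have "\<bar>\<Prod>k\<in>{K..<L}. cos (of_int n * angle k)\<bar> \<le> 1"
      unfolding abs_prod by (intro prod_le_1) auto
    ultimately show "\<bar>partial_cov L n\<bar> \<le> \<bar>partial_cov K n\<bar>"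
      by (simp add: abs_mult mult_left_le)
  qed
qed auto

text \<open>If \<open>y\<close> and \<open>129/2 * y\<close> are both close to integers \<open>m\<close> and \<open>m'\<close>, then \<open>2 * m' = 129 * m\<close>.
  Hence a chain of \<open>L\<close> such scales forces \<open>2 ^ L\<close> to divide the lowest integer.\<close>

lemma exists_scale_far_from_int:
  fixes y :: real
  assumes "1 / 2 \<le> y" "y + 1 \<le> 2 ^ L"
  shows "\<exists>i\<le>L. \<forall>m::int. 1 / 264 \<le> \<bar>y * (129 / 2) ^ i - of_int m\<bar>"
proof (rule ccontr)
  assume "\<not> ?thesis"
  then have "\<forall>i\<le>L. \<exists>m::int. \<bar>y * (129 / 2) ^ i - of_int m\<bar> < 1 / 264" by (metis not_le)
  then obtain m :: "nat \<Rightarrow> int" where m: "\<And>i. i \<le> L \<Longrightarrow> \<bar>y * (129 / 2) ^ i - of_int (m i)\<bar> < 1 / 264"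
    by metis
  \<comment> \<open>Since \<open>y * (129 / 2) ^ i\<close> satisfies the relation exactly, the
    integer \<open>2 * m (Suc i) - 129 * m i\<close> has absolute value below
    \<open>(2 + 129) / 264 < 1\<close>, hence it is \<open>0\<close>.\<close>
  have step: "2 * m (Suc i) = 129 * m i" if "Suc i \<le> L" for i
  proof -
    have "\<bar>of_int (2 * m (Suc i) - 129 * m i)\<bar> < (1::real)"
      using m[of i] m[of "Suc i"] that by (simp add: abs_if split: if_splits)
    then show ?thesis by linarith
  qed
  have "2 ^ i * m i = 129 ^ i * m 0" if "i \<le> L" for i
    using that
  proof (induction i)
    case (Suc i)
    have "2 ^ Suc i * m (Suc i) = 2 ^ i * (2 * m (Suc i))" by simp
    also have "\<dots> = 129 * (2 ^ i * m i)" unfolding step[OF Suc.prems] by simp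
    finally show ?case using Suc by simp
  qed simp
  then have "(2::int) ^ L dvd 129 ^ L * m 0" by (metis dvd_triv_left order_refl)
  moreover have "coprime ((2::int) ^ L) (129 ^ L)" by simp
  ultimately have "(2::int) ^ L dvd m 0" by (simp add: coprime_dvd_mult_right_iff)
  moreover have "0 < m 0"
  proof -
    have "(0::real) < of_int (m 0)" using m[of 0] assms by (simp add: abs_if split: if_splits)
    then show ?thesis by simp
  qed
  ultimately have "2 ^ L \<le> m 0" by (rule zdvd_imp_le)
  then have "(2::real) ^ L \<le> of_int (m 0)" by (metis of_int_le_iff of_int_numeral of_int_power)
  moreover have "\<bar>y - of_int (m 0)\<bar> < 1 / 264" using m[of 0] by simp
  ultimately show False using assms by linarith
qed

text \<open>Subtracting the nearest integer from \<open>x\<close> changes at most the sign of the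
  cosine and moves the argument to a range where cosine is monotone in the distance.\<close>

lemma abs_cos_pi_le:
  fixes x :: real
  assumes "\<And>m::int. \<delta> \<le> \<bar>x - of_int m\<bar>" "0 \<le> \<delta>"
  shows "\<bar>cos (pi * x)\<bar> \<le> cos (pi * \<delta>)"
proof -
  define m where "m = round x"
  have h: "\<bar>x - of_int m\<bar> \<le> 1 / 2" unfolding m_def using of_int_round_abs_le[of x] by (simp add: abs_minus_commute)
  have "\<bar>cos (pi * x)\<bar> = \<bar>cos (pi * x - of_int m * pi)\<bar>"
    by (simp add: cos_diff abs_mult mult.commute)
  also have "pi * x - of_int m * pi = pi * (x - of_int m)" by (simp add: algebra_simps)
  also have "cos (pi * (x - of_int m)) = cos (pi * \<bar>x - of_int m\<bar>)"
    using cos_abs_real[of "pi * (x - of_int m)"] by (simp only: abs_mult abs_of_nonneg[OF pi_ge_zero])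
  also have "\<bar>cos (pi * \<bar>x - of_int m\<bar>)\<bar> = cos (pi * \<bar>x - of_int m\<bar>)"
    using h by (intro abs_of_nonneg cos_ge_zero) (auto intro: order_trans[of _ 0])
  also have "\<dots> \<le> cos (pi * \<delta>)"
    using assms h by (intro cos_monotone_0_pi_le) (auto intro!: mult_left_mono)
  finally show ?thesis .
qed

text \<open>The size of a factor whose argument, in units of \<open>pi\<close>, keeps the distance
  \<open>1 / 264\<close> from the integers found in
  \<open>exists_scale_far_from_int\<close>.\<close>

definition cos_bound :: real where
  "cos_bound = cos (pi / 264)"

lemma cos_bound: "0 \<le> cos_bound" "cos_bound < 1"
proof -
  show "0 \<le> cos_bound" unfolding cos_bound_def by (intro cos_ge_zero) auto
  have "cos (pi / 264) < cos 0" by (intro cos_monotone_0_pi) auto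
  then show "cos_bound < 1" by (simp add: cos_bound_def)
qed

text \<open>Among the first \<open>L + 1\<close> scales one is far from the integers and contributes
  a factor \<open>cos_bound\<close>. Restarting at the next scale gives a number between
  \<open>1 / 2\<close> and \<open>Y * (129 / 2) ^ Suc L\<close>; this is why \<open>Y\<close> is
  arbitrary in the induction. The resulting \<open>K\<close> is uniform in \<open>y\<close>.\<close>

lemma prod_scales_le:
  "\<exists>K. \<forall>y. 1 / 2 \<le> y \<and> y \<le> Y \<longrightarrow> (\<Prod>i<K. \<bar>cos (pi * (y * (129 / 2) ^ i))\<bar>) \<le> cos_bound ^ B"
proof (induction B arbitrary: Y)
  case 0
  show ?case by (intro exI[of _ 0]) simp
next
  case (Suc B)
  obtain L where L: "Y + 1 < 2 ^ L" using real_arch_pow[of 2 "Y + 1"] by auto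
  obtain K where K: "\<And>y. 1 / 2 \<le> y \<Longrightarrow> y \<le> Y * (129 / 2) ^ Suc L \<Longrightarrow>
      (\<Prod>i<K. \<bar>cos (pi * (y * (129 / 2) ^ i))\<bar>) \<le> cos_bound ^ B"
    using Suc[of "Y * (129 / 2) ^ Suc L"] by blast
  show ?case
  proof (intro exI[of _ "Suc L + K"] allI impI)
    fix y :: real assume y: "1 / 2 \<le> y \<and> y \<le> Y"
    let ?c = "\<lambda>i. \<bar>cos (pi * (y * (129 / 2) ^ i))\<bar>"
    obtain j where j: "j \<le> L" "\<And>m::int. 1 / 264 \<le> \<bar>y * (129 / 2) ^ j - of_int m\<bar>"
      using exists_scale_far_from_int[of y L] y L by auto
    have cj: "?c j \<le> cos_bound" using abs_cos_pi_le[OF j(2)] by (simp add: cos_bound_def)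
    have pw: "(129 / 2) ^ Suc j \<le> (129 / 2 :: real) ^ Suc L" using j by (intro power_increasing) auto
    have "1 * (1 / 2) \<le> (129 / 2) ^ Suc j * y" using y one_le_power[of "129 / 2 :: real" "Suc j"] by (intro mult_mono) auto
    then have low: "1 / 2 \<le> y * (129 / 2) ^ Suc j" by (simp only: mult.commute mult_1)
    have high: "y * (129 / 2) ^ Suc j \<le> Y * (129 / 2) ^ Suc L" using y pw by (intro mult_mono) auto
    have sub: "{j} \<union> {Suc j..<Suc j + K} \<subseteq> {..<Suc L + K}" using j by auto
    have "(\<Prod>i<Suc L + K. ?c i) = (\<Prod>i\<in>{..<Suc L + K} - ({j} \<union> {Suc j..<Suc j + K}). ?c i) * (\<Prod>i\<in>{j} \<union> {Suc j..<Suc j + K}. ?c i)"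
      by (rule prod.subset_diff[OF sub]) simp
    also have "\<dots> \<le> 1 * (\<Prod>i\<in>{j} \<union> {Suc j..<Suc j + K}. ?c i)"
      by (intro mult_right_mono prod_le_1 prod_nonneg) auto
    also have "\<dots> = ?c j * (\<Prod>i\<in>{Suc j..<Suc j + K}. ?c i)" by simp
    also have "(\<Prod>i\<in>{Suc j..<Suc j + K}. ?c i) = (\<Prod>i<K. ?c (i + Suc j))"
      using prod.shift_bounds_nat_ivl[of ?c 0 "Suc j" K] by (simp add: lessThan_atLeast0 add.commute)
    also have "\<dots> = (\<Prod>i<K. \<bar>cos (pi * ((y * (129 / 2) ^ Suc j) * (129 / 2) ^ i))\<bar>)"
      by (simp only: power_add mult.assoc mult.commute mult.left_commute)
    also have "?c j * \<dots> \<le> cos_bound * cos_bound ^ B"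
      by (intro mult_mono cj K low high prod_nonneg cos_bound) auto
    finally show "(\<Prod>i<Suc L + K. ?c i) \<le> cos_bound ^ Suc B" by simp
  qed
qed

text \<open>Write \<open>n\<close> as \<open>y * (129 / 2) ^ i\<close> with \<open>y\<close> between
  \<open>1 / 2\<close> and \<open>129 / 4\<close>. Read backwards from index \<open>i\<close>, the
  factors are the cosines of \<open>pi * y\<close> at growing scales, and for large \<open>n\<close>
  there are at least \<open>K\<close> of them.\<close>

lemma cov_tendsto_0: "((\<lambda>n. cov (int n)) \<longlonglongrightarrow> 0)"
proof (rule tendstoI)
  fix e :: real assume e: "0 < e"
  obtain B where B: "cos_bound ^ B < e" using real_arch_pow_inv[OF e cos_bound(2)] by blast
  obtain K where K: "\<And>y. 1 / 2 \<le> y \<Longrightarrow> y \<le> 129 / 4 \<Longrightarrow> (\<Prod>i<K. \<bar>cos (pi * (y * (129 / 2) ^ i))\<bar>) \<le> cos_bound ^ B"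
    using prod_scales_le[of "129 / 4" B] by blast
  have "\<bar>cov (int n)\<bar> < e" if n: "(129 / 2) ^ K < real n" for n
  proof -
    obtain j0 where "2 * real n < (129 / 2) ^ j0" using real_arch_pow[of "129 / 2" "2 * real n"] by auto
    then have ex: "\<exists>j. 2 * real n \<le> (129 / 2) ^ j" by (auto intro: less_imp_le)
    define j where "j = (LEAST j. 2 * real n \<le> (129 / 2) ^ j)"
    have j1: "2 * real n \<le> (129 / 2) ^ j" unfolding j_def using ex by (rule LeastI_ex)
    have jK: "K < j"
    proof (rule ccontr)
      assume "\<not> K < j"
      then have "(129 / 2) ^ j \<le> (129 / 2 :: real) ^ K" by (intro power_increasing) auto
      then show False using j1 n by linarith
    qed
    then obtain i where i: "j = Suc i" by (cases j) auto
    have j2: "(129 / 2) ^ i < 2 * real n"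
      using not_less_Least[of i "\<lambda>j. 2 * real n \<le> (129 / 2) ^ j"] i by (simp add: j_def[symmetric] not_le)
    define y where "y = real n * (2 / 129) ^ i"
    have inv: "(2 / 129) ^ i * (129 / 2) ^ i = (1::real)" by (simp add: power_mult_distrib[symmetric])
    have yn: "y * (129 / 2) ^ i = real n" unfolding y_def mult.assoc inv by simp
    have "1 / 2 \<le> y"
    proof -
      have "1 / 2 * (129 / 2) ^ i \<le> y * (129 / 2) ^ i" using j2 unfolding yn by simp
      then show ?thesis by (rule mult_right_le_imp_le) simp
    qed
    moreover have "y \<le> 129 / 4"
    proof -
      have "y * (129 / 2) ^ i \<le> 129 / 4 * (129 / 2) ^ i" using j1 unfolding i yn by simp
      then show ?thesis by (rule mult_right_le_imp_le) simp
    qed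
    ultimately have "(\<Prod>l<K. \<bar>cos (pi * (y * (129 / 2) ^ l))\<bar>) \<le> cos_bound ^ B" by (rule K)
    have "\<bar>cov (int n)\<bar> \<le> \<bar>partial_cov (Suc i) (int n)\<bar>" by (rule abs_cov_le)
    also have "\<dots> = (\<Prod>k<Suc i. \<bar>cos (of_int (int n) * angle k)\<bar>)" by (simp only: partial_cov_def abs_prod)
    also have "\<dots> = (\<Prod>l<Suc i. \<bar>cos (of_int (int n) * angle (Suc i - Suc l))\<bar>)"
      by (rule prod.nat_diff_reindex[symmetric])
    also have "\<dots> = (\<Prod>l<Suc i. \<bar>cos (pi * (y * (129 / 2) ^ l))\<bar>)"
    proof (intro prod.cong refl arg_cong[where f = abs] arg_cong[where f = cos])
      fix l assume "l \<in> {..<Suc i}"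
      then have l: "l \<le> i" by simp
      have "(2 / 129 :: real) ^ i * (129 / 2) ^ l = (2 / 129) ^ (i - l) * ((2 / 129) ^ l * (129 / 2) ^ l)"
        using l by (simp add: power_add[symmetric] mult.assoc[symmetric])
      also have "\<dots> = (2 / 129) ^ (i - l)" by (simp add: power_mult_distrib[symmetric])
      finally show "of_int (int n) * angle (Suc i - Suc l) = pi * (y * (129 / 2) ^ l)"
        unfolding y_def angle_def by (simp add: mult.assoc)
    qed
    also have "\<dots> = (\<Prod>l\<in>{..<Suc i} - {..<K}. \<bar>cos (pi * (y * (129 / 2) ^ l))\<bar>) * (\<Prod>l<K. \<bar>cos (pi * (y * (129 / 2) ^ l))\<bar>)"
      using jK i by (intro prod.subset_diff) auto
    also have "\<dots> \<le> 1 * (\<Prod>l<K. \<bar>cos (pi * (y * (129 / 2) ^ l))\<bar>)"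
      by (intro mult_right_mono prod_le_1 prod_nonneg) auto
    also have "\<dots> \<le> cos_bound ^ B" using \<open>(\<Prod>l<K. \<bar>cos (pi * (y * (129 / 2) ^ l))\<bar>) \<le> cos_bound ^ B\<close> by simp
    finally show ?thesis using B by simp
  qed
  moreover obtain N where "(129 / 2) ^ K < real N" using reals_Archimedean2 by blast
  ultimately show "\<forall>\<^sub>F n in sequentially. dist (cov (int n)) 0 < e"
    by (intro eventually_sequentiallyI[of N]) (auto simp: dist_real_def elim!: order.strict_trans2)
qed

section \<open>The Gaussian process\<close>

definition noise :: "(nat set \<Rightarrow> real) measure" where
  "noise = PiM UNIV (\<lambda>_. std_normal_distribution)"

text \<open>In \<open>partial_cov K (m - n)\<close> each factor is
  \<open>cos * cos + sin * sin\<close> by the addition theorem. Expanding the product over the set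
  \<open>F\<close> of indices at which the sines are taken exhibits it as an inner product of
  vectors indexed by \<open>F\<close>. The noise is indexed by the same sets, so consecutive levels
  share their variables and converge on one probability space.\<close>

definition coef :: "nat \<Rightarrow> int \<Rightarrow> nat set \<Rightarrow> real" where
  "coef K n F = (\<Prod>k\<in>F. sin (of_int n * angle k)) * (\<Prod>k\<in>{..<K} - F. cos (of_int n * angle k))"

definition approx_path :: "nat \<Rightarrow> (nat set \<Rightarrow> real) \<Rightarrow> int \<Rightarrow> real" where
  "approx_path K \<omega> n = (\<Sum>F\<in>Pow {..<K}. coef K n F * \<omega> F)"

definition gauss_path :: "(nat set \<Rightarrow> real) \<Rightarrow> int \<Rightarrow> real" where
  "gauss_path \<omega> n = lim (\<lambda>K. approx_path K \<omega> n)"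

abbreviation path_space :: "(int \<Rightarrow> real) measure" where
  "path_space \<equiv> PiM UNIV (\<lambda>_. borel)"

definition gauss_law :: "(int \<Rightarrow> real) measure" where
  "gauss_law = distr noise path_space gauss_path"

lemma prob_space_std_normal: "prob_space std_normal_distribution"
  by (rule prob_space_normal_density) simp

interpretation noise: prob_space noise
  unfolding noise_def by (intro prob_space_PiM prob_space_std_normal)

lemma measurable_noise_component_std: "(\<lambda>\<omega>. \<omega> F) \<in> measurable noise std_normal_distribution"
  unfolding noise_def by (rule measurable_component_singleton) simp

lemma measurable_noise_component [measurable]: "(\<lambda>\<omega>. \<omega> F) \<in> borel_measurable noise"
  using measurable_noise_component_std by (simp add: measurable_def)

lemma space_noise [simp]: "space noise = UNIV"
  by (simp add: noise_def space_PiM)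

lemma distr_noise_component: "distr noise std_normal_distribution (\<lambda>\<omega>. \<omega> F) = std_normal_distribution"
  unfolding noise_def by (rule distr_PiM_component) (auto intro: prob_space_std_normal)

lemma indep_noise: "noise.indep_vars (\<lambda>_. std_normal_distribution) (\<lambda>F \<omega>. \<omega> F) UNIV"
proof (subst noise.indep_vars_iff_distr_eq_PiM')
  show "(\<lambda>\<omega>. \<omega> F) \<in> measurable noise std_normal_distribution" for F
    by (rule measurable_noise_component_std)
  show "distr noise (Pi\<^sub>M UNIV (\<lambda>_. std_normal_distribution)) (\<lambda>\<omega>. \<lambda>F\<in>UNIV. \<omega> F) =
      Pi\<^sub>M UNIV (\<lambda>F. distr noise std_normal_distribution (\<lambda>\<omega>. \<omega> F))"
    unfolding distr_noise_component by (simp add: noise_def restrict_def distr_id2)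
qed auto

lemma char_noise_component:
  "char (distr noise borel (\<lambda>\<omega>. a * \<omega> F)) s = exp (- (s * a)\<^sup>2 / 2)"
proof -
  have "char (distr noise borel (\<lambda>\<omega>. a * \<omega> F)) s = (\<integral>\<omega>. iexp (s * a * \<omega> F) \<partial>noise)"
    unfolding char_def by (subst integral_distr) (auto simp: mult.assoc)
  also have "\<dots> = (\<integral>x. iexp (s * a * x) \<partial>distr noise std_normal_distribution (\<lambda>\<omega>. \<omega> F))"
    by (subst integral_distr[OF measurable_noise_component_std]) auto
  also have "\<dots> = char std_normal_distribution (s * a)"
    unfolding distr_noise_component char_def ..
  finally show ?thesis by (simp add: char_std_normal_distribution)
qed

lemma integral_iexp_noise:
  assumes "finite I"
  shows "(\<integral>\<omega>. iexp (\<Sum>F\<in>I. a F * \<omega> F) \<partial>noise) = exp (- (\<Sum>F\<in>I. (a F)\<^sup>2) / 2)"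
proof -
  have "noise.indep_vars (\<lambda>_. borel) (\<lambda>F \<omega>. a F * \<omega> F) I"
    by (rule noise.indep_vars_compose2[OF noise.indep_vars_subset[OF indep_noise]]) auto
  then have "char (distr noise borel (\<lambda>\<omega>. \<Sum>F\<in>I. a F * \<omega> F)) 1 = (\<Prod>F\<in>I. char (distr noise borel (\<lambda>\<omega>. a F * \<omega> F)) 1)"
    by (rule noise.char_distr_sum)
  also have "\<dots> = exp (\<Sum>F\<in>I. - (a F)\<^sup>2 / 2)"
    unfolding char_noise_component using assms by (simp add: exp_sum)
  also have "char (distr noise borel (\<lambda>\<omega>. \<Sum>F\<in>I. a F * \<omega> F)) 1 = (\<integral>\<omega>. iexp (\<Sum>F\<in>I. a F * \<omega> F) \<partial>noise)"
    unfolding char_def by (subst integral_distr) auto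
  finally show ?thesis by (simp add: sum_divide_distrib sum_negf)
qed

lemma nn_integral_abs_noise_le: "(\<integral>\<^sup>+\<omega>. ennreal \<bar>\<omega> F\<bar> \<partial>noise) \<le> 1"
proof -
  have "(\<integral>\<^sup>+\<omega>. ennreal \<bar>\<omega> F\<bar> \<partial>noise) = (\<integral>\<^sup>+x. ennreal \<bar>x\<bar> \<partial>distr noise std_normal_distribution (\<lambda>\<omega>. \<omega> F))"
    by (subst nn_integral_distr[OF measurable_noise_component_std]) auto
  also have "\<dots> = (\<integral>\<^sup>+x. ennreal (std_normal_density x * \<bar>x\<bar> ^ (2 * 0 + 1)) \<partial>lborel)"
    unfolding distr_noise_component by (subst nn_integral_density) (auto simp: ennreal_mult')
  also have "\<dots> = ennreal (sqrt (2 / pi))"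
    using std_normal_moment_abs_odd[of 0]
    by (subst nn_integral_eq_integral) (auto simp: has_bochner_integral_iff normal_density_nonneg)
  also have "\<dots> \<le> 1" using pi_gt3 by (simp add: ennreal_le_1 real_sqrt_le_1_iff)
  finally show ?thesis .
qed

lemma sum_coef: "(\<Sum>F\<in>Pow {..<K}. coef K m F * coef K n F) = partial_cov K (m - n)"
proof -
  have "partial_cov K (m - n) = (\<Prod>k<K. sin (of_int m * angle k) * sin (of_int n * angle k) + cos (of_int m * angle k) * cos (of_int n * angle k))"
    unfolding partial_cov_def by (intro prod.cong) (auto simp: cos_diff left_diff_distrib)
  also have "\<dots> = (\<Sum>F\<in>Pow {..<K}. coef K m F * coef K n F)"
    unfolding coef_def by (subst prod_add) (auto simp: prod.distrib intro!: sum.cong)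
  finally show ?thesis by simp
qed

lemma abs_coef_le_1: "\<bar>coef K n F\<bar> \<le> 1"
proof -
  have "\<bar>coef K n F\<bar> = (\<Prod>k\<in>F. \<bar>sin (of_int n * angle k)\<bar>) * (\<Prod>k\<in>{..<K} - F. \<bar>cos (of_int n * angle k)\<bar>)"
    by (simp add: coef_def abs_mult abs_prod)
  also have "\<dots> \<le> 1 * 1" by (intro mult_mono prod_le_1 prod_nonneg) auto
  finally show ?thesis by simp
qed

lemma approx_path_measurable [measurable]: "(\<lambda>\<omega>. approx_path K \<omega> n) \<in> borel_measurable noise"
  unfolding approx_path_def by measurable

lemma gauss_path_component_measurable [measurable]: "(\<lambda>\<omega>. gauss_path \<omega> n) \<in> borel_measurable noise"
  unfolding gauss_path_def by measurable

lemma gauss_path_measurable [measurable]: "gauss_path \<in> measurable noise path_space"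
  using measurable_PiM_single'[of UNIV "\<lambda>n \<omega>. gauss_path \<omega> n" noise "\<lambda>_. borel"] by auto

section \<open>Convergence of the finite levels, almost surely and in mean\<close>

lemma approx_path_Suc_diff:
  "approx_path (Suc K) \<omega> n - approx_path K \<omega> n =
    (\<Sum>F\<in>Pow {..<K}. coef K n F * ((cos (of_int n * angle K) - 1) * \<omega> F + sin (of_int n * angle K) * \<omega> (insert K F)))"
proof -
  have c1: "coef (Suc K) n F = coef K n F * cos (of_int n * angle K)" if "F \<in> Pow {..<K}" for F
  proof -
    have "K \<notin> F" using that by auto
    then have "{..<Suc K} - F = insert K ({..<K} - F)" by auto
    then show ?thesis unfolding coef_def by simp
  qed
  have c2: "coef (Suc K) n (insert K F) = coef K n F * sin (of_int n * angle K)" if "F \<in> Pow {..<K}" for F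
  proof -
    have "K \<notin> F" "finite F" using that by (auto intro: finite_subset)
    moreover have "{..<Suc K} - insert K F = {..<K} - F" by auto
    ultimately show ?thesis unfolding coef_def by simp
  qed
  have "inj_on (insert K) (Pow {..<K})" by (auto simp: inj_on_def)
  moreover have "Pow {..<K} \<inter> insert K ` Pow {..<K} = {}" by auto
  ultimately have "approx_path (Suc K) \<omega> n =
      (\<Sum>F\<in>Pow {..<K}. coef (Suc K) n F * \<omega> F) + (\<Sum>F\<in>Pow {..<K}. coef (Suc K) n (insert K F) * \<omega> (insert K F))"
    unfolding approx_path_def lessThan_Suc Pow_insert by (simp add: sum.union_disjoint sum.reindex)
  also have "\<dots> = (\<Sum>F\<in>Pow {..<K}. coef K n F * cos (of_int n * angle K) * \<omega> F) +
      (\<Sum>F\<in>Pow {..<K}. coef K n F * sin (of_int n * angle K) * \<omega> (insert K F))"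
    by (intro arg_cong2[where f = "(+)"] sum.cong) (auto simp: c1 c2)
  finally show ?thesis
    unfolding approx_path_def by (simp add: sum.distrib[symmetric] sum_subtractf[symmetric] algebra_simps)
qed

text \<open>The triangle inequality over the \<open>2 ^ K\<close> terms, each with coefficients of
  size at most \<open>\<bar>n\<bar> * angle K\<close>. The loss of the factor \<open>2 ^ K\<close>
  against an orthogonality argument is harmless, as \<open>2 ^ K * (2 / 129) ^ K\<close> is still
  below \<open>(1 / 32) ^ K\<close>.\<close>

lemma nn_integral_approx_path_diff_le:
  "(\<integral>\<^sup>+\<omega>. ennreal \<bar>approx_path (Suc K) \<omega> n - approx_path K \<omega> n\<bar> \<partial>noise) \<le> ennreal (8 * \<bar>of_int n\<bar> * (1 / 32) ^ K)"
proof -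
  define c where "c = \<bar>of_int n\<bar> * angle K"
  have c0: "0 \<le> c" by (simp add: c_def angle_def)
  have cc: "\<bar>cos (of_int n * angle K) - 1\<bar> \<le> c"
    using abs_one_minus_cos_le[of "of_int n * angle K"] by (simp add: c_def abs_mult angle_def abs_minus_commute)
  have cs: "\<bar>sin (of_int n * angle K)\<bar> \<le> c"
    using abs_sin_x_le_abs_x[of "of_int n * angle K"] by (simp add: c_def abs_mult angle_def)
  have bound: "\<bar>approx_path (Suc K) \<omega> n - approx_path K \<omega> n\<bar> \<le> (\<Sum>F\<in>Pow {..<K}. c * \<bar>\<omega> F\<bar> + c * \<bar>\<omega> (insert K F)\<bar>)" for \<omega>
    unfolding approx_path_Suc_diff
  proof (rule order_trans[OF sum_abs], rule sum_mono)
    fix F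
    have "\<bar>coef K n F * ((cos (of_int n * angle K) - 1) * \<omega> F + sin (of_int n * angle K) * \<omega> (insert K F))\<bar> \<le>
        1 * \<bar>(cos (of_int n * angle K) - 1) * \<omega> F + sin (of_int n * angle K) * \<omega> (insert K F)\<bar>"
      unfolding abs_mult by (intro mult_right_mono abs_coef_le_1) auto
    also have "\<dots> \<le> \<bar>cos (of_int n * angle K) - 1\<bar> * \<bar>\<omega> F\<bar> + \<bar>sin (of_int n * angle K)\<bar> * \<bar>\<omega> (insert K F)\<bar>"
      unfolding mult_1 by (rule order_trans[OF abs_triangle_ineq]) (simp add: abs_mult)
    also have "\<dots> \<le> c * \<bar>\<omega> F\<bar> + c * \<bar>\<omega> (insert K F)\<bar>" by (intro add_mono mult_right_mono cc cs) auto
    finally show "\<bar>coef K n F * ((cos (of_int n * angle K) - 1) * \<omega> F + sin (of_int n * angle K) * \<omega> (insert K F))\<bar> \<le> c * \<bar>\<omega> F\<bar> + c * \<bar>\<omega> (insert K F)\<bar>" .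
  qed
  have "(\<integral>\<^sup>+\<omega>. ennreal \<bar>approx_path (Suc K) \<omega> n - approx_path K \<omega> n\<bar> \<partial>noise) \<le>
      (\<integral>\<^sup>+\<omega>. ennreal (\<Sum>F\<in>Pow {..<K}. c * \<bar>\<omega> F\<bar> + c * \<bar>\<omega> (insert K F)\<bar>) \<partial>noise)"
    by (intro nn_integral_mono ennreal_leI bound)
  also have "\<dots> = (\<integral>\<^sup>+\<omega>. (\<Sum>F\<in>Pow {..<K}. ennreal c * ennreal \<bar>\<omega> F\<bar> + ennreal c * ennreal \<bar>\<omega> (insert K F)\<bar>) \<partial>noise)"
    using c0 by (simp add: sum_ennreal[symmetric] ennreal_mult)
  also have "\<dots> = (\<Sum>F\<in>Pow {..<K}. ennreal c * (\<integral>\<^sup>+\<omega>. ennreal \<bar>\<omega> F\<bar> \<partial>noise) + ennreal c * (\<integral>\<^sup>+\<omega>. ennreal \<bar>\<omega> (insert K F)\<bar> \<partial>noise))"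
    by (simp add: nn_integral_sum nn_integral_add nn_integral_cmult)
  also have "\<dots> \<le> (\<Sum>F\<in>Pow {..<K}. ennreal c * 1 + ennreal c * 1)"
    by (intro sum_mono add_mono mult_left_mono nn_integral_abs_noise_le) auto
  also have "\<dots> = ennreal (2 ^ K * (2 * c))"
    using c0 by (simp add: card_Pow ennreal_plus[symmetric] ennreal_mult ennreal_of_nat_eq_real_of_nat ennreal_power[symmetric] del: ennreal_plus) 
  also have "\<dots> \<le> ennreal (8 * \<bar>of_int n\<bar> * (1 / 32) ^ K)"
  proof (rule ennreal_leI)
    have "2 ^ K * (2 * c) = 2 * pi * \<bar>of_int n\<bar> * (2 ^ K * (2 / 129) ^ K)" by (simp add: c_def angle_def)
    also have "2 ^ K * (2 / 129) ^ K = (4 / 129 :: real) ^ K" by (simp add: power_mult_distrib[symmetric])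
    also have "2 * pi * \<bar>of_int n\<bar> * (4 / 129) ^ K \<le> 8 * \<bar>of_int n\<bar> * (1 / 32) ^ K"
      using pi_less_4 by (intro mult_mono power_mono) auto
    finally show "2 ^ K * (2 * c) \<le> 8 * \<bar>of_int n\<bar> * (1 / 32) ^ K" by simp
  qed
  finally show ?thesis .
qed

lemma suminf_geometric_tail:
  assumes "0 \<le> (c::real)"
  shows "(\<Sum>k. ennreal (c * (1 / 32) ^ (k + K))) \<le> ennreal (2 * c * (1 / 32) ^ K)"
proof -
  have s: "(\<lambda>k. c * (1 / 32) ^ K * (1 / 32) ^ k) sums (c * (1 / 32) ^ K * (1 / (1 - 1 / 32)))"
    by (intro sums_mult geometric_sums) simp
  have "(\<Sum>k. ennreal (c * (1 / 32) ^ (k + K))) = (\<Sum>k. ennreal (c * (1 / 32) ^ K * (1 / 32) ^ k))"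
    by (simp add: power_add mult_ac)
  also have "\<dots> = ennreal (\<Sum>k. c * (1 / 32) ^ K * (1 / 32) ^ k)"
    using assms sums_summable[OF s] by (intro suminf_ennreal2) auto
  also have "(\<Sum>k. c * (1 / 32) ^ K * (1 / 32) ^ k) = c * (1 / 32) ^ K * (1 / (1 - 1 / 32))"
    by (rule sums_unique[OF s, symmetric])
  also have "\<dots> \<le> ennreal (2 * c * (1 / 32) ^ K)"
    using assms by (intro ennreal_leI) (simp add: mult_right_mono)
  finally show ?thesis .
qed

lemma nn_integral_tail_le:
  "(\<integral>\<^sup>+\<omega>. (\<Sum>k. ennreal \<bar>approx_path (Suc (k + K)) \<omega> n - approx_path (k + K) \<omega> n\<bar>) \<partial>noise) \<le>
    ennreal (16 * \<bar>of_int n\<bar> * (1 / 32) ^ K)"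
proof -
  have "(\<integral>\<^sup>+\<omega>. (\<Sum>k. ennreal \<bar>approx_path (Suc (k + K)) \<omega> n - approx_path (k + K) \<omega> n\<bar>) \<partial>noise) =
      (\<Sum>k. \<integral>\<^sup>+\<omega>. ennreal \<bar>approx_path (Suc (k + K)) \<omega> n - approx_path (k + K) \<omega> n\<bar> \<partial>noise)"
    by (rule nn_integral_suminf) measurable
  also have "\<dots> \<le> (\<Sum>k. ennreal (8 * \<bar>of_int n\<bar> * (1 / 32) ^ (k + K)))"
    by (intro suminf_le nn_integral_approx_path_diff_le summableI)
  also have "\<dots> \<le> ennreal (2 * (8 * \<bar>of_int n\<bar>) * (1 / 32) ^ K)"
    by (rule suminf_geometric_tail) simp
  finally show ?thesis by simp
qed

text \<open>The increments have a summable series of first moments, hence are almost surely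
  absolutely summable. The tail bound in the second conjunct is what turns this into a rate in
  mean.\<close>

lemma AE_approx_path:
  "AE \<omega> in noise. (\<lambda>K. approx_path K \<omega> n) \<longlonglongrightarrow> gauss_path \<omega> n \<and>
    (\<forall>K. ennreal \<bar>gauss_path \<omega> n - approx_path K \<omega> n\<bar> \<le> (\<Sum>k. ennreal \<bar>approx_path (Suc (k + K)) \<omega> n - approx_path (k + K) \<omega> n\<bar>))"
proof -
  have "AE \<omega> in noise. (\<Sum>k. ennreal \<bar>approx_path (Suc (k + 0)) \<omega> n - approx_path (k + 0) \<omega> n\<bar>) \<noteq> \<infinity>"
    using nn_integral_tail_le[of 0 n] by (intro nn_integral_noteq_infinite) (auto simp: top_unique)
  then show ?thesis
  proof eventually_elim
    case (elim \<omega>)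
    let ?a = "\<lambda>K. approx_path K \<omega> n"
    have summ: "summable (\<lambda>k. \<bar>?a (Suc k) - ?a k\<bar>)"
      using elim by (intro summable_suminf_not_top) auto
    then have "summable (\<lambda>k. ?a (Suc k) - ?a k)" by (rule summable_rabs_cancel)
    then have "convergent ?a"
      by (simp only: summable_iff_convergent sum_lessThan_telescope[of ?a] convergent_diff_const_right_iff)
    then have lim: "?a \<longlonglongrightarrow> gauss_path \<omega> n" by (simp add: gauss_path_def convergent_LIMSEQ_iff)
    moreover have "ennreal \<bar>gauss_path \<omega> n - ?a K\<bar> \<le> (\<Sum>k. ennreal \<bar>?a (Suc (k + K)) - ?a (k + K)\<bar>)" for K
    proof -
      have sK: "summable (\<lambda>k. \<bar>?a (Suc (k + K)) - ?a (k + K)\<bar>)"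
        using summ by (subst summable_iff_shift[of "\<lambda>k. \<bar>?a (Suc k) - ?a k\<bar>" K])
      have "(\<lambda>k. ?a (Suc (k + K)) - ?a (k + K)) sums (gauss_path \<omega> n - ?a (0 + K))"
        using telescope_sums[OF LIMSEQ_ignore_initial_segment[OF lim, of K]] by simp
      then have "gauss_path \<omega> n - ?a K = (\<Sum>k. ?a (Suc (k + K)) - ?a (k + K))" by (simp add: sums_unique)
      then have "\<bar>gauss_path \<omega> n - ?a K\<bar> \<le> (\<Sum>k. \<bar>?a (Suc (k + K)) - ?a (k + K)\<bar>)"
        using summable_rabs[OF sK] by simp
      then have "ennreal \<bar>gauss_path \<omega> n - ?a K\<bar> \<le> ennreal (\<Sum>k. \<bar>?a (Suc (k + K)) - ?a (k + K)\<bar>)" by (rule ennreal_leI)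
      also have "\<dots> = (\<Sum>k. ennreal \<bar>?a (Suc (k + K)) - ?a (k + K)\<bar>)"
        using sK by (intro suminf_ennreal2[symmetric]) auto
      finally show ?thesis .
    qed
    ultimately show ?case by simp
  qed
qed

lemma nn_integral_gauss_path_diff_le:
  "(\<integral>\<^sup>+\<omega>. ennreal \<bar>gauss_path \<omega> n - approx_path K \<omega> n\<bar> \<partial>noise) \<le> ennreal (16 * \<bar>of_int n\<bar> * (1 / 32) ^ K)"
proof -
  have "(\<integral>\<^sup>+\<omega>. ennreal \<bar>gauss_path \<omega> n - approx_path K \<omega> n\<bar> \<partial>noise) \<le>
      (\<integral>\<^sup>+\<omega>. (\<Sum>k. ennreal \<bar>approx_path (Suc (k + K)) \<omega> n - approx_path (k + K) \<omega> n\<bar>) \<partial>noise)"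
    by (intro nn_integral_mono_AE) (use AE_approx_path[of n] in eventually_elim, blast)
  also note nn_integral_tail_le
  finally show ?thesis .
qed

section \<open>The law on path space and its characteristic function\<close>

interpretation gauss_law: prob_space gauss_law
  unfolding gauss_law_def by (rule noise.prob_space_distr) measurable

lemma sets_gauss_law [simp, measurable_cong]: "sets gauss_law = sets path_space"
  by (simp add: gauss_law_def)

lemma space_gauss_law [simp]: "space gauss_law = UNIV"
  by (simp add: gauss_law_def space_PiM)

text \<open>At level \<open>K\<close> the form is a finite linear combination of independent normal
  variables, with variance given by \<open>sum_coef\<close>. Dominated convergence with the bound
  \<open>1\<close> passes to the limit.\<close>

lemma integral_iexp_gauss_law:
  assumes J: "finite J"
  shows "(\<integral>x. iexp (\<Sum>j\<in>J. t j * x (a j)) \<partial>gauss_law) = exp (- (\<Sum>i\<in>J. \<Sum>j\<in>J. t i * t j * cov (a i - a j)) / 2)"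
proof -
  have "(\<integral>x. iexp (\<Sum>j\<in>J. t j * x (a j)) \<partial>gauss_law) = (\<integral>\<omega>. iexp (\<Sum>j\<in>J. t j * gauss_path \<omega> (a j)) \<partial>noise)"
    unfolding gauss_law_def by (subst integral_distr) auto
  moreover have "(\<lambda>K. \<integral>\<omega>. iexp (\<Sum>j\<in>J. t j * approx_path K \<omega> (a j)) \<partial>noise) \<longlonglongrightarrow> (\<integral>\<omega>. iexp (\<Sum>j\<in>J. t j * gauss_path \<omega> (a j)) \<partial>noise)"
  proof (rule integral_dominated_convergence[where w = "\<lambda>_. 1"])
    have "AE \<omega> in noise. \<forall>j\<in>J. (\<lambda>K. approx_path K \<omega> (a j)) \<longlonglongrightarrow> gauss_path \<omega> (a j)"
      using AE_approx_path by (intro AE_finite_allI[OF J]) (auto elim: AE_mp)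
    then show "AE \<omega> in noise. (\<lambda>K. iexp (\<Sum>j\<in>J. t j * approx_path K \<omega> (a j))) \<longlonglongrightarrow> iexp (\<Sum>j\<in>J. t j * gauss_path \<omega> (a j))"
      by eventually_elim (intro tendsto_intros, auto)
  qed auto
  moreover have "(\<integral>\<omega>. iexp (\<Sum>j\<in>J. t j * approx_path K \<omega> (a j)) \<partial>noise) =
      exp (- (\<Sum>i\<in>J. \<Sum>j\<in>J. t i * t j * partial_cov K (a i - a j)) / 2)" for K
  proof -
    define b where "b F = (\<Sum>j\<in>J. t j * coef K (a j) F)" for F
    have "(\<Sum>j\<in>J. t j * approx_path K \<omega> (a j)) = (\<Sum>F\<in>Pow {..<K}. b F * \<omega> F)" for \<omega>
      unfolding approx_path_def b_def sum_distrib_left sum_distrib_right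
      by (subst sum.swap) (simp add: mult.assoc)
    moreover have "(\<Sum>F\<in>Pow {..<K}. (b F)\<^sup>2) = (\<Sum>i\<in>J. \<Sum>j\<in>J. t i * t j * partial_cov K (a i - a j))"
    proof -
      have "(\<Sum>F\<in>Pow {..<K}. (b F)\<^sup>2) = (\<Sum>F\<in>Pow {..<K}. \<Sum>i\<in>J. \<Sum>j\<in>J. t i * t j * (coef K (a i) F * coef K (a j) F))"
        unfolding b_def power2_eq_square sum_product by (simp add: mult.assoc mult.left_commute)
      also have "\<dots> = (\<Sum>i\<in>J. \<Sum>j\<in>J. \<Sum>F\<in>Pow {..<K}. t i * t j * (coef K (a i) F * coef K (a j) F))"
        by (subst sum.swap, rule sum.cong[OF refl], rule sum.swap)
      finally show ?thesis by (simp only: sum_distrib_left[symmetric] sum_coef)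
    qed
    ultimately show ?thesis using integral_iexp_noise[of "Pow {..<K}" b] by simp
  qed
  moreover have "(\<lambda>K. complex_of_real (exp (- (\<Sum>i\<in>J. \<Sum>j\<in>J. t i * t j * partial_cov K (a i - a j)) / 2))) \<longlonglongrightarrow>
      complex_of_real (exp (- (\<Sum>i\<in>J. \<Sum>j\<in>J. t i * t j * cov (a i - a j)) / 2))"
    by (intro tendsto_intros partial_cov_tendsto) auto
  ultimately show ?thesis using LIMSEQ_unique by simp
qed

text \<open>As a measurability rule this fact would also capture the coordinates of \<open>path_space\<close>.\<close>

declare measurable_noise_component [measurable del]

text \<open>Lists permit repeated coordinates: a sum of forms is a concatenation, and composing a
  form with a shift is a map over the list. This also suits \<open>reflect\<close>, which moves
  weight from all coordinates to coordinate \<open>0\<close>.\<close>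

definition lin :: "(real \<times> int) list \<Rightarrow> (int \<Rightarrow> real) \<Rightarrow> real" where
  "lin ps x = (\<Sum>p\<leftarrow>ps. fst p * x (snd p))"

definition cov_form :: "(real \<times> int) list \<Rightarrow> (real \<times> int) list \<Rightarrow> real" where
  "cov_form ps qs = (\<Sum>p\<leftarrow>ps. \<Sum>q\<leftarrow>qs. fst p * fst q * cov (snd p - snd q))"

lemma lin_simps [simp]:
  "lin [] x = 0" "lin (p # ps) x = fst p * x (snd p) + lin ps x" "lin (ps @ qs) x = lin ps x + lin qs x"
  by (simp_all add: lin_def)

lemma lin_scale: "lin (map (\<lambda>q. (s * fst q, snd q)) ps) x = s * lin ps x"
  by (induction ps) (auto simp: algebra_simps)

lemma lin_measurable [measurable]: "lin ps \<in> borel_measurable path_space"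
proof (induction ps)
  case Nil
  have "lin [] = (\<lambda>_. 0)" by (rule ext) simp
  then show ?case by simp
next
  case (Cons p ps)
  have "lin (p # ps) = (\<lambda>x. fst p * x (snd p) + lin ps x)" by (rule ext) simp
  moreover have "(\<lambda>x. x (snd p)) \<in> borel_measurable path_space"
    by (rule measurable_component_singleton) simp
  ultimately show ?case using Cons by simp
qed

lemma cov_form_Nil [simp]: "cov_form [] qs = 0" "cov_form ps [] = 0"
  by (simp_all add: cov_form_def)

lemma cov_form_Cons:
  "cov_form (p # ps) qs = (\<Sum>q\<leftarrow>qs. fst p * fst q * cov (snd p - snd q)) + cov_form ps qs"
  by (simp add: cov_form_def)

lemma cov_form_append:
  "cov_form (ps @ ps') qs = cov_form ps qs + cov_form ps' qs"
  "cov_form ps (qs @ qs') = cov_form ps qs + cov_form ps qs'"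
  by (simp_all add: cov_form_def sum_list_addf)

lemma cov_commute: "cov (a - b) = cov (b - a)"
  using cov_minus[of "b - a"] by simp

lemma cov_form_commute: "cov_form ps qs = cov_form qs ps"
proof -
  have "cov_form ps qs = (\<Sum>i<length ps. \<Sum>j<length qs. fst (ps ! i) * fst (qs ! j) * cov (snd (ps ! i) - snd (qs ! j)))" for ps qs
    by (simp add: cov_form_def sum_list_sum_nth lessThan_atLeast0)
  note eq = this
  show ?thesis unfolding eq[of ps qs] eq[of qs ps]
    by (subst sum.swap, intro sum.cong refl) (simp add: cov_commute[of "snd (ps ! _)"] mult.commute)
qed

lemma integral_iexp_lin: "(\<integral>x. iexp (lin ps x) \<partial>gauss_law) = exp (- cov_form ps ps / 2)"
proof -
  have "lin ps x = (\<Sum>i<length ps. fst (ps ! i) * x (snd (ps ! i)))" for x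
    by (simp add: lin_def sum_list_sum_nth lessThan_atLeast0)
  moreover have "cov_form ps ps = (\<Sum>i<length ps. \<Sum>j<length ps. fst (ps ! i) * fst (ps ! j) * cov (snd (ps ! i) - snd (ps ! j)))"
    by (simp add: cov_form_def sum_list_sum_nth lessThan_atLeast0)
  ultimately show ?thesis
    using integral_iexp_gauss_law[of "{..<length ps}" "\<lambda>i. fst (ps ! i)" "\<lambda>i. snd (ps ! i)"] by simp
qed

lemma measurable_gauss_law_component: "(\<lambda>x. x n) \<in> borel_measurable gauss_law"
  unfolding measurable_cong_sets[OF sets_gauss_law refl] by (rule measurable_component_singleton) simp

lemma distr_gauss_law_component: "distr gauss_law borel (\<lambda>x. x n) = std_normal_distribution"
proof (rule Levy_uniqueness)
  show "real_distribution (distr gauss_law borel (\<lambda>x. x n))"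
    by (rule gauss_law.real_distribution_distr) (rule measurable_gauss_law_component)
  show "real_distribution std_normal_distribution"
    by (rule real_dist_normal_dist)
  show "char (distr gauss_law borel (\<lambda>x. x n)) = char std_normal_distribution"
  proof
    fix s
    have "char (distr gauss_law borel (\<lambda>x. x n)) s = (\<integral>x. iexp (lin [(s, n)] x) \<partial>gauss_law)"
      unfolding char_def by (subst integral_distr[OF measurable_gauss_law_component]) auto
    also have "\<dots> = char std_normal_distribution s"
      unfolding integral_iexp_lin char_std_normal_distribution by (simp add: cov_form_Cons cov_0 power2_eq_square)
    finally show "char (distr gauss_law borel (\<lambda>x. x n)) s = char std_normal_distribution s" .
  qed
qed

lemma measure_gauss_law_component: 
  assumes "A \<in> sets borel"
  shows "measure gauss_law {x. x n \<in> A} = measure std_normal_distribution A"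
  unfolding distr_gauss_law_component[of n, symmetric] using assms by (subst measure_distr[OF measurable_gauss_law_component]) (auto simp: vimage_def)

text \<open>Without atoms in the coordinates, \<open>box_convergence\<close> applies to all boxes
  and not only to almost all of them.\<close>

lemma measure_gauss_law_atom: "measure gauss_law {x. x n = a} = 0"
proof -
  have "emeasure std_normal_distribution {a} = 0"
    by (subst emeasure_density) (auto intro!: nn_integral_null_set[THEN trans] simp: nn_integral_indicator_singleton')
  then show ?thesis using measure_gauss_law_component[of "{a}" n] by (simp add: measure_def)
qed

definition boxes :: "(int \<Rightarrow> real) set set" where
  "boxes = {{x. \<forall>j\<in>J. x j \<le> a j} | J a. finite J}"

lemma UNIV_in_boxes: "UNIV \<in> boxes"
  unfolding boxes_def by (auto intro!: exI[of _ "{}"])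

lemma Int_stable_boxes: "Int_stable boxes"
proof (rule Int_stableI)
  fix A B assume "A \<in> boxes" "B \<in> boxes"
  then obtain J a K b where J: "finite J" "A = {x. \<forall>j\<in>J. x j \<le> a j}" and K: "finite K" "B = {x. \<forall>j\<in>K. x j \<le> b j}"
    by (auto simp: boxes_def)
  define c where "c j = (if j \<in> J then if j \<in> K then min (a j) (b j) else a j else b j)" for j
  have "A \<inter> B = {x. \<forall>j\<in>J \<union> K. x j \<le> c j}" unfolding J K c_def by auto
  then show "A \<inter> B \<in> boxes" unfolding boxes_def using J K by blast
qed

lemma sets_path_space: "sets path_space = sigma_sets UNIV boxes"
proof
  let ?S = "sigma UNIV boxes"
  have "(\<lambda>x j. x j) \<in> measurable ?S path_space"
  proof (rule measurable_PiM_single')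
    fix i :: int
    show "(\<lambda>x. x i) \<in> borel_measurable ?S"
    proof (rule borel_measurableI_le)
      fix y
      have "{x. x i \<le> y} \<in> boxes" unfolding boxes_def by (auto intro!: exI[of _ "{i}"] exI[of _ "\<lambda>_. y"])
      then show "{x \<in> space ?S. x i \<le> y} \<in> sets ?S" by (simp add: space_measure_of_conv)
    qed
  qed auto
  then have "(\<lambda>x. x) -` A \<inter> space ?S \<in> sets ?S" if "A \<in> sets path_space" for A
    using that by (rule measurable_sets)
  then show "sets path_space \<subseteq> sigma_sets UNIV boxes" by (auto simp: space_measure_of_conv)
  have "{x. \<forall>j\<in>J. x j \<le> a j} \<in> sets path_space" if "finite J" for J and a :: "int \<Rightarrow> real"
  proof -
    have "{x \<in> space path_space. \<forall>j\<in>J. x j \<le> a j} \<in> sets path_space" using that by measurable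
    then show ?thesis by (simp add: space_PiM)
  qed
  then have "boxes \<subseteq> sets path_space" by (auto simp: boxes_def)
  then show "sigma_sets UNIV boxes \<subseteq> sets path_space"
    using sets.sigma_sets_subset[of boxes path_space] by (simp add: space_PiM)
qed

text \<open>Applied to a constant sequence, \<open>box_convergence\<close> becomes a uniqueness
  theorem on boxes, and these form an intersection-stable generator.\<close>

lemma gauss_law_eqI:
  assumes M: "prob_space M" "sets M = sets path_space"
    and char: "\<And>ps. (\<integral>x. iexp (lin ps x) \<partial>M) = exp (- cov_form ps ps / 2)"
  shows "M = gauss_law"
proof (rule measure_eqI_generator_eq[OF Int_stable_boxes, of UNIV])
  interpret M: prob_space M by fact
  fix X assume "X \<in> boxes"
  then obtain J a where J: "finite J" "X = {x. \<forall>j\<in>J. x j \<le> a j}" by (auto simp: boxes_def)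
  have "(\<lambda>n::nat. measure M {x \<in> space gauss_law. \<forall>j\<in>J. x j \<le> a j}) \<longlonglongrightarrow> measure gauss_law {x \<in> space gauss_law. \<forall>j\<in>J. x j \<le> a j}"
  proof (rule box_convergence[where V = "range lin" and f = "\<lambda>j x. x j"])
    show "(\<lambda>x. g x + s * h x) \<in> range lin" if gh: "g \<in> range lin" "h \<in> range lin" for g h s
    proof -
      obtain ps qs where "g = lin ps" "h = lin qs" using gh by blast
      then have "(\<lambda>x. g x + s * h x) = lin (ps @ map (\<lambda>q. (s * fst q, snd q)) qs)"
        by (auto simp: lin_scale)
      then show ?thesis by simp
    qed
    show "(\<lambda>_. 0) \<in> range lin" by (rule range_eqI[of _ _ "[]"]) auto
    show "(\<lambda>x. x j) \<in> range lin" for j by (rule range_eqI[of _ _ "[(1, j)]"]) auto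
    show "(\<lambda>n::nat. \<integral>x. iexp (h x) \<partial>M) \<longlonglongrightarrow> (\<integral>x. iexp (h x) \<partial>gauss_law)" if "h \<in> range lin" for h
      using that by (auto simp: char integral_iexp_lin)
  qed (use M J gauss_law.prob_space_axioms measure_gauss_law_atom in auto)
  then show "emeasure M X = emeasure gauss_law X"
    by (simp add: LIMSEQ_const_iff J M.emeasure_eq_measure gauss_law.emeasure_eq_measure)
next
  show "range (\<lambda>_::nat. UNIV) \<subseteq> boxes" using UNIV_in_boxes by auto
  show "sets M = sigma_sets UNIV boxes" by (simp only: M sets_path_space)
  show "sets gauss_law = sigma_sets UNIV boxes" by (simp only: sets_gauss_law sets_path_space)
  interpret M: prob_space M by fact
  show "emeasure M UNIV \<noteq> \<infinity>" using M.emeasure_finite by simp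
qed auto

section \<open>Shift and reflection preserve the law\<close>

definition shift :: "int \<Rightarrow> (int \<Rightarrow> real) \<Rightarrow> int \<Rightarrow> real" where
  "shift p x j = x (j + p)"

definition reflect :: "(int \<Rightarrow> real) \<Rightarrow> int \<Rightarrow> real" where
  "reflect x j = 2 * cov j * x 0 - x j"

lemma path_measurableI:
  assumes "\<And>j. (\<lambda>x. f x j) \<in> borel_measurable M"
  shows "f \<in> measurable M path_space"
  by (rule measurable_PiM_single'[of UNIV "\<lambda>n \<omega>. f \<omega> n", OF assms]) auto

lemma shift_measurable [measurable]: "shift p \<in> measurable path_space path_space"
  by (rule path_measurableI) (simp add: shift_def)

lemma reflect_measurable [measurable]: "reflect \<in> measurable path_space path_space"
  by (rule path_measurableI) (simp add: reflect_def)

lemma lin_shift: "lin ps (shift p x) = lin (map (\<lambda>q. (fst q, snd q + p)) ps) x"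
  by (induction ps) (auto simp: shift_def)

lemma cov_form_shift:
  "cov_form (map (\<lambda>q. (fst q, snd q + p)) ps) (map (\<lambda>q. (fst q, snd q + p)) qs) = cov_form ps qs"
  by (simp add: cov_form_def comp_def)

text \<open>\<open>F\<close> is the adjoint action of the linear map \<open>f\<close> on forms. If
  it preserves all variances, it preserves the characteristic function and thereby the law.\<close>

lemma distr_gauss_law_eqI:
  assumes f: "f \<in> measurable path_space path_space"
    and lin: "\<And>ps x. lin ps (f x) = lin (F ps) x" and form: "\<And>ps. cov_form (F ps) (F ps) = cov_form ps ps"
  shows "distr gauss_law path_space f = gauss_law"
proof (rule gauss_law_eqI)
  have f': "f \<in> measurable gauss_law path_space" using f by simp
  then show "prob_space (distr gauss_law path_space f)" by (rule gauss_law.prob_space_distr)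
  show "(\<integral>x. iexp (lin ps x) \<partial>distr gauss_law path_space f) = exp (- cov_form ps ps / 2)" for ps
    by (subst integral_distr[OF f']) (auto simp: lin integral_iexp_lin form)
qed simp

lemma distr_shift: "distr gauss_law path_space (shift p) = gauss_law"
  by (rule distr_gauss_law_eqI[OF shift_measurable lin_shift cov_form_shift])

text \<open>The component of each coordinate along coordinate \<open>0\<close> is kept, the orthogonal part changes
  its sign; this is an isometry of the Gaussian Hilbert space.\<close>

lemma distr_reflect: "distr gauss_law path_space reflect = gauss_law"
proof (rule distr_gauss_law_eqI)
  let ?A = "\<lambda>ps. map (\<lambda>q. (2 * fst q * cov (snd q), 0)) ps" and ?B = "\<lambda>ps. map (\<lambda>q. (- fst q, snd q)) ps"
  show "lin ps (reflect x) = lin (?A ps @ ?B ps) x" for ps x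
    by (induction ps) (auto simp: reflect_def algebra_simps)
  show "cov_form (?A ps @ ?B ps) (?A ps @ ?B ps) = cov_form ps ps" for ps
  proof -
    \<comment> \<open>\<open>s\<close> is the covariance of the form with \<open>x 0\<close>. The
      block \<open>?A\<close> contributes \<open>4 * s\<^sup>2\<close>, the two mixed blocks
      contribute \<open>-2 * s\<^sup>2\<close> each, and what remains is the original
      variance.\<close>
    define s where "s = (\<Sum>q\<leftarrow>ps. fst q * cov (snd q))"
    have AA: "cov_form (?A ps) (?A qs) = 4 * s * (\<Sum>q\<leftarrow>qs. fst q * cov (snd q))" for qs
      unfolding s_def cov_form_def
      by (simp add: comp_def cov_0 sum_list_const_mult[symmetric] sum_list_mult_const[symmetric] mult_ac)
    have AB: "cov_form (?A ps) (?B qs) = - 2 * s * (\<Sum>q\<leftarrow>qs. fst q * cov (snd q))" for qs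
      unfolding s_def cov_form_def
      by (simp add: comp_def cov_minus sum_list_const_mult[symmetric] sum_list_mult_const[symmetric] mult_ac uminus_sum_list_map)
    have BB: "cov_form (?B ps) (?B ps) = cov_form ps ps"
      by (simp add: cov_form_def comp_def)
    show ?thesis
      using AA[of ps] AB[of ps] BB cov_form_commute[of "?B ps" "?A ps"]
      by (simp add: cov_form_append s_def[symmetric])
  qed
qed (rule reflect_measurable)

lemma reflect_reflect: "reflect (reflect x) = x"
  by (rule ext) (simp add: reflect_def cov_0 algebra_simps)

lemma cov_tendsto_0_int:
  assumes "p \<noteq> 0"
  shows "(\<lambda>n. cov (m - p * int n)) \<longlonglongrightarrow> 0"
proof -
  have "filterlim (\<lambda>n. nat \<bar>m - p * int n\<bar>) at_top sequentially"
  proof (rule filterlim_at_top_mono)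
    show "filterlim (\<lambda>n. n - nat \<bar>m\<bar>) at_top sequentially"
      by (rule filterlim_minus_const_nat_at_top)
    have "n - nat \<bar>m\<bar> \<le> nat \<bar>m - p * int n\<bar>" for n
    proof -
      have "1 * int n \<le> \<bar>p\<bar> * int n" using assms by (intro mult_right_mono) auto
      then have "int n \<le> \<bar>p * int n\<bar>" by (simp add: abs_mult)
      then show ?thesis by linarith
    qed
    then show "\<forall>\<^sub>F n in sequentially. n - nat \<bar>m\<bar> \<le> nat \<bar>m - p * int n\<bar>" by simp
  qed
  then have "(\<lambda>n. cov (int (nat \<bar>m - p * int n\<bar>))) \<longlonglongrightarrow> 0"
    by (rule filterlim_compose[OF cov_tendsto_0])
  moreover have "cov (int (nat \<bar>k\<bar>)) = cov k" for k using cov_minus[of k] by (simp add: abs_if)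
  ultimately show ?thesis by simp
qed

lemma cov_form_shift_tendsto_0:
  assumes "p \<noteq> 0"
  shows "(\<lambda>n. cov_form ps (map (\<lambda>q. (fst q, snd q + p * int n)) qs)) \<longlonglongrightarrow> 0"
proof -
  have "(\<lambda>n. \<Sum>q\<leftarrow>qs. t * fst q * cov (a - (snd q + p * int n))) \<longlonglongrightarrow> 0" for t a
  proof (induction qs)
    case (Cons q qs)
    have "(\<lambda>n. t * fst q * cov (a - snd q - p * int n) + (\<Sum>q\<leftarrow>qs. t * fst q * cov (a - (snd q + p * int n)))) \<longlonglongrightarrow> t * fst q * 0 + 0"
      by (intro tendsto_add tendsto_mult_left cov_tendsto_0_int assms Cons)
    then show ?case by (simp add: diff_diff_eq)
  qed simp
  note * = this
  show ?thesis
  proof (induction ps)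
    case (Cons p' ps)
    have "(\<lambda>n. (\<Sum>q\<leftarrow>map (\<lambda>q. (fst q, snd q + p * int n)) qs. fst p' * fst q * cov (snd p' - snd q)) + cov_form ps (map (\<lambda>q. (fst q, snd q + p * int n)) qs)) \<longlonglongrightarrow> 0 + 0"
      using *[of "fst p'" "snd p'"] by (intro tendsto_add Cons) (simp add: comp_def)
    then show ?case by (simp add: cov_form_Cons)
  qed simp
qed

section \<open>Mixing\<close>

text \<open>A Dynkin argument. Invariance under \<open>g n\<close> gives the bound
  \<open>measure M X\<close> for every \<open>n\<close>, so limit and countable disjoint union can
  be exchanged by Tannery's theorem. Both \<open>g\<close> and \<open>C\<close> depend on
  \<open>n\<close>, so that the lemma extends either argument of a correlation.\<close>

lemma measure_limit_extend:
  assumes M: "prob_space M" and G: "Int_stable G" "G \<subseteq> Pow (space M)" "sets M = sigma_sets (space M) G" "space M \<in> G"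
    and g: "\<And>n. g n \<in> measurable M M" "\<And>n. distr M M (g n) = M" and C: "\<And>n. C n \<in> sets M"
    and lim: "\<And>X. X \<in> G \<Longrightarrow> (\<lambda>n. measure M (g n -` X \<inter> C n)) \<longlonglongrightarrow> c * measure M X"
    and A: "A \<in> sets M"
  shows "(\<lambda>n. measure M (g n -` A \<inter> C n)) \<longlonglongrightarrow> c * measure M A"
proof -
  interpret prob_space M by fact
  have gC: "g n -` X \<inter> C n \<in> sets M" if "X \<in> sets M" for n X
  proof -
    have "g n -` X \<inter> C n = (g n -` X \<inter> space M) \<inter> C n" using sets.sets_into_space[OF C[of n]] by auto
    then show ?thesis using measurable_sets[OF g(1) that, of n] C[of n] by simp
  qed
  have le: "measure M (g n -` X \<inter> C n) \<le> measure M X" if X: "X \<in> sets M" for n X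
  proof -
    have "measure M (g n -` X \<inter> C n) \<le> measure M (g n -` X \<inter> space M)"
      using measurable_sets[OF g(1) X, of n] sets.sets_into_space[OF C[of n]] by (intro finite_measure_mono) auto
    also have "\<dots> = measure (distr M M (g n)) X" using measure_distr[OF g(1) X, of n] by simp
    finally show ?thesis by (simp add: g(2))
  qed
  have gsp: "g n -` space M \<inter> C n = C n" for n
    using sets.sets_into_space[OF C[of n]] measurable_space[OF g(1), of _ n] by auto
  show ?thesis
    using G(1,2) A[unfolded G(3)]
  proof (induction rule: sigma_sets_induct_disjoint)
    case (compl X)
    then have X: "X \<in> sets M" by (simp add: G(3))
    have eq: "measure M (g n -` (space M - X) \<inter> C n) = measure M (g n -` space M \<inter> C n) - measure M (g n -` X \<inter> C n)" for n
    proof -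
      have "g n -` (space M - X) \<inter> C n = (g n -` space M \<inter> C n) - (g n -` X \<inter> C n)" by auto
      then show ?thesis using gC[OF X, of n] C[of n]
        by (simp only: gsp) (rule finite_measure_Diff, auto)
    qed
    have "(\<lambda>n. measure M (g n -` space M \<inter> C n) - measure M (g n -` X \<inter> C n)) \<longlonglongrightarrow>
        c * measure M (space M) - c * measure M X"
      by (intro tendsto_diff lim G(4) compl(2))
    then show ?case by (simp only: eq finite_measure_compl[OF X] right_diff_distrib)
  next
    case (union A)
    then have A: "A i \<in> sets M" for i by (auto simp: G(3))
    have sums: "(\<lambda>i. measure M (A i)) sums measure M (\<Union>i. A i)"
      using A union(1) by (intro finite_measure_UNION) auto
    have eq: "measure M (g n -` (\<Union>i. A i) \<inter> C n) = (\<Sum>i. measure M (g n -` A i \<inter> C n))" for n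
    proof -
      have "(\<lambda>i. measure M (g n -` A i \<inter> C n)) sums measure M (\<Union>i. g n -` A i \<inter> C n)"
        using gC[OF A] union(1) by (intro finite_measure_UNION) (auto simp: disjoint_family_on_def, blast)
      moreover have "(\<Union>i. g n -` A i \<inter> C n) = g n -` (\<Union>i. A i) \<inter> C n" by auto
      ultimately show ?thesis by (simp add: sums_unique)
    qed
    have "(\<lambda>n. \<Sum>i. measure M (g n -` A i \<inter> C n)) \<longlonglongrightarrow> (\<Sum>i. c * measure M (A i))"
    proof (rule tannerys_theorem[THEN conjunct2, THEN conjunct2])
      show "(\<lambda>n. measure M (g n -` A i \<inter> C n)) \<longlonglongrightarrow> c * measure M (A i)" for i by (rule union(3))
      show "\<forall>\<^sub>F (i, n) in at_top \<times>\<^sub>F sequentially. norm (measure M (g n -` A i \<inter> C n)) \<le> measure M (A i)"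
        using le[OF A] by (intro always_eventually) auto
      show "summable (\<lambda>i. measure M (A i))" using sums by (rule sums_summable)
    qed simp
    also have "(\<Sum>i. c * measure M (A i)) = c * measure M (\<Union>i. A i)"
      using sums by (simp add: suminf_mult sums_iff)
    finally show ?case by (simp add: eq)
  qed (auto intro: lim)
qed

lemma boxes_sets: "X \<in> boxes \<Longrightarrow> X \<in> sets gauss_law"
  by (simp only: sets_gauss_law sets_path_space) (rule sigma_sets.Basic)

text \<open>The joint law of \<open>x\<close> and its shift converges to the product law. For a pair
  of linear forms the variances stay fixed while the mixed covariance tends to \<open>0\<close>, so
  the characteristic functions converge, and \<open>box_convergence\<close> applies on the product
  space.\<close>

lemma gauss_mixing_boxes:
  assumes p: "p \<noteq> 0" and X: "X \<in> boxes" and Y: "Y \<in> boxes"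
  shows "(\<lambda>n. measure gauss_law (X \<inter> shift (p * int n) -` Y)) \<longlonglongrightarrow> measure gauss_law X * measure gauss_law Y"
proof -
  let ?P = "gauss_law \<Otimes>\<^sub>M gauss_law"
  interpret P: pair_prob_space gauss_law gauss_law ..
  obtain J a where J: "finite J" "X = {x. \<forall>j\<in>J. x j \<le> a j}" using X by (auto simp: boxes_def)
  obtain K b where K: "finite K" "Y = {x. \<forall>j\<in>K. x j \<le> b j}" using Y by (auto simp: boxes_def)
  have times: "measure ?P (U \<times> V) = measure gauss_law U * measure gauss_law V"
    if "U \<in> sets gauss_law" "V \<in> sets gauss_law" for U V
    unfolding measure_def using gauss_law.emeasure_pair_measure_Times[OF that] by (simp only: enn2real_mult)
  define pr where "pr n x = (x, shift (p * int n) x)" for n and x :: "int \<Rightarrow> real"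
  have sh: "shift m \<in> measurable gauss_law gauss_law" for m
    using shift_measurable[of m] measurable_cong_sets[OF sets_gauss_law sets_gauss_law] by blast
  have pr: "pr n \<in> measurable gauss_law ?P" for n
    unfolding pr_def by (intro measurable_Pair measurable_ident_sets[OF refl] sh)
  define Mn where "Mn n = distr gauss_law ?P (pr n)" for n
  define h where "h ps qs z = lin ps (fst z) + lin qs (snd z)" for ps qs z
  define f :: "int + int \<Rightarrow> (int \<Rightarrow> real) \<times> (int \<Rightarrow> real) \<Rightarrow> real"
    where "f = case_sum (\<lambda>j z. fst z j) (\<lambda>j z. snd z j)"
  have linm: "lin ps \<in> borel_measurable gauss_law" for ps
    using lin_measurable by (simp only: measurable_cong_sets[OF sets_gauss_law refl])
  have h_meas: "h ps qs \<in> borel_measurable ?P" for ps qs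
    unfolding h_def by (intro borel_measurable_add measurable_compose[OF measurable_fst linm] measurable_compose[OF measurable_snd linm])
  have "(\<lambda>n. measure (Mn n) {z \<in> space ?P. \<forall>s\<in>J <+> K. f s z \<le> case_sum a b s}) \<longlonglongrightarrow>
      measure ?P {z \<in> space ?P. \<forall>s\<in>J <+> K. f s z \<le> case_sum a b s}"
  proof (rule box_convergence[where V = "range (case_prod h)"])
    show "prob_space (Mn n)" for n unfolding Mn_def by (rule gauss_law.prob_space_distr[OF pr])
    show "prob_space ?P" by (rule P.prob_space_axioms)
    show "g \<in> borel_measurable ?P" if "g \<in> range (case_prod h)" for g using that h_meas by auto
    show "(\<lambda>z. g z + s * k z) \<in> range (case_prod h)" if gk: "g \<in> range (case_prod h)" "k \<in> range (case_prod h)" for g k s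
    proof -
      obtain ps qs ps' qs' where "g = h ps qs" "k = h ps' qs'" using gk by auto
      then have "(\<lambda>z. g z + s * k z) = case_prod h (ps @ map (\<lambda>q. (s * fst q, snd q)) ps', qs @ map (\<lambda>q. (s * fst q, snd q)) qs')"
        by (auto simp: h_def lin_scale algebra_simps)
      then show ?thesis by blast
    qed
    show "(\<lambda>_. 0) \<in> range (case_prod h)" by (rule range_eqI[of _ _ "([], [])"]) (auto simp: h_def)
    show "finite (J <+> K)" using J K by simp
    have "f (Inl j) = case_prod h ([(1, j)], [])" "f (Inr j) = case_prod h ([], [(1, j)])" for j
      by (auto simp: f_def h_def)
    then show "f s \<in> range (case_prod h)" for s by (cases s) auto
    show "measure ?P {z \<in> space ?P. f s z = case_sum a b s} = 0" for s
    proof (cases s)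
      case (Inl j)
      have "{z \<in> space ?P. f s z = case_sum a b s} = {x. x j = a j} \<times> UNIV"
        by (auto simp: Inl f_def space_pair_measure)
      moreover have "{x. x j = a j} \<in> sets gauss_law"
        using measurable_sets[OF measurable_gauss_law_component, of "{a j}" j] by (simp add: vimage_def)
      ultimately show ?thesis
        using measure_gauss_law_atom[of j "a j"] sets.top[of gauss_law] by (simp add: times)
    next
      case (Inr j)
      have "{z \<in> space ?P. f s z = case_sum a b s} = UNIV \<times> {x. x j = b j}"
        by (auto simp: Inr f_def space_pair_measure)
      moreover have "{x. x j = b j} \<in> sets gauss_law"
        using measurable_sets[OF measurable_gauss_law_component, of "{b j}" j] by (simp add: vimage_def)
      ultimately show ?thesis
        using measure_gauss_law_atom[of j "b j"] sets.top[of gauss_law] by (simp add: times)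
    qed
    show "(\<lambda>n. \<integral>z. iexp (g z) \<partial>Mn n) \<longlonglongrightarrow> (\<integral>z. iexp (g z) \<partial>?P)" if g: "g \<in> range (case_prod h)" for g
    proof -
      obtain ps qs where g: "g = h ps qs" using g by auto
      define sq where "sq n = map (\<lambda>q. (fst q, snd q + p * int n)) qs" for n
      have 1: "(\<integral>z. iexp (g z) \<partial>Mn n) = exp (- (cov_form ps ps + 2 * cov_form ps (sq n) + cov_form qs qs) / 2)" for n
      proof -
        have "(\<integral>z. iexp (g z) \<partial>Mn n) = (\<integral>x. iexp (lin (ps @ sq n) x) \<partial>gauss_law)"
          unfolding Mn_def g using h_meas[of ps qs]
          by (subst integral_distr[OF pr]) (auto simp: pr_def h_def lin_shift sq_def)
        also have "\<dots> = exp (- (cov_form ps ps + 2 * cov_form ps (sq n) + cov_form qs qs) / 2)"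
          unfolding integral_iexp_lin using cov_form_commute[of "sq n" ps]
          by (simp add: cov_form_append sq_def cov_form_shift)
        finally show ?thesis .
      qed
      have "(\<integral>z. iexp (g z) \<partial>?P) = (\<integral>z. iexp (lin ps (fst z)) * iexp (lin qs (snd z)) \<partial>?P)"
        by (simp only: g h_def iexp_add)
      also have "\<dots> = (\<integral>x. \<integral>y. iexp (lin ps x) * iexp (lin qs y) \<partial>gauss_law \<partial>gauss_law)"
      proof -
        have "(\<lambda>z. iexp (h ps qs z)) \<in> borel_measurable ?P" using h_meas[of ps qs] by measurable
        then have "(\<lambda>z. iexp (lin ps (fst z)) * iexp (lin qs (snd z))) \<in> borel_measurable ?P"
          by (simp only: h_def iexp_add)
        then have "integrable ?P (\<lambda>z. iexp (lin ps (fst z)) * iexp (lin qs (snd z)))"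
          by (intro P.integrable_const_bound[of _ 1]) (auto simp: norm_mult)
        then show ?thesis
          using P.integral_fst'[of "\<lambda>z. iexp (lin ps (fst z)) * iexp (lin qs (snd z))"] by simp
      qed
      \<comment> \<open>The summand \<open>2 * 0\<close> stands for the vanished mixed covariance
        and gives the limit the shape of the terms of the sequence.\<close>
      also have "\<dots> = exp (- (cov_form ps ps + 2 * 0 + cov_form qs qs) / 2)"
      proof -
        have "exp (- cov_form ps ps / 2) * exp (- cov_form qs qs / 2) = exp (- (cov_form ps ps + 2 * 0 + cov_form qs qs) / 2)"
          unfolding exp_add[symmetric] by (simp add: field_simps)
        then show ?thesis
          by (simp only: integral_mult_right_zero integral_mult_left_zero integral_iexp_lin of_real_mult[symmetric])
      qed
      finally have 2: "(\<integral>z. iexp (g z) \<partial>?P) = exp (- (cov_form ps ps + 2 * 0 + cov_form qs qs) / 2)" .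
      have "(\<lambda>n. complex_of_real (exp (- (cov_form ps ps + 2 * cov_form ps (sq n) + cov_form qs qs) / 2))) \<longlonglongrightarrow>
         complex_of_real (exp (- (cov_form ps ps + 2 * 0 + cov_form qs qs) / 2))"
        unfolding sq_def by (intro tendsto_intros cov_form_shift_tendsto_0 p) auto
      then show ?thesis unfolding 1 2 .
    qed
  qed (auto simp: Mn_def)
  moreover have "{z \<in> space ?P. \<forall>s\<in>J <+> K. f s z \<le> case_sum a b s} = X \<times> Y"
  proof -
    have "(\<forall>s\<in>J <+> K. Q s) \<longleftrightarrow> (\<forall>j\<in>J. Q (Inl j)) \<and> (\<forall>j\<in>K. Q (Inr j))" for Q
      by blast
    then show ?thesis unfolding J K by (auto simp: f_def space_pair_measure)
  qed
  moreover have "measure (Mn n) (X \<times> Y) = measure gauss_law (X \<inter> shift (p * int n) -` Y)" for n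
    unfolding Mn_def using boxes_sets[OF X] boxes_sets[OF Y]
    by (subst measure_distr[OF pr]) (auto intro!: arg_cong[where f = "measure gauss_law"] simp: pr_def)
  moreover have "measure ?P (X \<times> Y) = measure gauss_law X * measure gauss_law Y"
    using boxes_sets[OF X] boxes_sets[OF Y] by (rule times)
  ultimately show ?thesis by simp
qed

text \<open>Two extensions: \<open>A\<close> becomes arbitrary while the other set is a box, with
  the identity as invariant map; then \<open>B\<close> becomes arbitrary for fixed \<open>A\<close>,
  with the shift as invariant map.\<close>

lemma gauss_mixing:
  assumes p: "p \<noteq> 0" and A: "A \<in> sets path_space" and B: "B \<in> sets path_space"
  shows "(\<lambda>n. measure gauss_law (A \<inter> shift (p * int n) -` B)) \<longlonglongrightarrow> measure gauss_law A * measure gauss_law B"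
proof -
  note prems = gauss_law.prob_space_axioms Int_stable_boxes
  have S: "sets gauss_law = sigma_sets (space gauss_law) boxes"
    by (simp only: sets_gauss_law sets_path_space space_gauss_law)
  have sh: "shift m \<in> measurable gauss_law gauss_law" for m
    using shift_measurable[of m] measurable_cong_sets[OF sets_gauss_law sets_gauss_law] by blast
  have shd: "distr gauss_law gauss_law (shift m) = gauss_law" for m
    using distr_shift[of m] by (simp cong: distr_cong)
  have vim: "shift m -` Y \<in> sets gauss_law" if "Y \<in> sets gauss_law" for m Y
    using measurable_sets[OF sh that, of m] by simp
  have 1: "(\<lambda>n. measure gauss_law (A \<inter> shift (p * int n) -` Y)) \<longlonglongrightarrow> measure gauss_law Y * measure gauss_law A"
    if Y: "Y \<in> boxes" for Y
  proof -
    have "(\<lambda>n. measure gauss_law ((\<lambda>x. x) -` A \<inter> shift (p * int n) -` Y)) \<longlonglongrightarrow> measure gauss_law Y * measure gauss_law A"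
    proof (rule measure_limit_extend[OF prems _ S])
      show "(\<lambda>n. measure gauss_law ((\<lambda>x. x) -` X \<inter> shift (p * int n) -` Y)) \<longlonglongrightarrow> measure gauss_law Y * measure gauss_law X"
        if "X \<in> boxes" for X
        using gauss_mixing_boxes[OF p that Y] by (simp add: mult.commute)
      show "shift (p * int n) -` Y \<in> sets gauss_law" for n by (rule vim[OF boxes_sets[OF Y]])
    qed (use A UNIV_in_boxes in \<open>auto simp: distr_id\<close>)
    then show ?thesis by simp
  qed
  have "(\<lambda>n. measure gauss_law (shift (p * int n) -` B \<inter> A)) \<longlonglongrightarrow> measure gauss_law A * measure gauss_law B"
  proof (rule measure_limit_extend[OF prems _ S])
    show "(\<lambda>n. measure gauss_law (shift (p * int n) -` Y \<inter> A)) \<longlonglongrightarrow> measure gauss_law A * measure gauss_law Y"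
      if "Y \<in> boxes" for Y using 1[OF that] by (simp add: Int_commute mult.commute)
  qed (use A B UNIV_in_boxes sh shd in auto)
  then show ?thesis by (simp add: Int_commute)
qed

section \<open>Few tubes carry the process\<close>

lemma compact_disjoint_dist:
  fixes S T :: "'a::metric_space set"
  assumes "compact S" "compact T" "S \<inter> T = {}"
  shows "\<exists>d>0. \<forall>x\<in>S. \<forall>y\<in>T. d \<le> dist x y"
proof (cases "S \<times> T = {}")
  case True
  then show ?thesis by (intro exI[of _ 1]) auto
next
  case False
  have "\<exists>p\<in>S \<times> T. \<forall>q\<in>S \<times> T. dist (fst p) (snd p) \<le> dist (fst q) (snd q)"
    using assms False by (intro continuous_attains_inf compact_Times continuous_intros) auto
  then obtain p where p: "p \<in> S \<times> T" "\<And>q. q \<in> S \<times> T \<Longrightarrow> dist (fst p) (snd p) \<le> dist (fst q) (snd q)" by blast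
  have "0 < dist (fst p) (snd p)" using p(1) assms(3) by auto
  then show ?thesis using p(2) by (intro exI[of _ "dist (fst p) (snd p)"]) force
qed

text \<open>Each cell contains a compact core that exhausts it up to a small measure, by inner
  regularity. Finitely many disjoint compact sets have positive distance, and the metric of the
  product depends on finitely many coordinates up to a small error. On the union \<open>E\<close> of
  the cores those coordinates therefore decide the cell.\<close>

lemma partition_separation:
  assumes Q: "finite Q" "Q \<subseteq> sets path_space" "disjoint Q" "\<Union>Q = UNIV" and \<gamma>: "0 < \<gamma>"
  shows "\<exists>E\<in>sets path_space. \<exists>\<eta>>0. \<exists>N. measure gauss_law (UNIV - E) \<le> \<gamma> \<and>
    (\<forall>x\<in>E. \<forall>y\<in>E. (\<forall>j. \<bar>j\<bar> \<le> N \<longrightarrow> \<bar>x j - y j\<bar> \<le> \<eta>) \<longrightarrow> (\<forall>B\<in>Q. x \<in> B \<longrightarrow> y \<in> B))"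
proof -
  have sb: "sets gauss_law = sets borel" by (simp add: sets_PiM_equal_borel)
  have Qne: "Q \<noteq> {}" using Q(4) by auto
  define \<delta> where "\<delta> = \<gamma> / card Q"
  have \<delta>: "0 < \<delta>" using \<gamma> Q Qne by (simp add: \<delta>_def card_gt_0_iff)
  have "\<exists>K\<subseteq>B. compact K \<and> measure gauss_law (B - K) \<le> \<delta>" if B: "B \<in> Q" for B
  proof (cases "measure gauss_law B \<le> \<delta>")
    case True
    then show ?thesis by (intro exI[of _ "{}"]) auto
  next
    case False
    have Bs: "B \<in> sets gauss_law" using B Q by auto
    have "ennreal (measure gauss_law B - \<delta>) < ennreal (measure gauss_law B)"
      using False \<delta> by (intro ennreal_lessI) auto
    also have "\<dots> = emeasure gauss_law B" by (simp add: gauss_law.emeasure_eq_measure)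
    also have "\<dots> = (SUP K\<in>{K. K \<subseteq> B \<and> compact K}. emeasure gauss_law K)"
      using Bs by (intro inner_regular[OF sb]) (auto simp: sb simp del: sets_gauss_law)
    finally obtain K where K: "K \<subseteq> B" "compact K" "ennreal (measure gauss_law B - \<delta>) < emeasure gauss_law K"
      unfolding less_SUP_iff by auto
    have Ks: "K \<in> sets gauss_law" unfolding sb using K(2) by (simp add: borel_compact)
    have "measure gauss_law B - \<delta> < measure gauss_law K"
      using K(3) False by (simp add: gauss_law.emeasure_eq_measure ennreal_less_iff)
    then have "measure gauss_law (B - K) \<le> \<delta>"
      using gauss_law.finite_measure_Diff[OF Bs Ks K(1)] by simp
    then show ?thesis using K by blast
  qed
  then obtain K where K: "\<And>B. B \<in> Q \<Longrightarrow> K B \<subseteq> B" "\<And>B. B \<in> Q \<Longrightarrow> compact (K B)"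
      "\<And>B. B \<in> Q \<Longrightarrow> measure gauss_law (B - K B) \<le> \<delta>"
    by metis
  have Ks: "K B \<in> sets gauss_law" if "B \<in> Q" for B unfolding sb using K(2)[OF that] by (simp add: borel_compact)
  have diff: "B - K B \<in> sets path_space" if "B \<in> Q" for B using Q(2) Ks[OF that] that by auto
  define E where "E = (\<Union>B\<in>Q. K B)"
  have Es: "E \<in> sets path_space" unfolding E_def using Q Ks by auto
  have "measure gauss_law (UNIV - E) \<le> measure gauss_law (\<Union>B\<in>Q. B - K B)"
  proof (intro gauss_law.finite_measure_mono subsetI)
    fix x assume "x \<in> UNIV - E"
    moreover obtain B where "B \<in> Q" "x \<in> B" using Q(4) by blast
    ultimately show "x \<in> (\<Union>B\<in>Q. B - K B)" by (auto simp: E_def)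
  qed (use Q(1) diff in \<open>auto intro!: sets.finite_UN\<close>)
  also have "\<dots> \<le> (\<Sum>B\<in>Q. measure gauss_law (B - K B))"
    using Q(1) diff by (intro gauss_law.finite_measure_subadditive_finite) auto
  also have "\<dots> \<le> (\<Sum>B\<in>Q. \<delta>)" using K by (intro sum_mono)
  also have "\<dots> = \<gamma>" using Q Qne by (simp add: \<delta>_def)
  finally have E\<gamma>: "measure gauss_law (UNIV - E) \<le> \<gamma>" .
  have "\<exists>d>0. \<forall>x\<in>K B. \<forall>y\<in>K B'. d \<le> dist x y" if B: "B \<in> Q" "B' \<in> Q" "B \<noteq> B'" for B B'
  proof -
    have "B \<inter> B' = {}" using B Q(3) by (simp add: disjoint_def)
    then have "K B \<inter> K B' = {}" using K(1)[OF B(1)] K(1)[OF B(2)] by blast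
    then show ?thesis using K(2) B by (intro compact_disjoint_dist) auto
  qed
  then obtain d where d: "\<And>B B'. B \<in> Q \<Longrightarrow> B' \<in> Q \<Longrightarrow> B \<noteq> B' \<Longrightarrow> 0 < d B B'"
      "\<And>B B' x y. B \<in> Q \<Longrightarrow> B' \<in> Q \<Longrightarrow> B \<noteq> B' \<Longrightarrow> x \<in> K B \<Longrightarrow> y \<in> K B' \<Longrightarrow> d B B' \<le> dist x y"
    by metis
  \<comment> \<open>The inserted \<open>1\<close> keeps the minimum meaningful and positive when
    \<open>Q\<close> has a single cell.\<close>
  define D where "D = insert 1 ((\<lambda>p. d (fst p) (snd p)) ` {p \<in> Q \<times> Q. fst p \<noteq> snd p})"
  have finD: "finite D" unfolding D_def using Q(1) by simp
  define e where "e = Min D"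
  have "0 < r" if "r \<in> D" for r
    using that unfolding D_def by (elim insertE imageE) (auto intro!: d(1))
  then have e: "0 < e" unfolding e_def using Min_in[OF finD] by (simp add: D_def)
  have e_le: "e \<le> dist x y" if "B \<in> Q" "B' \<in> Q" "B \<noteq> B'" "x \<in> K B" "y \<in> K B'" for B B' x y
  proof -
    have "d B B' \<in> D" unfolding D_def using that(1-3) by (intro insertI2 image_eqI[of _ _ "(B, B')"]) auto
    then have "e \<le> d B B'" unfolding e_def using finD by (intro Min_le)
    then show ?thesis using d(2)[OF that] by linarith
  qed
  \<comment> \<open>If the first \<open>M + 1\<close> enumerated coordinates agree up to
    \<open>e / 5\<close>, the distance is below \<open>2 * (e / 5) + e / 2 < e\<close>.\<close>
  obtain M where M: "(1 / 2) ^ M < e / 2" using real_arch_pow_inv[of "e / 2" "1 / 2"] e by auto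
  define N where "N = Max ((\<lambda>n. \<bar>from_nat n :: int\<bar>) ` {..M})"
  have same: "y \<in> B" if xy: "x \<in> E" "y \<in> E" "\<And>j. \<bar>j\<bar> \<le> N \<Longrightarrow> \<bar>x j - y j\<bar> \<le> e / 5" and B: "B \<in> Q" "x \<in> B" for x y B
  proof -
    obtain B1 B2 where B12: "B1 \<in> Q" "x \<in> K B1" "B2 \<in> Q" "y \<in> K B2" using xy by (auto simp: E_def)
    have "B = B1" using B12 B K(1)[OF B12(1)] Q(3) by (auto simp: disjoint_def)
    moreover have "B1 = B2"
    proof (rule ccontr)
      assume "B1 \<noteq> B2"
      then have "e \<le> dist x y" using e_le B12 by blast
      also have "\<dots> \<le> 2 * Max {dist (x (from_nat n)) (y (from_nat n)) |n. n \<le> M} + (1 / 2) ^ M"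
        by (rule dist_fun_le_dist_first_terms)
      also have "Max {dist (x (from_nat n)) (y (from_nat n)) |n. n \<le> M} \<le> e / 5"
      proof (rule Max.boundedI)
        fix r assume "r \<in> {dist (x (from_nat n)) (y (from_nat n)) |n. n \<le> M}"
        then obtain n where n: "n \<le> M" "r = dist (x (from_nat n)) (y (from_nat n))" by auto
        have "\<bar>from_nat n :: int\<bar> \<le> N" unfolding N_def using n by (intro Max_ge) auto
        then show "r \<le> e / 5" using xy(3) n by (simp add: dist_real_def)
      qed auto
      finally show False using M e by simp
    qed
    ultimately show ?thesis using K(1) B12 by auto
  qed
  show ?thesis
  proof (intro bexI[OF _ Es] exI[of _ "e / 5"] exI[of _ N] conjI ballI impI)
    show "0 < e / 5" using e by simp
    show "measure gauss_law (UNIV - E) \<le> \<gamma>" by (rule E\<gamma>)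
    fix x y B assume "x \<in> E" "y \<in> E" "\<forall>j. \<bar>j\<bar> \<le> N \<longrightarrow> \<bar>x j - y j\<bar> \<le> e / 5" "B \<in> Q" "x \<in> B"
    then show "y \<in> B" using same by blast
  qed
qed

section \<open>Quantization of the noise and counting of tubes\<close>

lemma noise_markov:
  assumes f: "f \<in> borel_measurable noise" and a: "0 < a" and b: "(\<integral>\<^sup>+\<omega>. ennreal (f \<omega>) \<partial>noise) \<le> ennreal b" "0 \<le> b"
  shows "measure noise {\<omega>. a < f \<omega>} \<le> b / a"
proof -
  have S: "{\<omega>. a < f \<omega>} \<in> sets noise"
  proof -
    have "{\<omega> \<in> space noise. a < f \<omega>} \<in> sets noise" using f by measurable
    then show ?thesis by simp
  qed
  have "ennreal a * emeasure noise {\<omega>. a < f \<omega>} = (\<integral>\<^sup>+\<omega>. ennreal a * indicator {\<omega>. a < f \<omega>} \<omega> \<partial>noise)"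
    using S by (simp add: nn_integral_cmult_indicator)
  also have "\<dots> \<le> (\<integral>\<^sup>+\<omega>. ennreal (f \<omega>) \<partial>noise)"
    by (intro nn_integral_mono) (auto simp: indicator_def intro!: ennreal_leI)
  also note b(1)
  finally have "ennreal (a * measure noise {\<omega>. a < f \<omega>}) \<le> ennreal b"
    using a by (simp add: noise.emeasure_eq_measure ennreal_mult)
  then have "a * measure noise {\<omega>. a < f \<omega>} \<le> b" using b(2) by simp
  then show ?thesis using a by (simp add: field_simps)
qed

text \<open>Integers that stand for multiples of the mesh \<open>1 / 4 ^ K\<close> with values up to
  \<open>4 ^ K\<close>. Rounding \<open>2 ^ K\<close> variables then costs at most
  \<open>2 ^ K / 4 ^ K\<close>, and the chance that one of them exceeds the cutoff is at most the
  same number.\<close>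

definition grid :: "nat \<Rightarrow> (nat set \<Rightarrow> int) set" where
  "grid K = Pow {..<K} \<rightarrow>\<^sub>E {- (16 ^ K)..16 ^ K}"

definition grid_path :: "nat \<Rightarrow> (nat set \<Rightarrow> int) \<Rightarrow> int \<Rightarrow> real" where
  "grid_path K k = approx_path K (\<lambda>F. of_int (k F) / 4 ^ K)"

definition tube :: "int \<Rightarrow> real \<Rightarrow> (int \<Rightarrow> real) \<Rightarrow> (int \<Rightarrow> real) set" where
  "tube m e u = {x. \<forall>j\<in>{- m..m}. \<bar>x j - u j\<bar> \<le> e}"

lemma tube_sets: "tube m e u \<in> sets path_space"
proof -
  have "{x \<in> space path_space. \<forall>j\<in>{- m..m}. \<bar>x j - u j\<bar> \<le> e} \<in> sets path_space"
    by measurable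
  then show ?thesis by (simp add: tube_def space_PiM)
qed

lemma finite_grid: "finite (grid K)"
  unfolding grid_def by (intro finite_PiE) auto

text \<open>The exponent is of order \<open>K * 2 ^ K\<close>, which is small against the window
  length \<open>4 ^ K\<close>. The constant \<open>3\<close> comes from
  \<open>16 \<le> exp 3\<close>.\<close>

lemma card_grid_le: "real (card (grid K)) \<le> exp (2 ^ K * (2 + 3 * real K))"
proof -
  have "card (grid K) = (2 * 16 ^ K + 1) ^ 2 ^ K"
    unfolding grid_def by (subst card_PiE) (auto simp: card_Pow nat_add_distrib nat_mult_distrib nat_power_eq)
  then have "real (card (grid K)) = (2 * 16 ^ K + 1) ^ 2 ^ K" by (simp add: add.commute)
  also have "\<dots> \<le> (exp (2 + 3 * real K)) ^ 2 ^ K"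
  proof (rule power_mono)
    have "2 * 16 ^ K + 1 \<le> 3 * (16 :: real) ^ K" by simp
    also have "\<dots> \<le> exp 2 * exp 3 ^ K"
    proof (intro mult_mono power_mono)
      show "3 \<le> exp (2::real)" using exp_ge_add_one_self[of 2] by simp
      have "(2.7::real) \<le> exp 1" using e_approx_32 by (simp add: abs_if split: if_splits)
      then have "2.7 ^ 3 \<le> exp (1::real) ^ 3" by (intro power_mono) auto
      also have "exp (1::real) ^ 3 = exp 3" by (simp add: exp_of_nat_mult[symmetric])
      finally show "16 \<le> exp (3::real)" by (simp add: power3_eq_cube)
    qed auto
    also have "\<dots> = exp (2 + 3 * real K)" by (simp add: exp_add exp_of_nat_mult[symmetric] mult.commute)
    finally show "2 * 16 ^ K + 1 \<le> exp (2 + 3 * real K)" .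
  qed simp
  also have "\<dots> = exp (2 ^ K * (2 + 3 * real K))" by (simp add: exp_of_nat_mult[symmetric])
  finally show ?thesis .
qed

text \<open>Since \<open>coef\<close> is bounded by \<open>1\<close> at every time, a single
  rounding of the noise serves the whole time axis.\<close>

lemma approx_path_near_grid:
  assumes "\<And>F. F \<in> Pow {..<K} \<Longrightarrow> \<bar>\<omega> F\<bar> \<le> 4 ^ K"
  shows "\<exists>k\<in>grid K. \<forall>j. \<bar>approx_path K \<omega> j - grid_path K k j\<bar> \<le> 1 / 2 ^ K"
proof
  let ?k = "\<lambda>F\<in>Pow {..<K}. \<lfloor>\<omega> F * 4 ^ K\<rfloor>"
  have p: "(4::real) ^ K * 4 ^ K = 16 ^ K" by (simp add: power_mult_distrib[symmetric])
  show "?k \<in> grid K"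
    unfolding grid_def
  proof (rule restrict_PiE_iff[THEN iffD2], rule ballI)
    fix F assume F: "F \<in> Pow {..<K}"
    have "\<bar>\<omega> F * 4 ^ K\<bar> \<le> 4 ^ K * 4 ^ K" unfolding abs_mult using assms[OF F] by (intro mult_mono) auto
    then have b: "- (16 ^ K) \<le> \<omega> F * 4 ^ K" "\<omega> F * 4 ^ K \<le> 16 ^ K" unfolding p by auto
    have "of_int (- (16 ^ K)) \<le> \<omega> F * 4 ^ K" "\<omega> F * 4 ^ K \<le> of_int (16 ^ K)" using b by simp_all
    then show "\<lfloor>\<omega> F * 4 ^ K\<rfloor> \<in> {- (16 ^ K)..16 ^ K}"
      using floor_mono[of "\<omega> F * 4 ^ K" "of_int (16 ^ K)"] by (auto simp only: le_floor_iff floor_of_int atLeastAtMost_iff)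
  qed
  show "\<forall>j. \<bar>approx_path K \<omega> j - grid_path K ?k j\<bar> \<le> 1 / 2 ^ K"
  proof
    fix j
    have "\<bar>approx_path K \<omega> j - grid_path K ?k j\<bar> = \<bar>\<Sum>F\<in>Pow {..<K}. coef K j F * (\<omega> F - of_int \<lfloor>\<omega> F * 4 ^ K\<rfloor> / 4 ^ K)\<bar>"
      unfolding grid_path_def approx_path_def by (simp add: sum_subtractf[symmetric] right_diff_distrib)
    also have "\<dots> \<le> (\<Sum>F\<in>Pow {..<K}. \<bar>coef K j F * (\<omega> F - of_int \<lfloor>\<omega> F * 4 ^ K\<rfloor> / 4 ^ K)\<bar>)" by (rule sum_abs)
    also have "\<dots> \<le> (\<Sum>F\<in>Pow {..<K}. 1 * (1 / 4 ^ K))"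
    proof (intro sum_mono)
      fix F
      have "\<omega> F - of_int \<lfloor>\<omega> F * 4 ^ K\<rfloor> / 4 ^ K = (\<omega> F * 4 ^ K - of_int \<lfloor>\<omega> F * 4 ^ K\<rfloor>) / 4 ^ K" by (simp add: field_simps)
      moreover have "\<bar>\<omega> F * 4 ^ K - of_int \<lfloor>\<omega> F * 4 ^ K\<rfloor>\<bar> \<le> 1"
        using of_int_floor_le[of "\<omega> F * 4 ^ K"] real_of_int_floor_add_one_ge[of "\<omega> F * 4 ^ K"] by linarith
      ultimately have "\<bar>\<omega> F - of_int \<lfloor>\<omega> F * 4 ^ K\<rfloor> / 4 ^ K\<bar> \<le> 1 / 4 ^ K" by (simp add: divide_right_mono)
      then show "\<bar>coef K j F * (\<omega> F - of_int \<lfloor>\<omega> F * 4 ^ K\<rfloor> / 4 ^ K)\<bar> \<le> 1 * (1 / 4 ^ K)"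
        unfolding abs_mult by (intro mult_mono abs_coef_le_1) auto
    qed
    also have "\<dots> = 2 ^ K / (2 ^ K * 2 ^ K)" by (simp add: card_Pow power_mult_distrib[symmetric])
    also have "\<dots> = 1 / 2 ^ K" by simp
    finally show "\<bar>approx_path K \<omega> j - grid_path K ?k j\<bar> \<le> 1 / 2 ^ K" .
  qed
qed

text \<open>A path avoids all tubes only if a noise variable exceeds \<open>4 ^ K\<close> (event
  \<open>B1\<close>) or if level \<open>K\<close> misses the path by more than \<open>e\<close> at
  some time of the window (event \<open>B2\<close>). Markov's inequality bounds the first union by
  \<open>2 ^ K / 4 ^ K\<close> and the second by a multiple of \<open>m\<^sup>2 / 32 ^ K\<close>,
  where \<open>m\<^sup>2\<close> is of order \<open>16 ^ K\<close>.\<close>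

lemma measure_tubes_ge:
  assumes e: "0 < e" and K: "1 / 2 ^ K \<le> e" and m: "1 \<le> m" "real_of_int m \<le> c * 4 ^ K"
  shows "measure gauss_law (UNIV - (\<Union>k\<in>grid K. tube m (2 * e) (grid_path K k))) \<le> (1 + 48 * c\<^sup>2 / e) / 2 ^ K"
proof -
  let ?U = "\<Union>k\<in>grid K. tube m (2 * e) (grid_path K k)"
  define B1 :: "nat set \<Rightarrow> (nat set \<Rightarrow> real) set" where "B1 F = {\<omega>. 4 ^ K < \<bar>\<omega> F\<bar>}" for F
  define B2 where "B2 j = {\<omega>. e < \<bar>gauss_path \<omega> j - approx_path K \<omega> j\<bar>}" for j
  have Us: "UNIV - ?U \<in> sets path_space"
    using finite_grid tube_sets sets.top[of path_space] by (intro sets.Diff sets.finite_UN) (auto simp: space_PiM)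
  have m1: "(\<lambda>\<omega>. \<bar>\<omega> F\<bar>) \<in> borel_measurable noise" for F :: "nat set"
    by (intro borel_measurable_abs measurable_noise_component)
  have m2: "(\<lambda>\<omega>. \<bar>gauss_path \<omega> j - approx_path K \<omega> j\<bar>) \<in> borel_measurable noise" for j
    by (intro borel_measurable_abs borel_measurable_diff gauss_path_component_measurable approx_path_measurable)
  have B1s: "B1 F \<in> sets noise" for F
    using borel_measurable_less[OF measurable_const[of "4 ^ K"] m1[of F]] by (simp add: B1_def pred_def)
  have B2s: "B2 j \<in> sets noise" for j
    using borel_measurable_less[OF measurable_const[of e] m2[of j]] by (simp add: B2_def pred_def)
  have "gauss_path \<omega> \<in> ?U" if "\<omega> \<notin> (\<Union>F\<in>Pow {..<K}. B1 F)" "\<omega> \<notin> (\<Union>j\<in>{- m..m}. B2 j)" for \<omega>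
  proof -
    have "\<bar>\<omega> F\<bar> \<le> 4 ^ K" if "F \<in> Pow {..<K}" for F
    proof -
      have "\<omega> \<notin> B1 F" using that \<open>\<omega> \<notin> (\<Union>F\<in>Pow {..<K}. B1 F)\<close> by blast
      then show ?thesis by (simp add: B1_def not_less)
    qed
    then obtain k where k: "k \<in> grid K" "\<And>j. \<bar>approx_path K \<omega> j - grid_path K k j\<bar> \<le> 1 / 2 ^ K"
      using approx_path_near_grid by meson
    have "\<bar>gauss_path \<omega> j - grid_path K k j\<bar> \<le> 2 * e" if "j \<in> {- m..m}" for j
    proof -
      have "\<bar>gauss_path \<omega> j - approx_path K \<omega> j\<bar> \<le> e" 
      proof -
        have "\<omega> \<notin> B2 j" using that \<open>\<omega> \<notin> (\<Union>j\<in>{- m..m}. B2 j)\<close> by blast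
        then show ?thesis by (simp add: B2_def not_less)
      qed
      then show ?thesis using k(2)[of j] K by linarith
    qed
    then have "gauss_path \<omega> \<in> tube m (2 * e) (grid_path K k)" by (simp add: tube_def)
    then show ?thesis using k by blast
  qed
  then have sub: "gauss_path -` (UNIV - ?U) \<inter> space noise \<subseteq> (\<Union>F\<in>Pow {..<K}. B1 F) \<union> (\<Union>j\<in>{- m..m}. B2 j)"
    by blast
  have B12s: "(\<Union>F\<in>Pow {..<K}. B1 F) \<in> sets noise" "(\<Union>j\<in>{- m..m}. B2 j) \<in> sets noise"
    by (intro sets.finite_UN B1s B2s; simp)+
  have b1: "measure noise (B1 F) \<le> 1 / 4 ^ K" for F
    unfolding B1_def using nn_integral_abs_noise_le[of F] by (intro noise_markov m1) auto
  have b2: "measure noise (B2 j) \<le> 16 * real_of_int m * (1 / 32) ^ K / e" if "j \<in> {- m..m}" for j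
  proof -
    have "measure noise (B2 j) \<le> 16 * \<bar>of_int j\<bar> * (1 / 32) ^ K / e"
      unfolding B2_def using nn_integral_gauss_path_diff_le[of j K] e by (intro noise_markov m2) auto
    also have "\<dots> \<le> 16 * real_of_int m * (1 / 32) ^ K / e"
      using that e by (intro divide_right_mono mult_right_mono mult_left_mono) auto
    finally show ?thesis .
  qed
  have "measure gauss_law (UNIV - ?U) = measure noise (gauss_path -` (UNIV - ?U) \<inter> space noise)"
    unfolding gauss_law_def using Us by (subst measure_distr[OF gauss_path_measurable]) auto
  also have "\<dots> \<le> measure noise ((\<Union>F\<in>Pow {..<K}. B1 F) \<union> (\<Union>j\<in>{- m..m}. B2 j))"
    using sub B12s by (intro noise.finite_measure_mono) auto
  also have "\<dots> \<le> measure noise (\<Union>F\<in>Pow {..<K}. B1 F) + measure noise (\<Union>j\<in>{- m..m}. B2 j)"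
    using B12s by (rule measure_Un_le)
  also have "\<dots> \<le> (\<Sum>F\<in>Pow {..<K}. measure noise (B1 F)) + (\<Sum>j\<in>{- m..m}. measure noise (B2 j))"
    using B1s B2s by (intro add_mono noise.finite_measure_subadditive_finite) auto
  also have "\<dots> \<le> (\<Sum>F\<in>Pow {..<K}. 1 / 4 ^ K) + (\<Sum>j\<in>{- m..m}. 16 * real_of_int m * (1 / 32) ^ K / e)"
    by (intro add_mono sum_mono b1 b2)
  also have "\<dots> = 2 ^ K / 4 ^ K + (2 * real_of_int m + 1) * (16 * real_of_int m * (1 / 32) ^ K / e)"
    using m by (simp add: card_Pow)
  also have "\<dots> \<le> 2 ^ K / 4 ^ K + (3 * real_of_int m) * (16 * real_of_int m * (1 / 32) ^ K / e)"
    using m e by (intro add_left_mono mult_right_mono) auto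
  also have "\<dots> = 2 ^ K / 4 ^ K + 48 * (real_of_int m)\<^sup>2 * (1 / 32) ^ K / e" by (simp add: power2_eq_square)
  also have "\<dots> \<le> 2 ^ K / 4 ^ K + 48 * (c * 4 ^ K)\<^sup>2 * (1 / 32) ^ K / e"
    using m e by (intro add_left_mono divide_right_mono mult_right_mono mult_left_mono power_mono) auto
  also have "2 ^ K / 4 ^ K = (1 / 2 :: real) ^ K" by (simp add: power_divide[symmetric])
  also have "48 * (c * 4 ^ K)\<^sup>2 * (1 / 32) ^ K / e = 48 * c\<^sup>2 / e * ((4 ^ K * 4 ^ K) * (1 / 32) ^ K)"
    by (simp add: power2_eq_square)
  also have "(4 ^ K * 4 ^ K) * (1 / 32 :: real) ^ K = (1 / 2) ^ K" by (simp add: power_mult_distrib[symmetric])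
  finally show ?thesis by (simp add: power_divide add_divide_distrib)
qed

text \<open>The level \<open>K\<close> is determined by \<open>4 ^ K \<le> n < 4 ^ (K + 1)\<close>.
  The logarithm of the number of tubes is at most \<open>2 ^ K * (2 + 3 * K)\<close>, hence
  eventually below \<open>\<gamma> * 4 ^ K\<close> and so below \<open>\<gamma> * n\<close>.\<close>

lemma gauss_law_tubes:
  assumes e: "0 < e" and \<gamma>: "0 < \<gamma>" and c: "1 \<le> c"
  shows "\<forall>\<^sub>F n in sequentially. \<exists>\<C>. finite \<C> \<and> \<C> \<subseteq> sets path_space \<and> real (card \<C>) \<le> exp (\<gamma> * real n) \<and>
    measure gauss_law (UNIV - \<Union>\<C>) \<le> \<gamma> \<and>
    (\<forall>C\<in>\<C>. \<forall>x\<in>C. \<forall>y\<in>C. \<forall>j. \<bar>j\<bar> \<le> c * (int n + 1) \<longrightarrow> \<bar>x j - y j\<bar> \<le> e)"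
proof -
  \<comment> \<open>Tubes have half-width \<open>2 * e'\<close>, so two paths in one tube differ by
    at most \<open>4 * e' = e\<close>.\<close>
  define e' where "e' = e / 4"
  have e': "0 < e'" using e by (simp add: e'_def)
  \<comment> \<open>The constant of \<open>measure_tubes_ge\<close> for \<open>4 * c\<close> in
    place of \<open>c\<close>, because \<open>c * (n + 1)\<close> is at most
    \<open>4 * c * 4 ^ K\<close>.\<close>
  define b where "b = 1 + 48 * (4 * real_of_int c)\<^sup>2 / e'"
  have "((\<lambda>K. 1 / 2 ^ K) \<longlonglongrightarrow> (0::real))" by real_asymp
  from order_tendstoD(2)[OF this e'] have ev1: "\<forall>\<^sub>F K in sequentially. 1 / 2 ^ K < e'" .
  have "((\<lambda>K. b / 2 ^ K) \<longlonglongrightarrow> 0)" by real_asymp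
  from order_tendstoD(2)[OF this \<gamma>] have ev2: "\<forall>\<^sub>F K in sequentially. b / 2 ^ K < \<gamma>" .
  have "((\<lambda>K. (2 + 3 * real K) / 2 ^ K) \<longlonglongrightarrow> 0)" by real_asymp
  from order_tendstoD(2)[OF this \<gamma>] have ev3: "\<forall>\<^sub>F K in sequentially. (2 + 3 * real K) / 2 ^ K < \<gamma>" .
  obtain K0 where K0: "\<And>K. K \<ge> K0 \<Longrightarrow> 1 / 2 ^ K < e' \<and> b / 2 ^ K < \<gamma> \<and> (2 + 3 * real K) / 2 ^ K < \<gamma>"
    using eventually_conj[OF ev1 eventually_conj[OF ev2 ev3]] by (auto simp: eventually_sequentially)
  show ?thesis
  proof (rule eventually_sequentiallyI[of "4 ^ K0"])
    fix n :: nat assume n: "4 ^ K0 \<le> n"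
    then have "1 \<le> n" by (meson one_le_numeral one_le_power order_trans)
    then obtain K where K: "4 ^ K \<le> n" "n < 4 ^ (K + 1)" using ex_power_ivl1[of 4 n] by auto
    have "4 ^ K0 < (4::nat) ^ (K + 1)" using n K by linarith
    then have "K0 < K + 1" by (rule power_less_imp_less_exp[rotated]) simp
    then have "K0 \<le> K" by simp
    note KK = K0[OF this]
    define m where "m = c * (int n + 1)"
    have m1: "1 \<le> m" unfolding m_def using c by (metis add_increasing mult_mono' mult_1 of_nat_0_le_iff order_refl zero_le_one)
    have "n + 1 \<le> 4 * 4 ^ K" using K by simp
    then have "real (n + 1) \<le> real (4 * 4 ^ K)" by (rule of_nat_mono)
    then have nK: "real n + 1 \<le> 4 * 4 ^ K" by simp
    have "real_of_int m = real_of_int c * (real n + 1)" by (simp add: m_def)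
    also have "\<dots> \<le> real_of_int c * (4 * 4 ^ K)" using c nK by (intro mult_left_mono) auto
    finally have m2: "real_of_int m \<le> 4 * real_of_int c * 4 ^ K" by simp
    define \<C> where "\<C> = (\<lambda>k. tube m (2 * e') (grid_path K k)) ` grid K"
    have "finite \<C>" unfolding \<C>_def using finite_grid by simp
    moreover have "\<C> \<subseteq> sets path_space" unfolding \<C>_def using tube_sets by auto
    moreover have "real (card \<C>) \<le> exp (\<gamma> * real n)"
    proof -
      have "real (card \<C>) \<le> real (card (grid K))" unfolding \<C>_def using card_image_le[OF finite_grid] by (intro of_nat_mono)
      also have "\<dots> \<le> exp (2 ^ K * (2 + 3 * real K))" by (rule card_grid_le)
      also have "\<dots> \<le> exp (\<gamma> * real n)"
      proof -
        have "2 + 3 * real K \<le> \<gamma> * 2 ^ K" using KK by (simp add: pos_divide_less_eq)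
        then have "2 ^ K * (2 + 3 * real K) \<le> 2 ^ K * (\<gamma> * 2 ^ K)" by (intro mult_left_mono) auto
        also have "\<dots> = \<gamma> * 4 ^ K" by (simp add: power_mult_distrib[symmetric])
        also have "\<dots> \<le> \<gamma> * real n" using \<gamma> K(1) by (intro mult_left_mono) (auto simp: numeral_power_le_of_nat_cancel_iff)
        finally show ?thesis by simp
      qed
      finally show ?thesis .
    qed
    moreover have "measure gauss_law (UNIV - \<Union>\<C>) \<le> \<gamma>"
      using measure_tubes_ge[OF e' _ m1 m2] KK unfolding \<C>_def b_def by simp
    moreover have "\<bar>x j - y j\<bar> \<le> e" if xy: "C \<in> \<C>" "x \<in> C" "y \<in> C" "\<bar>j\<bar> \<le> m" for C x y j
    proof -
      obtain u where u: "x \<in> tube m (2 * e') u" "y \<in> tube m (2 * e') u" using xy unfolding \<C>_def by blast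
      have "j \<in> {- m..m}" using xy by auto
      then have "\<bar>x j - u j\<bar> \<le> 2 * e'" "\<bar>y j - u j\<bar> \<le> 2 * e'" using u by (auto simp: tube_def)
      then show ?thesis unfolding e'_def by linarith
    qed
    ultimately show "\<exists>\<C>. finite \<C> \<and> \<C> \<subseteq> sets path_space \<and> real (card \<C>) \<le> exp (\<gamma> * real n) \<and>
      measure gauss_law (UNIV - \<Union>\<C>) \<le> \<gamma> \<and>
      (\<forall>C\<in>\<C>. \<forall>x\<in>C. \<forall>y\<in>C. \<forall>j. \<bar>j\<bar> \<le> c * (int n + 1) \<longrightarrow> \<bar>x j - y j\<bar> \<le> e)"
      unfolding m_def by (intro exI[of _ \<C>]) blast
  qed
qed

section \<open>Transfer to the reals\<close>

text \<open>Only cardinality matters: the measurable structure and the topology will be transported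
  along the injection, so it may be arbitrarily wild. Reals are read as sets of naturals, and a
  sequence of sets is coded by the set of pairs of index and element.\<close>

lemma sequences_inject_reals: "\<exists>f :: (int \<Rightarrow> real) \<Rightarrow> real. inj f"
proof -
  obtain g :: "nat set \<Rightarrow> real" where g: "bij g"
    using nat_sets_eqpoll_reals by (auto simp: eqpoll_def)
  define code where "code x = {prod_encode (int_encode i, k) | i k. k \<in> inv g (x i)}" for x :: "int \<Rightarrow> real"
  have "inj (\<lambda>x. g (code x))"
  proof (rule injI)
    fix x y assume "g (code x) = g (code y)"
    then have eq: "code x = code y" using g by (auto dest: bij_is_inj injD)
    have "k \<in> inv g (x i) \<longleftrightarrow> prod_encode (int_encode i, k) \<in> code x" for x :: "int \<Rightarrow> real" and i k
      by (auto simp: code_def int_encode_eq)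
    then have "inv g (x i) = inv g (y i)" for i using eq by blast
    then show "x = y" using bij_is_surj[OF g] by (intro ext) (metis surj_f_inv_f)
  qed
  then show ?thesis by blast
qed

lemma second_countable_euclidean: "second_countable (euclidean :: 'a::second_countable_topology topology)"
proof -
  obtain B :: "'a set set" where B: "countable B" "topological_basis B" using ex_countable_basis by blast
  have "\<exists>V\<in>B. x \<in> V \<and> V \<subseteq> U" if "open U" "x \<in> U" for U x
    by (rule topological_basisE[OF B(2) that]) blast
  then show ?thesis
    unfolding second_countable_def open_openin[symmetric]
    by (intro exI[of _ B] conjI B(1) ballI topological_basis_open[OF B(2)] allI impI) simp_all
qed

text \<open>The Polish topology on the range of \<open>enc\<close> is the one that makes
  \<open>enc\<close> a homeomorphism from the product space; it need not be related to the usual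
  topology of the reals.\<close>

lemma standard_probability_space_embed:
  assumes "inj enc"
  shows "standard_probability_space (embed_measure gauss_law enc)"
proof -
  let ?M = "embed_measure gauss_law enc"
  define dec where "dec = the_inv_into UNIV enc"
  have dec: "dec (enc x) = x" for x unfolding dec_def using assms by (simp add: the_inv_into_f_f)
  define X where "X = pullback_topology (range enc) dec euclidean"
  have top: "topspace X = range enc" by (simp add: X_def topspace_pullback_topology)
  have "homeomorphic_maps euclidean X enc dec"
    unfolding homeomorphic_maps_def
  proof (intro conjI)
    show "continuous_map euclidean X enc"
      unfolding X_def
    proof (rule continuous_map_pullback')
      show "continuous_map euclidean euclidean (dec \<circ> enc)" by (simp add: dec comp_def)
    qed auto
    show "continuous_map X euclidean dec"
      using continuous_map_pullback[of euclidean euclidean "\<lambda>x. x" "range enc" dec] by (simp add: X_def comp_def)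
  qed (auto simp: dec top)
  then have hom: "(euclidean :: (int \<Rightarrow> real) topology) homeomorphic_space X"
    by (auto simp: homeomorphic_space_def)
  have cm: "completely_metrizable_space X"
    using homeomorphic_completely_metrizable_space[OF hom] completely_metrizable_space_euclidean by blast
  have sep: "separable_space X"
    using homeomorphic_separable_space[OF hom] second_countable_imp_separable_space[OF second_countable_euclidean] by blast
  have "sets ?M = sets (vimage_algebra (range enc) dec gauss_law)"
    using sets_embed_eq_vimage_algebra[of enc gauss_law] assms by (simp add: dec_def)
  also have "\<dots> = sets (vimage_algebra (range enc) dec (sigma UNIV {S. open S}))"
    using sets_PiM_equal_borel by (intro sets_vimage_algebra_cong) (simp only: sets_gauss_law borel_def)
  also have "\<dots> = sets (sigma (range enc) {dec -` A \<inter> range enc | A. A \<in> {S. open S}})"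
    by (subst vimage_algebra_sigma) auto
  also have "\<dots> = sigma_sets (range enc) {dec -` A \<inter> range enc | A. A \<in> {S. open S}}"
    by (rule sets_measure_of) auto
  also have "{dec -` A \<inter> range enc | A. A \<in> {S. open S}} = {U. openin X U}"
    by (auto simp: X_def openin_pullback_topology)
  finally have "sets ?M = sigma_sets (topspace X) {U. openin X U}" by (simp only: top)
  moreover have "prob_space ?M"
    using gauss_law.prob_space_distr[OF measurable_embed_measure2[OF assms, of gauss_law]]
    by (simp add: embed_measure_eq_distr[OF assms, symmetric])
  ultimately show ?thesis
    unfolding standard_probability_space_def using cm sep top by (intro conjI exI[of _ X]) (auto simp: space_embed_measure)
qed

text \<open>The map \<open>\<Theta>\<close> carries the shift on the Gaussian path space to a conjugate system on the
  reals. Composing one fixed encoding with \<open>reflect\<close> gives the second transformation.\<close>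

locale gauss_model =
  fixes M :: "real measure" and \<Theta> :: "(int \<Rightarrow> real) \<Rightarrow> real" and Z :: "real \<Rightarrow> int \<Rightarrow> real"
  assumes \<Theta>: "\<Theta> \<in> measurable gauss_law M" and Z: "Z \<in> measurable M gauss_law"
    and distr_\<Theta>: "distr gauss_law M \<Theta> = M"
    and Z\<Theta> [simp]: "Z (\<Theta> x) = x" and \<Theta>Z: "y \<in> space M \<Longrightarrow> \<Theta> (Z y) = y"
begin

definition conj_shift :: "int \<Rightarrow> real \<Rightarrow> real" where
  "conj_shift p y = \<Theta> (shift p (Z y))"

lemma \<Theta>_space [simp]: "\<Theta> x \<in> space M"
  using measurable_space[OF \<Theta>] by simp

lemma prob_space_M: "prob_space M"
  using gauss_law.prob_space_distr[OF \<Theta>] by (simp add: distr_\<Theta>)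

lemma measure_M: "B \<in> sets M \<Longrightarrow> measure M B = measure gauss_law (\<Theta> -` B)"
  using measure_distr[OF \<Theta>, of B] by (simp add: distr_\<Theta>)

lemma \<Theta>_vimage: "B \<in> sets M \<Longrightarrow> \<Theta> -` B \<in> sets path_space"
  using measurable_sets[OF \<Theta>, of B] by simp

lemma Z_vimage: "B \<in> sets path_space \<Longrightarrow> Z -` B \<inter> space M \<in> sets M"
  using measurable_sets[OF Z, of B] by simp

lemma shift_measurable_gauss: "shift p \<in> measurable gauss_law gauss_law"
  using shift_measurable[of p] measurable_cong_sets[OF sets_gauss_law sets_gauss_law] by blast

lemma conj_shift_\<Theta>: "conj_shift p (\<Theta> x) = \<Theta> (shift p x)"
  by (simp add: conj_shift_def)

lemma conj_shift_space: "conj_shift p y \<in> space M"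
  by (simp add: conj_shift_def)

lemma conj_shift_measurable: "conj_shift p \<in> measurable M M"
  unfolding conj_shift_def[abs_def]
  by (rule measurable_compose[OF measurable_compose[OF Z shift_measurable_gauss] \<Theta>])

lemma distr_conj_shift: "distr M M (conj_shift p) = M"
proof -
  have "distr M M (conj_shift p) = distr (distr gauss_law M \<Theta>) M (conj_shift p)" by (simp only: distr_\<Theta>)
  also have "\<dots> = distr gauss_law M (\<lambda>x. \<Theta> (shift p x))"
    by (subst distr_distr[OF conj_shift_measurable \<Theta>]) (simp add: comp_def conj_shift_\<Theta>)
  also have "\<dots> = distr (distr gauss_law gauss_law (shift p)) M \<Theta>"
    by (subst distr_distr[OF \<Theta> shift_measurable_gauss]) (simp add: comp_def)
  also have "distr gauss_law gauss_law (shift p) = gauss_law"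
    using distr_shift[of p] by (simp cong: distr_cong)
  finally show ?thesis by (simp only: distr_\<Theta>)
qed

lemma shift_shift: "shift p (shift q x) = shift (p + q) x"
  by (rule ext) (simp add: shift_def algebra_simps)

lemma shift_0: "shift 0 x = x"
  by (rule ext) (simp add: shift_def)

lemma conj_shift_add: "conj_shift p (conj_shift q y) = conj_shift (p + q) y"
  by (simp add: conj_shift_def shift_shift)

lemma conj_shift_0: "y \<in> space M \<Longrightarrow> conj_shift 0 y = y"
  by (simp add: conj_shift_def shift_0 \<Theta>Z)

lemma bij_conj_shift: "bij_betw (conj_shift p) (space M) (space M)"
  by (rule bij_betw_byWitness[where f' = "conj_shift (- p)"])
     (auto simp: conj_shift_add conj_shift_0 conj_shift_space)

lemma inv_conj_shift: "y \<in> space M \<Longrightarrow> inv_into (space M) (conj_shift p) y = conj_shift (- p) y"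
  by (rule inv_into_f_eq[OF bij_betw_imp_inj_on[OF bij_conj_shift]])
     (auto simp: conj_shift_add conj_shift_0 conj_shift_space)

text \<open>Agreement with \<open>conj_shift p\<close> is required on \<open>space M\<close> only,
  so that the lemma also covers \<open>inv_into\<close>, which is controlled only there, and hence
  negative powers.\<close>

lemma funpow_conj_shift:
  assumes f: "\<And>y. y \<in> space M \<Longrightarrow> f y = conj_shift p y" and y: "y \<in> space M"
  shows "(f ^^ n) y = conj_shift (p * int n) y"
proof (induction n)
  case 0
  then show ?case using y by (simp add: conj_shift_0)
next
  case (Suc n)
  then show ?case by (simp add: f conj_shift_space conj_shift_add algebra_simps)
qed

lemma int_iterate_conj_shift:
  "y \<in> space M \<Longrightarrow> int_iterate M (conj_shift p) k y = conj_shift (p * k) y"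
  using funpow_conj_shift[of "conj_shift p" p y "nat k"]
    funpow_conj_shift[of "inv_into (space M) (conj_shift p)" "- p" y "nat (- k)"]
  by (auto simp: int_iterate_def inv_conj_shift)

lemma \<Theta>_vimage_iterate_preimage:
  "\<Theta> -` iterate_preimage M (conj_shift p) k B = shift (p * k) -` (\<Theta> -` B)"
  by (auto simp: iterate_preimage_def int_iterate_conj_shift conj_shift_\<Theta>)

lemma invertible_mpt_conj_shift: "invertible_mpt M (conj_shift p)"
  unfolding invertible_mpt_def
  using bij_conj_shift conj_shift_measurable distr_conj_shift
  by (auto simp: measurable_cong[OF inv_conj_shift])

lemma iterate_preimage_sets:
  assumes "B \<in> sets M"
  shows "iterate_preimage M (conj_shift p) k B \<in> sets M"
proof -
  have "iterate_preimage M (conj_shift p) k B = conj_shift (p * k) -` B \<inter> space M"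
    by (auto simp: iterate_preimage_def int_iterate_conj_shift)
  then show ?thesis using measurable_sets[OF conj_shift_measurable assms] by simp
qed

lemma mixing_conj_shift:
  assumes "p \<noteq> 0"
  shows "mixing M (conj_shift p)"
  unfolding mixing_def
proof (intro ballI)
  fix B1 B2 assume B: "B1 \<in> sets M" "B2 \<in> sets M"
  have "measure M (B1 \<inter> iterate_preimage M (conj_shift p) (int n) B2) =
      measure gauss_law (\<Theta> -` B1 \<inter> shift (p * int n) -` (\<Theta> -` B2))" for n
    using B iterate_preimage_sets by (subst measure_M) (auto simp only: vimage_Int \<Theta>_vimage_iterate_preimage)
  then show "(\<lambda>n. measure M (B1 \<inter> iterate_preimage M (conj_shift p) (int n) B2)) \<longlonglongrightarrow> measure M B1 * measure M B2"
    using gauss_mixing[OF assms \<Theta>_vimage[OF B(1)] \<Theta>_vimage[OF B(2)]] B by (simp only: measure_M)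
qed

text \<open>For good points the cell at time \<open>i\<close> is decided by coordinates at distance
  at most \<open>N\<close> from \<open>p * i\<close>. All coordinates that decide a name of length
  \<open>n\<close> thus lie in a window of length linear in \<open>n\<close>, and paths in the same
  tube have the same letters up to visits outside \<open>E\<close>.\<close>

lemma KS_entropy_conj_shift: "KS_entropy M (conj_shift p) = 0"
proof (rule KS_entropy_eq_0I[OF prob_space_M conj_shift_measurable distr_conj_shift])
  fix P \<gamma> assume P: "finite_partition M P" and \<gamma>: "0 < \<gamma>" "\<gamma> < (1::real)"
  define Q where "Q = (\<lambda>B. \<Theta> -` B) ` P"
  have "\<exists>E\<in>sets path_space. \<exists>\<eta>>0. \<exists>N. measure gauss_law (UNIV - E) \<le> \<gamma> \<and>
    (\<forall>x\<in>E. \<forall>y\<in>E. (\<forall>j. \<bar>j\<bar> \<le> N \<longrightarrow> \<bar>x j - y j\<bar> \<le> \<eta>) \<longrightarrow> (\<forall>B\<in>Q. x \<in> B \<longrightarrow> y \<in> B))"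
  proof (rule partition_separation)
    show "finite Q" "Q \<subseteq> sets path_space" using P \<Theta>_vimage by (auto simp: Q_def finite_partition_def)
    show "disjoint Q" using P by (fastforce simp: Q_def finite_partition_def disjoint_def)
    have "\<Theta> x \<in> \<Union>P" for x using P by (simp add: finite_partition_def)
    then show "\<Union>Q = UNIV" by (auto simp: Q_def)
  qed (rule \<gamma>)
  then obtain E \<eta> N where E: "E \<in> sets path_space" "0 < \<eta>" "measure gauss_law (UNIV - E) \<le> \<gamma>"
    and same: "\<And>x y B. x \<in> E \<Longrightarrow> y \<in> E \<Longrightarrow> (\<And>j. \<bar>j\<bar> \<le> N \<Longrightarrow> \<bar>x j - y j\<bar> \<le> \<eta>) \<Longrightarrow> B \<in> Q \<Longrightarrow> x \<in> B \<Longrightarrow> y \<in> B"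
    by (elim bexE exE conjE) metis
  \<comment> \<open>Chosen such that \<open>\<bar>j + p * i\<bar> \<le> c * (n + 1)\<close> whenever
    \<open>\<bar>j\<bar> \<le> N\<close> and \<open>i < n\<close>, for any sign of \<open>p\<close>
    and \<open>N\<close>.\<close>
  define c where "c = \<bar>p\<bar> + \<bar>N\<bar> + 1"
  have vimZ: "\<Theta> -` (space M - Z -` B \<inter> space M) = UNIV - B" for B by auto
  have measZ: "measure M (space M - Z -` B \<inter> space M) = measure gauss_law (UNIV - B)" if "B \<in> sets path_space" for B
    using Z_vimage[OF that] by (subst measure_M) (auto simp only: vimZ)
  have E': "Z -` E \<inter> space M \<in> sets M" "measure M (space M - Z -` E \<inter> space M) \<le> \<gamma>"
    using E Z_vimage by (auto simp: measZ)
  have c1: "1 \<le> c" by (simp add: c_def)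
  have "\<forall>\<^sub>F n in sequentially. \<exists>\<C>. finite \<C> \<and> \<C> \<subseteq> sets M \<and> real (card \<C>) \<le> exp (\<gamma> * real n) \<and>
      measure M (space M - \<Union>\<C>) \<le> \<gamma> \<and>
      (\<forall>C\<in>\<C>. \<forall>x\<in>C. \<forall>y\<in>C. \<forall>i<n. (conj_shift p ^^ i) x \<in> Z -` E \<inter> space M \<longrightarrow>
        (conj_shift p ^^ i) y \<in> Z -` E \<inter> space M \<longrightarrow>
        (\<forall>B\<in>P. (conj_shift p ^^ i) x \<in> B \<longrightarrow> (conj_shift p ^^ i) y \<in> B))"
    using gauss_law_tubes[OF E(2) \<gamma>(1) c1]
  proof eventually_elim
    case (elim n)
    then obtain \<C> where \<C>: "finite \<C>" "\<C> \<subseteq> sets path_space" "real (card \<C>) \<le> exp (\<gamma> * real n)"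
        "measure gauss_law (UNIV - \<Union>\<C>) \<le> \<gamma>"
      and close: "\<And>C x y j. C \<in> \<C> \<Longrightarrow> x \<in> C \<Longrightarrow> y \<in> C \<Longrightarrow> \<bar>j\<bar> \<le> c * (int n + 1) \<Longrightarrow> \<bar>x j - y j\<bar> \<le> \<eta>"
      by (elim exE conjE) metis
    define \<D> where "\<D> = (\<lambda>C. Z -` C \<inter> space M) ` \<C>"
    have "finite \<D>" "\<D> \<subseteq> sets M" using \<C> Z_vimage by (auto simp: \<D>_def)
    moreover have "real (card \<D>) \<le> exp (\<gamma> * real n)"
      using card_image_le[OF \<C>(1), of "\<lambda>C. Z -` C \<inter> space M"] \<C>(3) unfolding \<D>_def by linarith
    moreover have "measure M (space M - \<Union>\<D>) \<le> \<gamma>"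
    proof -
      have "\<Union>\<D> = Z -` (\<Union>\<C>) \<inter> space M" by (auto simp: \<D>_def)
      moreover have "\<Union>\<C> \<in> sets path_space" using \<C> by (intro sets.finite_Union) auto
      ultimately show ?thesis using \<C>(4) by (simp add: measZ)
    qed
    moreover have "(conj_shift p ^^ i) y \<in> B"
      if "D \<in> \<D>" "x \<in> D" "y \<in> D" "i < n" "(conj_shift p ^^ i) x \<in> Z -` E \<inter> space M"
        "(conj_shift p ^^ i) y \<in> Z -` E \<inter> space M" "B \<in> P" "(conj_shift p ^^ i) x \<in> B" for D x y i B
    proof -
      obtain C where C: "C \<in> \<C>" "Z x \<in> C" "Z y \<in> C" "x \<in> space M" "y \<in> space M"
        using \<open>D \<in> \<D>\<close> \<open>x \<in> D\<close> \<open>y \<in> D\<close> by (auto simp: \<D>_def)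
      have it: "(conj_shift p ^^ i) u = \<Theta> (shift (p * int i) (Z u))" if "u \<in> space M" for u
        by (simp only: funpow_conj_shift[OF refl that]) (simp add: conj_shift_def)
      have "shift (p * int i) (Z x) \<in> E" "shift (p * int i) (Z y) \<in> E"
        using that it C by auto
      moreover have "\<bar>shift (p * int i) (Z x) j - shift (p * int i) (Z y) j\<bar> \<le> \<eta>" if j: "\<bar>j\<bar> \<le> N" for j
      proof -
        have "\<bar>j + p * int i\<bar> \<le> \<bar>N\<bar> + \<bar>p\<bar> * int i" using j abs_mult[of p "int i"] by simp
        also have "\<dots> \<le> c * int i + c" unfolding c_def by (simp add: distrib_right)
        also have "\<dots> \<le> c * (int n + 1)" using c1 \<open>i < n\<close> by (simp add: distrib_left)
        finally show ?thesis unfolding shift_def using C by (intro close)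
      qed
      moreover have "\<Theta> -` B \<in> Q" using \<open>B \<in> P\<close> by (auto simp: Q_def)
      moreover have "shift (p * int i) (Z x) \<in> \<Theta> -` B" using that it C by simp
      ultimately have "shift (p * int i) (Z y) \<in> \<Theta> -` B" by (rule same)
      then show ?thesis using it C by simp
    qed
    ultimately show ?case by (intro exI[of _ \<D>]) blast
  qed
  then show "\<exists>E\<in>sets M. measure M (space M - E) \<le> \<gamma> \<and>
      (\<forall>\<^sub>F n in sequentially. \<exists>\<C>. finite \<C> \<and> \<C> \<subseteq> sets M \<and> real (card \<C>) \<le> exp (\<gamma> * real n) \<and>
        measure M (space M - \<Union>\<C>) \<le> \<gamma> \<and>
        (\<forall>C\<in>\<C>. \<forall>x\<in>C. \<forall>y\<in>C. \<forall>i<n. (conj_shift p ^^ i) x \<in> E \<longrightarrow> (conj_shift p ^^ i) y \<in> E \<longrightarrow>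
          (\<forall>B\<in>P. (conj_shift p ^^ i) x \<in> B \<longrightarrow> (conj_shift p ^^ i) y \<in> B)))"
    using E' by (intro bexI[of _ "Z -` E \<inter> space M"] conjI)
qed

end

text \<open>As \<open>R\<close> is a measure preserving involution, encoding after \<open>R\<close>
  and \<open>R\<close> after decoding are inverse to each other on the same space. The identity and
  \<open>reflect\<close> thus give two models with a common measure.\<close>

lemma gauss_modelI:
  assumes "inj enc" and R: "R \<in> measurable path_space path_space" "distr gauss_law path_space R = gauss_law" "\<And>x. R (R x) = x"
  shows "gauss_model (embed_measure gauss_law enc) (\<lambda>x. enc (R x)) (\<lambda>y. R (the_inv_into UNIV enc y))"
proof
  let ?M = "embed_measure gauss_law enc"
  let ?dec = "the_inv_into UNIV enc"
  have dec: "?dec (enc x) = x" for x using assms(1) by (simp add: the_inv_into_f_f)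
  have R': "R \<in> measurable gauss_law gauss_law"
    using R(1) measurable_cong_sets[OF sets_gauss_law sets_gauss_law] by blast
  have enc: "enc \<in> measurable gauss_law ?M" by (rule measurable_embed_measure2[OF assms(1)])
  show "(\<lambda>x. enc (R x)) \<in> measurable gauss_law ?M" by (rule measurable_compose[OF R' enc])
  show "(\<lambda>y. R (?dec y)) \<in> measurable ?M gauss_law"
    by (rule measurable_embed_measure1) (simp add: dec R')
  have "distr gauss_law ?M (\<lambda>x. enc (R x)) = distr (distr gauss_law gauss_law R) ?M enc"
    by (subst distr_distr[OF enc R']) (simp add: comp_def)
  also have "distr gauss_law gauss_law R = gauss_law" using R(2) by (simp cong: distr_cong)
  finally show "distr gauss_law ?M (\<lambda>x. enc (R x)) = ?M" by (simp add: embed_measure_eq_distr[OF assms(1), symmetric])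
  show "R (?dec (enc (R x))) = x" for x by (simp add: dec R(3))
  show "enc (R (R (?dec y))) = y" if "y \<in> space ?M" for y
    using that by (auto simp: space_embed_measure dec R(3))
qed

theorem theorem1p2:
  fixes c d :: int
  assumes "c \<noteq> 0" and "d \<noteq> 0"
  shows "\<exists>(M :: real measure) T S A.
    standard_probability_space M \<and>
    invertible_mpt M T \<and> invertible_mpt M S \<and>
    mixing M T \<and> mixing M S \<and>
    KS_entropy M T = 0 \<and> KS_entropy M S = 0 \<and>
    A \<in> sets M \<and> measure M A > 0 \<and>
    (\<forall>n::nat. n \<ge> 1 \<longrightarrow>
       A \<inter> iterate_preimage M T (c * int n) A \<inter> iterate_preimage M S (d * int n) A = {})"
proof -
  obtain enc :: "(int \<Rightarrow> real) \<Rightarrow> real" where enc: "inj enc" using sequences_inject_reals by blast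
  define M where "M = embed_measure gauss_law enc"
  define dec where "dec = the_inv_into UNIV enc"
  interpret T: gauss_model M enc dec
    unfolding M_def dec_def using gauss_modelI[OF enc, of "\<lambda>x. x"] by (simp add: distr_id2)
  interpret S: gauss_model M "\<lambda>x. enc (reflect x)" "\<lambda>y. reflect (dec y)"
    unfolding M_def dec_def using enc reflect_measurable distr_reflect reflect_reflect by (rule gauss_modelI)
  have "\<forall>\<^sub>F n in sequentially. cov (int n) < 1 / 2"
    using cov_tendsto_0 by (rule order_tendstoD) simp
  then obtain m0 where m0: "\<And>n. m0 \<le> n \<Longrightarrow> cov (int n) < 1 / 2" by (auto simp: eventually_sequentially)
  \<comment> \<open>Every shift length that will occur is a nonzero multiple of \<open>m\<close>, so
    its covariance is below \<open>1 / 2\<close>. The added \<open>1\<close> keeps \<open>m\<close>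
    positive.\<close>
  define m where "m = int m0 + 1"
  have cov_small: "cov q < 1 / 2" if "m \<le> \<bar>q\<bar>" for q
  proof -
    have "cov q = cov (int (nat \<bar>q\<bar>))" using cov_minus[of q] by (simp add: abs_if)
    moreover have "m0 \<le> nat \<bar>q\<bar>" using that by (simp add: m_def)
    ultimately show ?thesis using m0[of "nat \<bar>q\<bar>"] by (simp only:)
  qed
  \<comment> \<open>Both models read the same event off coordinate \<open>0\<close>, which
    \<open>reflect\<close> fixes. The upper end \<open>2\<close> is twice the lower end: a point of
    the intersection would satisfy \<open>2 < 2 * cov q * x 0 < x 0 < 2\<close>.\<close>
  define A where "A = {y \<in> space M. dec y 0 \<in> {1<..<2}}"
  define T where "T = T.conj_shift (m * d)"
  define S where "S = S.conj_shift (m * c)"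
  have slab: "{x. x 0 \<in> {1<..<2}} \<in> sets path_space"
    using measurable_sets[OF measurable_gauss_law_component, of "{1<..<2}" 0] by (simp add: vimage_def)
  have A_eq: "A = dec -` {x. x 0 \<in> {1<..<2}} \<inter> space M" by (auto simp: A_def)
  have A_sets: "A \<in> sets M" unfolding A_eq using slab by (rule T.Z_vimage)
  have "measure M A = measure std_normal_distribution {1<..<2}"
  proof -
    have "measure M A = measure gauss_law (enc -` A)" using A_sets by (rule T.measure_M)
    also have "enc -` A = {x. x 0 \<in> {1<..<2}}" by (auto simp: A_def)
    also have "measure gauss_law \<dots> = measure std_normal_distribution {1<..<2}"
      by (rule measure_gauss_law_component) simp
    finally show ?thesis .
  qed
  moreover have "measure std_normal_distribution {1<..<2} \<noteq> 0"
  proof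
    interpret N: prob_space std_normal_distribution by (rule prob_space_std_normal)
    assume "measure std_normal_distribution {1<..<2} = 0"
    then have "{1<..<2} \<in> null_sets std_normal_distribution" by (intro null_setsI) (auto simp: N.emeasure_eq_measure)
    then have "AE x in lborel. x \<in> {1<..<2} \<longrightarrow> ennreal (std_normal_density x) = 0"
      by (subst (asm) null_sets_density_iff) auto
    then have "AE x in lborel. x \<notin> {1<..<2::real}"
    proof eventually_elim
      case (elim x)
      then show ?case using normal_density_pos[of 1 0 x] by auto
    qed
    then have "emeasure lborel {1<..<2::real} = 0"
      using AE_iff_measurable[of "{1<..<2}" lborel "\<lambda>x. x \<notin> {1<..<2::real}"]
      by (simp add: greaterThanLessThan_eq Int_def)
    then show False by simp
  qed
  ultimately have A_pos: "0 < measure M A" using measure_nonneg[of M A] by linarith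
  have empty: "A \<inter> iterate_preimage M T (c * int n) A \<inter> iterate_preimage M S (d * int n) A = {}" if n: "1 \<le> n" for n
  proof (rule ccontr)
    define q where "q = m * d * (c * int n)"
    have q: "m * c * (d * int n) = q" by (simp add: q_def)
    assume "A \<inter> iterate_preimage M T (c * int n) A \<inter> iterate_preimage M S (d * int n) A \<noteq> {}"
    then obtain y where y: "y \<in> A" "y \<in> iterate_preimage M T (c * int n) A" "y \<in> iterate_preimage M S (d * int n) A"
      by blast
    have yM: "y \<in> space M" using y(1) by (simp add: A_def)
    define x where "x = dec y"
    have x0: "1 < x 0" "x 0 < 2" using y(1) by (auto simp: A_def x_def)
    have "T.conj_shift q y \<in> A"
      using y(2) yM by (simp add: iterate_preimage_def T_def T.int_iterate_conj_shift q_def)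
    then have x1: "1 < x q" by (simp add: A_def T.conj_shift_def x_def shift_def)
    have "S.conj_shift q y \<in> A"
      using y(3) yM by (simp add: iterate_preimage_def S_def S.int_iterate_conj_shift q)
    then have "1 < dec (enc (reflect (shift q (reflect x)))) 0" by (simp add: A_def S.conj_shift_def x_def)
    \<comment> \<open>The outer \<open>reflect\<close> acts at coordinate \<open>0\<close>, where it
      is the identity because \<open>cov 0 = 1\<close>; only the inner one changes the
      value.\<close>
    then have x2: "1 < 2 * cov q * x 0 - x q"
      by (simp add: T.Z\<Theta> reflect_def shift_def cov_0)
    have "m * 1 \<le> \<bar>q\<bar>"
    proof -
      have "\<bar>q\<bar> = m * \<bar>d * (c * int n)\<bar>" by (simp add: q_def abs_mult m_def)
      moreover have "1 \<le> \<bar>d * (c * int n)\<bar>" using assms n by (simp add: abs_mult[symmetric] int_one_le_iff_zero_less del: abs_mult)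
      ultimately show ?thesis by (simp add: m_def mult_left_mono)
    qed
    then have "cov q < 1 / 2" by (intro cov_small) simp
    then have "2 * cov q * x 0 < 1 * x 0" using x0 by (intro mult_strict_right_mono) auto
    then show False using x0 x1 x2 by linarith
  qed
  have nz: "m * d \<noteq> 0" "m * c \<noteq> 0" using assms by (auto simp: m_def)
  have "standard_probability_space M" unfolding M_def using enc by (rule standard_probability_space_embed)
  moreover have "invertible_mpt M T" "mixing M T" "KS_entropy M T = 0"
    unfolding T_def using nz T.invertible_mpt_conj_shift T.mixing_conj_shift T.KS_entropy_conj_shift by auto
  moreover have "invertible_mpt M S" "mixing M S" "KS_entropy M S = 0"
    unfolding S_def using nz S.invertible_mpt_conj_shift S.mixing_conj_shift S.KS_entropy_conj_shift by auto
  ultimately show ?thesis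
    using A_sets A_pos empty by (intro exI[of _ M] exI[of _ T] exI[of _ S] exI[of _ A]) auto
qed

end
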